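(* Let $P$ be a simple (not necessarily convex) hexagon with corners labeled $0,1,\dots,5$ cyclically, $[i]$ the angle at corner $i$, and $|\bar{i}|$ the length of the side $\bar i$ joining corners $i$ and $i+1$ (indices mod $6$). Suppose $[0]+[1]+[3]=[2]+[4]+[5]=2\pi$, $|\bar{1}|=|\bar{3}|$, $|\bar{2}|=|\bar{5}|$, and suppose moreover that each of $|\bar{0}|$, $|\bar{4}|$ differs from the lengths of all the other five sides, $|\bar{1}|\neq|\bar{2}|$, and $[2]\neq[3]$. Then there is, up to isometry of the plane, exactly one side-to-side tiling of the Euclidean plane by congruent copies of $P$ in which every vertex has degree $3$. This tiling is isohedral and periodic, and it covers a minimal torus tiling consisting of four tiles.
   Context: Tiles are congruent copies of $P$ under isometries of the plane. A tiling is side-to-side if its vertices and edges coincide with corners and sides of tiles; the degree of a vertex is the number of tiles meeting there. Isohedral: the symmetry group of the tiling acts transitively on tiles. Periodic: invariant under two linearly independent translations. A plane tiling invariant under a lattice $\Lambda$ of translations induces a tiling of the flat torus $\mathbb{C}/\Lambda$, and for a sublattice $\Lambda'\subset\Lambda$ the induced tiling of $\mathbb{C}/\Lambda'$ covers that of $\mathbb{C}/\Lambda$; the plane tiling itself covers each such torus tiling. A torus tiling $\mathcal{T}$ is minimal if whenever $\mathcal{T}$ covers a torus tiling $\mathcal{T}'$, then $\mathcal{T}=\mathcal{T}'$. *)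

theory Defs
  imports "HOL-Complex_Analysis.Complex_Analysis"
begin

text \<open>A hexagon is given by its corners \<open>p 0, \<dots>, p 5\<close> in the plane \<open>\<complex>\<close>, with indices read
  modulo 6. Either orientation of the boundary is allowed.\<close>

definition hexagon_path :: "(nat \<Rightarrow> complex) \<Rightarrow> real \<Rightarrow> complex" where
  "hexagon_path p =
     linepath (p 0) (p 1) +++ linepath (p 1) (p 2) +++ linepath (p 2) (p 3) +++
     linepath (p 3) (p 4) +++ linepath (p 4) (p 5) +++ linepath (p 5) (p 0)"

definition simple_hexagon :: "(nat \<Rightarrow> complex) \<Rightarrow> bool" where
  "simple_hexagon p \<longleftrightarrow> simple_path (hexagon_path p)"

definition side :: "(nat \<Rightarrow> complex) \<Rightarrow> nat \<Rightarrow> complex set" where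
  "side p i = closed_segment (p (i mod 6)) (p ((i + 1) mod 6))"

definition side_length :: "(nat \<Rightarrow> complex) \<Rightarrow> nat \<Rightarrow> real" where
  "side_length p i = dist (p (i mod 6)) (p ((i + 1) mod 6))"

definition counterclockwise :: "(nat \<Rightarrow> complex) \<Rightarrow> bool" where
  "counterclockwise p \<longleftrightarrow>
     (\<forall>z \<in> inside (path_image (hexagon_path p)). winding_number (hexagon_path p) z = 1)"

text \<open>The interior angle, in \<open>(0, 2\<pi>)\<close> for a simple hexagon: if the boundary runs counterclockwise,
  the interior at corner \<open>i\<close> is swept by turning the ray towards corner \<open>i + 1\<close> counterclockwise
  onto the ray towards corner \<open>i - 1\<close> (that is, \<open>i + 5\<close>); otherwise the rays change roles.\<close>

definition interior_angle :: "(nat \<Rightarrow> complex) \<Rightarrow> nat \<Rightarrow> real" where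
  "interior_angle p i =
     (let c = p (i mod 6); a = p ((i + 1) mod 6) - c; b = p ((i + 5) mod 6) - c
      in if counterclockwise p then Arg2pi (b / a) else Arg2pi (a / b))"

text \<open>An unlabelled polygon: a closed region together with its corners and sides. Recording the
  corners and sides keeps them well defined even if some angle equals \<open>\<pi>\<close>.\<close>

datatype polygon =
  Polygon (region: "complex set") (corners: "complex set") (sides: "complex set set")

definition hexagon :: "(nat \<Rightarrow> complex) \<Rightarrow> polygon" where
  "hexagon p =
     Polygon (path_image (hexagon_path p) \<union> inside (path_image (hexagon_path p)))
       (p ` {..<6}) (side p ` {..<6})"

definition plane_isometry :: "(complex \<Rightarrow> complex) \<Rightarrow> bool" where
  "plane_isometry f \<longleftrightarrow> (\<forall>x y. dist (f x) (f y) = dist x y)"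

definition move :: "(complex \<Rightarrow> complex) \<Rightarrow> polygon \<Rightarrow> polygon" where
  "move f P = Polygon (f ` region P) (f ` corners P) ((`) f ` sides P)"

definition congruent_copy :: "polygon \<Rightarrow> polygon \<Rightarrow> bool" where
  "congruent_copy P t \<longleftrightarrow> (\<exists>f. plane_isometry f \<and> t = move f P)"

definition plane_tiling :: "polygon \<Rightarrow> polygon set \<Rightarrow> bool" where
  "plane_tiling P T \<longleftrightarrow>
     (\<forall>t \<in> T. congruent_copy P t) \<and>
     (\<Union>t \<in> T. region t) = UNIV \<and>
     (\<forall>s \<in> T. \<forall>t \<in> T. s \<noteq> t \<longrightarrow> interior (region s) \<inter> interior (region t) = {})"

definition side_to_side :: "polygon set \<Rightarrow> bool" where
  "side_to_side T \<longleftrightarrow>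
     (\<forall>s \<in> T. \<forall>t \<in> T. s \<noteq> t \<longrightarrow>
        region s \<inter> region t = \<Union>(sides s \<inter> sides t) \<union> (corners s \<inter> corners t))"

definition tiling_vertices :: "polygon set \<Rightarrow> complex set" where
  "tiling_vertices T = (\<Union>t \<in> T. corners t)"

definition vertex_degree :: "polygon set \<Rightarrow> complex \<Rightarrow> nat" where
  "vertex_degree T v = card {t \<in> T. v \<in> region t}"

definition symmetry :: "polygon set \<Rightarrow> (complex \<Rightarrow> complex) \<Rightarrow> bool" where
  "symmetry T g \<longleftrightarrow> plane_isometry g \<and> move g ` T = T"

definition isohedral :: "polygon set \<Rightarrow> bool" where
  "isohedral T \<longleftrightarrow> (\<forall>s \<in> T. \<forall>t \<in> T. \<exists>g. symmetry T g \<and> move g s = t)"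

definition periodic :: "polygon set \<Rightarrow> bool" where
  "periodic T \<longleftrightarrow>
     (\<exists>u v. u \<noteq> v \<and> independent {u, v} \<and> symmetry T ((+) u) \<and> symmetry T ((+) v))"

definition plane_lattice :: "complex set \<Rightarrow> bool" where
  "plane_lattice L \<longleftrightarrow>
     (\<exists>u v. u \<noteq> v \<and> independent {u, v} \<and> L = {of_int m * u + of_int n * v | m n. True})"

definition lattice_invariant :: "complex set \<Rightarrow> polygon set \<Rightarrow> bool" where
  "lattice_invariant L T \<longleftrightarrow> (\<forall>l \<in> L. symmetry T ((+) l))"

text \<open>A tiling of the flat torus \<open>\<complex>/L\<close> is the pair of \<open>L\<close> and its set of tiles, where a tile of the
  torus is represented by the set of all its lifts to the plane, an \<open>L\<close>-orbit of plane tiles.\<close>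

type_synonym torus_tiling = "complex set \<times> polygon set set"

definition induced_torus_tiling :: "complex set \<Rightarrow> polygon set \<Rightarrow> torus_tiling" where
  "induced_torus_tiling L T = (L, (\<lambda>t. (\<lambda>l. move ((+) l) t) ` L) ` T)"

definition plane_covers :: "polygon \<Rightarrow> polygon set \<Rightarrow> torus_tiling \<Rightarrow> bool" where
  "plane_covers P T X \<longleftrightarrow>
     plane_tiling P T \<and>
     (\<exists>L. plane_lattice L \<and> lattice_invariant L T \<and> X = induced_torus_tiling L T)"

definition is_torus_tiling :: "polygon \<Rightarrow> torus_tiling \<Rightarrow> bool" where
  "is_torus_tiling P X \<longleftrightarrow> (\<exists>T. plane_covers P T X)"

definition torus_covers :: "polygon \<Rightarrow> torus_tiling \<Rightarrow> torus_tiling \<Rightarrow> bool" where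
  "torus_covers P X Y \<longleftrightarrow>
     (\<exists>T. plane_covers P T X \<and> plane_covers P T Y \<and> fst X \<subseteq> fst Y)"

definition minimal_torus_tiling :: "polygon \<Rightarrow> torus_tiling \<Rightarrow> bool" where
  "minimal_torus_tiling P X \<longleftrightarrow>
     is_torus_tiling P X \<and> (\<forall>Y. torus_covers P X Y \<longrightarrow> X = Y)"

definition degree3_tiling :: "polygon \<Rightarrow> polygon set \<Rightarrow> bool" where
  "degree3_tiling P T \<longleftrightarrow>
     plane_tiling P T \<and> side_to_side T \<and> (\<forall>v \<in> tiling_vertices T. vertex_degree T v = 3)"

end

theory Submission
  imports Defs
begin

text \<open>The angle conditions say that the orientation-reversing isometries carrying side 3 to side 1 and
  side 5 to side 2 are glide reflections with perpendicular axes. Together with the half-turns about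
  the midpoints of sides 0 and 4 they generate a group of type \<open>pgg\<close>, and in suitable coordinates it
  consists of the maps \<open>(x, y) \<mapsto> (\<plusminus>x + m a, \<plusminus>y + n b)\<close> with signs \<open>(-1)^n\<close> and \<open>(-1)^m\<close>.

  That the images of the hexagon tile the plane is shown with winding numbers. For a generic point,
  sum the winding number of the boundary over the orbit of the point. Moving the corners while keeping
  the side pairing changes the boundary by closed quadrilaterals, one for each side, and their
  contributions cancel along the pairing. So the sum is the same as for the fundamental rectangle with
  sides \<open>a\<close>, \<open>b\<close>, where it is \<open>\<plusminus>1\<close> (and 0 if the rectangle degenerates). Hence the rectangle does not
  degenerate and a generic point lies in exactly one image.

  In an arbitrary side-to-side tiling with vertices of degree 3, the side lengths only allow the
  corners \<open>{0, 1, 2}\<close>, \<open>{0, 1, 3}\<close>, \<open>{2, 4, 5}\<close> or \<open>{3, 4, 5}\<close> at a vertex, and the angles exclude the first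
  and the last. This determines the four neighbours of a tile given by the glide reflections, so the
  tiling contains the image of the whole group orbit, and it is equal to it because the orbit already
  covers the plane.\<close>

section \<open>Plane isometries\<close>

text \<open>The hexagon may be non-convex and its position relative to the glide axes is unknown, so
  no explicit fundamental domain is at hand; this is why coverings are counted. The count keeps the
  hexagon fixed and moves the point through its orbit, so that reflected tiles get the same sign as
  the others. It uses only additivity of angles, hence the comparison may go straight to the
  collapsed hexagon \<open>rect\<close>, without a deformation through simple hexagons. Angles have
  no meaning on the sides themselves, hence the generic points; closures and local finiteness then
  lead to all points.

  The angle hypotheses are used as relations between the unit vectors \<open>corner_dir\<close>, so
  that sums become products. Such a product fixes the relative position of the axes in
  \<open>normalization\<close>, and at a vertex of any tiling the quotients of consecutive rays
  multiply to 1. That three tiles fill a neighbourhood of a vertex comes from a connectedness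
  argument.

  The distinct lengths also make the hexagon asymmetric, so that a tile determines its isometry.
  This gives the count of four torus tiles and the minimality.\<close>

definition ori :: "bool \<Rightarrow> real" where
  "ori d = (if d then 1 else -1)"

text \<open>The flag \<open>d\<close> refines \<open>plane_isometry\<close> by the orientation,
  because a reflection changes the sign of every angle and of every winding number.\<close>

definition rigid :: "bool \<Rightarrow> (complex \<Rightarrow> complex) \<Rightarrow> bool" where
  "rigid d f \<longleftrightarrow> (\<exists>u w. norm u = 1 \<and> (\<forall>z. f z = u * (if d then z else cnj z) + w))"

lemma rigidI:
  "norm u = 1 \<Longrightarrow> (\<And>z. f z = u * (if d then z else cnj z) + w) \<Longrightarrow> rigid d f"
  unfolding rigid_def by blast

lemma rigidE:
  assumes "rigid d f"
  obtains u w where "norm u = 1" "\<And>z. f z = u * (if d then z else cnj z) + w"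
  using assms unfolding rigid_def by blast

lemma rigid_imp_dist: "rigid d f \<Longrightarrow> dist (f x) (f y) = dist x y"
proof (erule rigidE)
  fix u w assume u: "norm u = 1" and f: "\<And>z. f z = u * (if d then z else cnj z) + w"
  have "f x - f y = u * (if d then x - y else cnj (x - y))"
    by (auto simp: f algebra_simps)
  then have "norm (f x - f y) = norm (x - y)"
    using u by (simp add: norm_mult del: complex_cnj_diff)
  then show ?thesis by (simp add: dist_norm)
qed

text \<open>After subtracting \<open>f 0\<close> the map is linear and keeps norms, so it is
  determined by the unit vector \<open>u\<close>, the image of 1, and by \<open>v\<close>, the image
  of i divided by \<open>u\<close>. The length of the image of 1 + i forces \<open>v\<close> to be i
  or -i.\<close>

lemma plane_isometry_iff_rigid: "plane_isometry f \<longleftrightarrow> (\<exists>d. rigid d f)"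
proof
  assume "\<exists>d. rigid d f"
  then show "plane_isometry f" unfolding plane_isometry_def using rigid_imp_dist by blast
next
  assume f: "plane_isometry f"
  define h where "h z = f z - f 0" for z
  have "orthogonal_transformation h"
    unfolding orthogonal_transformation_isometry h_def
    using f by (simp add: plane_isometry_def dist_norm)
  then have lin: "linear h" and nrm: "\<And>z. norm (h z) = norm z"
    by (auto simp: orthogonal_transformation)
  define u where "u = h 1"
  define v where "v = h \<i> / u"
  have u: "norm u = 1" using nrm[of 1] by (simp add: u_def)
  then have u0: "u \<noteq> 0" by auto
  have hz: "h z = u * (of_real (Re z) + of_real (Im z) * v)" for z
  proof -
    have "z = Re z *\<^sub>R 1 + Im z *\<^sub>R \<i>" by (simp add: complex_eq_iff)
    then have "h z = h (Re z *\<^sub>R 1 + Im z *\<^sub>R \<i>)" by simp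
    also have "\<dots> = Re z *\<^sub>R u + Im z *\<^sub>R h \<i>"
      using lin by (simp add: linear_add linear_scale u_def)
    also have "\<dots> = u * (of_real (Re z) + of_real (Im z) * v)"
      using u0 by (simp add: v_def scaleR_conv_of_real algebra_simps)
    finally show ?thesis .
  qed
  have "norm v = 1" using nrm[of \<i>] u by (simp add: v_def norm_divide)
  moreover have "norm (1 + v) = norm (1 + \<i>)"
    using nrm[of "1 + \<i>"] hz[of "1 + \<i>"] u by (simp add: norm_mult)
  ultimately have "(Re v)\<^sup>2 + (Im v)\<^sup>2 = 1" "(1 + Re v)\<^sup>2 + (Im v)\<^sup>2 = 2"
    by (auto simp: cmod_def)
  moreover from this have "Re v = 0" by (simp add: power2_eq_square algebra_simps)
  ultimately have "Re v = 0" "(Im v)\<^sup>2 = 1" by auto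
  then have "v = \<i> \<or> v = - \<i>" by (auto simp: complex_eq_iff power2_eq_1_iff)
  then show "\<exists>d. rigid d f"
  proof
    assume v: "v = \<i>"
    have "rigid True f"
    proof (rule rigidI[OF u])
      fix z show "f z = u * (if True then z else cnj z) + f 0"
        using hz[of z] v complex_eq[of z] by (simp add: h_def algebra_simps)
    qed
    then show ?thesis ..
  next
    assume v: "v = - \<i>"
    have "rigid False f"
    proof (rule rigidI[OF u])
      fix z
      have c: "of_real (Re z) + of_real (Im z) * - \<i> = cnj z" by (simp add: complex_eq_iff)
      have "f z - f 0 = u * cnj z" using hz[of z] unfolding v c h_def .
      then show "f z = u * (if False then z else cnj z) + f 0" by (simp add: diff_eq_eq)
    qed
    then show ?thesis ..
  qed
qed

lemma rigid_isometry: "rigid d f \<Longrightarrow> plane_isometry f"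
  using plane_isometry_iff_rigid by blast

text \<open>The equation \<open>d = e\<close> encodes the product of the two orientation
  signs.\<close>

lemma rigid_comp:
  assumes "rigid d f" "rigid e g" shows "rigid (d = e) (f \<circ> g)"
proof -
  obtain u w where f: "norm u = 1" "\<And>z. f z = u * (if d then z else cnj z) + w"
    using assms(1) unfolding rigid_def by blast
  obtain u' w' where g: "norm u' = 1" "\<And>z. g z = u' * (if e then z else cnj z) + w'"
    using assms(2) unfolding rigid_def by blast
  show ?thesis
    by (rule rigidI[of "u * (if d then u' else cnj u')" _ _ "u * (if d then w' else cnj w') + w"])
      (use f g in \<open>auto simp: norm_mult algebra_simps\<close>)
qed

lemma rigid_inverse:
  assumes "rigid d f"
  obtains g where "rigid d g" "f \<circ> g = id" "g \<circ> f = id"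
proof -
  obtain u w where u: "norm u = 1" and f: "\<And>z. f z = u * (if d then z else cnj z) + w"
    using assms unfolding rigid_def by blast
  have uu: "u * cnj u = 1" using u by (simp add: complex_norm_square[symmetric])
  define g where "g z = (if d then cnj u * (z - w) else u * cnj (z - w))" for z
  have "rigid d g"
    by (rule rigidI[of "if d then cnj u else u" _ _ "if d then - cnj u * w else - u * cnj w"])
      (use u in \<open>auto simp: g_def algebra_simps\<close>)
  moreover have "f \<circ> g = id" "g \<circ> f = id"
  proof -
    have 1: "u * (cnj u * y) = y" "cnj u * (u * y) = y" for y
      using uu by (simp_all add: mult.assoc[symmetric] mult.commute[of "cnj u"])
    show "f \<circ> g = id" "g \<circ> f = id"
      by (simp_all add: fun_eq_iff f g_def 1)
  qed
  ultimately show thesis using that by blast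
qed

lemma rigid_inj: "rigid d f \<Longrightarrow> inj f"
  by (metis rigid_imp_dist dist_eq_0_iff injI)

lemma rigid_surj: "rigid d f \<Longrightarrow> surj f"
  by (metis rigid_inverse comp_def id_apply surj_def)

text \<open>The two ends of a shared side together with the orientation thus identify the isometry
  of a neighbouring tile.\<close>

lemma rigid_eqI:
  assumes "rigid d f" "rigid d g" "a \<noteq> b" "f a = g a" "f b = g b"
  shows "f = g"
proof -
  obtain u w where f: "norm u = 1" "\<And>z. f z = u * (if d then z else cnj z) + w"
    using assms(1) unfolding rigid_def by blast
  obtain u' w' where g: "norm u' = 1" "\<And>z. g z = u' * (if d then z else cnj z) + w'"
    using assms(2) unfolding rigid_def by blast
  have "(f a - f b) - (g a - g b) = (u - u') * (if d then a - b else cnj (a - b))"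
    unfolding f g by (simp add: algebra_simps)
  then have "(u - u') * (if d then a - b else cnj (a - b)) = 0"
    using assms(4,5) by simp
  then have "u = u'" using assms(3) by (auto split: if_splits)
  then show ?thesis using assms(4) f g by (auto simp: fun_eq_iff)
qed

text \<open>All angle notions here are arguments of quotients of differences, so this identity
  governs how \<open>ang\<close>, the side of a line and \<open>corner_dir\<close>
  transform.\<close>

lemma rigid_ratio:
  assumes "rigid d f"
  shows "(f z - f x) / (f b - f a) = (if d then (z - x) / (b - a) else cnj ((z - x) / (b - a)))"
proof -
  obtain u w where f: "norm u = 1" "\<And>z. f z = u * (if d then z else cnj z) + w"
    using assms(1) unfolding rigid_def by blast
  then have "u \<noteq> 0" by auto
  moreover have "f z - f x = u * (if d then z - x else cnj (z - x))" for z x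
    by (auto simp: f algebra_simps)
  ultimately show ?thesis by simp
qed

lemma rigid_Im_ratio:
  "rigid d f \<Longrightarrow> Im ((f z - f x) / (f b - f a)) = ori d * Im ((z - x) / (b - a))"
  unfolding rigid_ratio ori_def by (simp del: complex_cnj_divide complex_cnj_diff)

lemma rigid_segment:
  assumes "rigid d f"
  shows "f ` closed_segment a b = closed_segment (f a) (f b)"
    "f ` open_segment a b = open_segment (f a) (f b)"
proof -
  obtain u w where u: "norm u = 1" and f: "\<And>z. f z = u * (if d then z else cnj z) + w"
    using assms(1) unfolding rigid_def by blast
  define h where "h z = u * (if d then z else cnj z)" for z
  have lin: "linear h"
    by (rule linearI) (auto simp: h_def algebra_simps scaleR_conv_of_real)
  have fh: "f = (\<lambda>z. w + z) \<circ> h" by (auto simp: fun_eq_iff f h_def)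
  have "inj h" using rigid_inj[OF assms] unfolding fh by (simp add: inj_def)
  then show "f ` closed_segment a b = closed_segment (f a) (f b)"
    "f ` open_segment a b = open_segment (f a) (f b)"
    unfolding fh image_comp[symmetric] o_apply
    by (simp_all only: closed_segment_linear_image[OF lin, symmetric]
        open_segment_linear_image[OF lin, symmetric] closed_segment_translation open_segment_translation)
qed

lemma rigid_continuous: "rigid d f \<Longrightarrow> continuous_on S f"
  by (intro continuous_at_imp_continuous_on ballI)
    (force simp: continuous_at_eps_delta rigid_imp_dist dist_commute)

lemma rigid_homeomorphism:
  assumes "rigid d f" shows "\<exists>g. homeomorphism UNIV UNIV f g"
proof -
  obtain g where g: "rigid d g" "f \<circ> g = id" "g \<circ> f = id" using rigid_inverse[OF assms] .
  then have "homeomorphism UNIV UNIV f g"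
    using rigid_continuous[OF g(1)] rigid_continuous[OF assms] rigid_surj[OF g(1)] rigid_surj[OF assms]
    unfolding homeomorphism_def by (auto simp: fun_eq_iff)
  then show ?thesis by blast
qed

lemma rigid_open: "rigid d f \<Longrightarrow> open S \<Longrightarrow> open (f ` S)"
  using rigid_homeomorphism homeomorphism_imp_open_map[of UNIV UNIV f _ S] by fastforce

lemma rigid_closed: "rigid d f \<Longrightarrow> closed S \<Longrightarrow> closed (f ` S)"
  using rigid_homeomorphism homeomorphism_imp_closed_map[of UNIV UNIV f _ S] by fastforce

lemma rigid_ball: "rigid d f \<Longrightarrow> f ` ball x r = ball (f x) r"
proof -
  assume f: "rigid d f"
  { fix y assume "y \<in> ball (f x) r"
    moreover obtain z where "y = f z" using rigid_surj[OF f] by blast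
    ultimately have "y \<in> f ` ball x r" using rigid_imp_dist[OF f] by auto }
  then show ?thesis using rigid_imp_dist[OF f] by auto
qed

lemma rigid_interior: "rigid d f \<Longrightarrow> interior (f ` S) = f ` interior S"
proof -
  assume f: "rigid d f"
  obtain g where g: "rigid d g" "f \<circ> g = id" "g \<circ> f = id" using rigid_inverse[OF f] .
  then have gf: "g ` f ` X = X" "f ` g ` X = X" for X by (simp_all add: image_comp)
  have "f ` interior S \<subseteq> interior (f ` S)"
    by (intro interior_maximal rigid_open[OF f] image_mono interior_subset open_interior)
  moreover have "g ` interior (f ` S) \<subseteq> interior (g ` f ` S)"
    by (intro interior_maximal rigid_open[OF g(1)] image_mono interior_subset open_interior)
  then have "interior (f ` S) \<subseteq> f ` interior S" using gf by (metis image_mono)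
  ultimately show ?thesis by blast
qed

lemma move_comp: "move f (move g P) = move (f \<circ> g) P"
  by (simp add: move_def image_comp comp_def)

lemma move_id: "move id P = P"
  by (simp add: move_def)

section \<open>Winding numbers of hexagons\<close>

text \<open>The signed angle under which the segment from \<open>a\<close> to \<open>b\<close> is seen from \<open>z\<close>; the sum over a closed
  polygon is \<open>2\<pi>\<close> times its winding number. On the segment itself the value is junk.\<close>

definition ang :: "complex \<Rightarrow> complex \<Rightarrow> complex \<Rightarrow> real" where
  "ang a b z = Arg ((b - z) / (a - z))"

text \<open>If the quotient is a real t <= 0, then b - z is -t times z - a, so \<open>z\<close> lies
  on the segment with weight 1 / (1 - t) at \<open>b\<close>. Off the segment the quotient therefore
  avoids the cut of \<open>Arg\<close>, which gives continuity and oddness of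
  \<open>ang\<close>.\<close>

lemma not_in_segment_ratio:
  fixes a b z :: complex
  assumes "z \<notin> closed_segment a b"
  shows "(b - z) / (a - z) \<notin> \<real>\<^sub>\<le>\<^sub>0"
proof
  assume "(b - z) / (a - z) \<in> \<real>\<^sub>\<le>\<^sub>0"
  then have "(b - z) / (a - z) \<in> \<real>" "Re ((b - z) / (a - z)) \<le> 0"
    by (simp_all only: complex_nonpos_Reals_iff complex_is_Real_iff)
  then obtain t where t: "(b - z) / (a - z) = of_real t" "t \<le> 0"
    by (metis Reals_cases Re_complex_of_real)
  have az: "a \<noteq> z" using assms by auto
  then have "b - z = of_real t * (a - z)" using t(1) nonzero_divide_eq_eq[of "a - z" "b - z" "of_real t"] by simp
  then have "(1 - of_real t) * z = b - of_real t * a" by (simp add: algebra_simps)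
  then have "of_real s * ((1 - of_real t) * z) = of_real s * (b - of_real t * a)" for s :: real
    by simp
  from this[of "1 / (1 - t)"] have "of_real (1 / (1 - t) * (1 - t)) * z =
      of_real (1 / (1 - t)) * b - of_real (1 / (1 - t) * t) * a"
    unfolding of_real_mult of_real_diff of_real_1 by (simp only: algebra_simps)
  moreover have "1 / (1 - t) * (1 - t) = 1" "1 / (1 - t) * t = 1 / (1 - t) - 1"
    using t(2) by (auto simp: field_simps)
  ultimately have "z = (1 - 1 / (1 - t)) *\<^sub>R a + (1 / (1 - t)) *\<^sub>R b"
    by (simp only: scaleR_conv_of_real) (simp add: algebra_simps)
  also have "\<dots> \<in> closed_segment a b"
    unfolding closed_segment_def mem_Collect_eq
    using t(2) by (intro exI[of _ "1 / (1 - t)"] conjI refl) simp_all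
  finally show False using assms by simp
qed

text \<open>Makes the collapsed sides of \<open>rect\<close> disappear. At \<open>a = z\<close> the
  quotient is 0 / 0 = 0, and \<open>Arg\<close> is 0 there.\<close>

lemma ang_self: "ang a a z = 0"
  by (cases "a = z") (auto simp: ang_def Arg_zero)

lemma Arg_inverse_cnj:
  assumes "w \<notin> \<real>\<^sub>\<le>\<^sub>0"
  shows "Arg (inverse w) = - Arg w" "Arg (cnj w) = - Arg w"
proof -
  have "Arg w = 0" if "w \<in> \<real>"
  proof -
    have "0 \<le> Re w" using that assms by (auto simp: complex_nonpos_Reals_iff complex_is_Real_iff)
    then show ?thesis using that by (simp add: Arg_eq_0_iff)
  qed
  then show "Arg (inverse w) = - Arg w" "Arg (cnj w) = - Arg w"
    unfolding Arg_inverse Arg_cnj by auto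
qed

lemma ang_swap:
  assumes "z \<notin> closed_segment a b" shows "ang b a z = - ang a b z"
proof -
  have "inverse ((b - z) / (a - z)) = (a - z) / (b - z)" by (rule inverse_divide)
  then show ?thesis
    using Arg_inverse_cnj(1)[OF not_in_segment_ratio[OF assms]] by (simp only: ang_def)
qed

lemma ang_rigid:
  assumes "rigid d f" "z \<notin> closed_segment a b"
  shows "ang (f a) (f b) (f z) = ori d * ang a b z"
  using Arg_inverse_cnj(2)[OF not_in_segment_ratio[OF assms(2)]]
  unfolding ang_def rigid_ratio[OF assms(1)] ori_def
  by (simp del: complex_cnj_divide complex_cnj_diff)

text \<open>Seen from a distant \<open>z\<close>, the angle is a difference of values belonging to
  the two endpoints, because \<open>1 - x / z\<close> stays in the right half-plane, where arguments
  subtract without correction. Closed polygons hence telescope to 0.\<close>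

lemma ang_far:
  assumes "norm a < norm z" "norm b < norm z"
  shows "ang a b z = Arg (1 - b / z) - Arg (1 - a / z)"
proof -
  have pos: "0 < Re (1 - x / z)" if "norm x < norm z" for x
  proof -
    have "Re (x / z) \<le> norm (x / z)" by (rule complex_Re_le_cmod)
    also have "\<dots> < 1" using that by (auto simp: norm_divide divide_less_eq_1)
    finally show ?thesis by simp
  qed
  let ?A = "1 - a / z" and ?B = "1 - b / z"
  have z: "z \<noteq> 0" using assms(1) by auto
  have AB: "?A \<noteq> 0" "?B \<noteq> 0" using pos[OF assms(1)] pos[OF assms(2)] by force+
  have bd: "\<bar>Arg ?A\<bar> < pi / 2" "\<bar>Arg ?B\<bar> < pi / 2"
    using pos[OF assms(1)] pos[OF assms(2)] Arg_Re_pos by blast+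
  have "b - z = - z * ?B" "a - z = - z * ?A" using z by (simp_all add: field_simps)
  then have "(b - z) / (a - z) = (- z * ?B) / (- z * ?A)" by (simp only:)
  also have "\<dots> = ?B / ?A" using z by (metis mult_divide_mult_cancel_left neg_equal_0_iff_equal)
  finally have "(b - z) / (a - z) = ?B / ?A" .
  moreover have "Arg (?B / ?A) = Arg ?B - Arg ?A"
  proof (rule cis_Arg_unique)
    have "sgn ?B = cis (Arg ?B)" "sgn ?A = cis (Arg ?A)" using cis_Arg[OF AB(1)] cis_Arg[OF AB(2)] by simp_all
    then show "sgn (?B / ?A) = cis (Arg ?B - Arg ?A)"
      by (simp only: sgn_divide cis_divide)
  qed (use bd in \<open>auto simp: abs_less_iff\<close>)
  ultimately show ?thesis by (simp add: ang_def)
qed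

text \<open>\<open>Ln ((w - z) / (a - z))\<close> is a primitive along the whole segment, since the
  part from \<open>a\<close> to \<open>w\<close> also misses \<open>z\<close> and so the quotient
  avoids the cut. Taking the real part drops the contribution of the changing modulus.\<close>

lemma winding_number_linepath_ang:
  assumes "z \<notin> closed_segment a b"
  shows "Re (winding_number (linepath a b) z) = ang a b z / (2 * pi)"
proof -
  have az: "a \<noteq> z" using assms by auto
  have "(b - z) / (a - z) \<noteq> 0" using assms by auto
  have "((\<lambda>w. 1 / (w - z)) has_contour_integral (Ln ((b - z) / (a - z)) - Ln ((a - z) / (a - z)))) (linepath a b)"
  proof -
    have D: "((\<lambda>w. Ln ((w - z) / (a - z))) has_field_derivative 1 / (w - z)) (at w within closed_segment a b)"
      if w: "w \<in> closed_segment a b" for w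
    proof -
      have "closed_segment a w \<subseteq> closed_segment a b" using w by (simp add: subset_closed_segment)
      then have nr: "(w - z) / (a - z) \<notin> \<real>\<^sub>\<le>\<^sub>0" using not_in_segment_ratio[of z a w] assms by auto
      have "w \<noteq> z" using w assms by auto
      have "((\<lambda>w. (w - z) / (a - z)) has_field_derivative 1 / (a - z)) (at w within closed_segment a b)"
        using az by (auto intro!: derivative_eq_intros)
      then have "((\<lambda>w. Ln ((w - z) / (a - z))) has_field_derivative
          inverse ((w - z) / (a - z)) * (1 / (a - z))) (at w within closed_segment a b)"
        by (rule DERIV_chain2[where f = Ln and g = "\<lambda>w. (w - z) / (a - z)", OF has_field_derivative_Ln[OF nr]])
      moreover have "inverse ((w - z) / c) * (1 / c) = 1 / (w - z)" if "c \<noteq> 0" for c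
        using that by (simp add: field_simps)
      ultimately show ?thesis using az by simp
    qed
    have "((\<lambda>w. 1 / (w - z)) has_contour_integral
        ((\<lambda>w. Ln ((w - z) / (a - z))) (pathfinish (linepath a b)) - (\<lambda>w. Ln ((w - z) / (a - z))) (pathstart (linepath a b)))) (linepath a b)"
      by (rule contour_integral_primitive[where S = "closed_segment a b"]) (use D in auto)
    then show ?thesis by simp
  qed
  then have "contour_integral (linepath a b) (\<lambda>w. 1 / (w - z)) = Ln ((b - z) / (a - z))"
    using az by (simp add: contour_integral_unique)
  moreover have "winding_number (linepath a b) z = 1 / (2 * pi * \<i>) * contour_integral (linepath a b) (\<lambda>w. 1 / (w - z))"
    using assms by (intro winding_number_valid_path) auto
  ultimately have "winding_number (linepath a b) z = Ln ((b - z) / (a - z)) / (2 * pi * \<i>)" by simp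
  moreover have "Re (w / (2 * pi * \<i>)) = Im w / (2 * pi)" for w :: complex
  proof -
    have "w / (2 * pi * \<i>) = (- \<i> * w) / of_real (2 * pi)" by (simp add: field_simps)
    then show ?thesis by (simp only: Re_divide_of_real) simp
  qed
  ultimately show ?thesis
    using \<open>(b - z) / (a - z) \<noteq> 0\<close> by (simp add: ang_def Arg_eq_Im_Ln)
qed

lemma isCont_ang:
  assumes "x \<notin> closed_segment a b" shows "isCont (ang a b) x"
proof -
  have "isCont (\<lambda>z. (b - z) / (a - z)) x" using assms by (intro continuous_intros) auto
  then show ?thesis
    unfolding ang_def
    using continuous_at_Arg[OF not_in_segment_ratio[OF assms]] by (rule isCont_o2)
qed

declare One_nat_def [simp del]

definition total_ang :: "(nat \<Rightarrow> complex) \<Rightarrow> complex \<Rightarrow> real" where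
  "total_ang p z = (\<Sum>i<6. ang (p i) (p (Suc i mod 6)) z)"

abbreviation nx :: "nat \<Rightarrow> nat" where "nx k \<equiv> Suc k mod 6"

lemma less_6_cases:
  assumes "(i::nat) < 6"
  obtains "i = 0" | "i = 1" | "i = 2" | "i = 3" | "i = 4" | "i = 5"
  using assms by linarith

lemma Suc_mod_6:
  "Suc 0 mod 6 = 1" "Suc 1 mod 6 = 2" "Suc 2 mod 6 = 3" "Suc 3 mod 6 = 4" "Suc 4 mod 6 = 5" "Suc 5 mod 6 = 0"
  by (simp_all add: One_nat_def)

lemma sum_lessThan_6: "(\<Sum>i<6. f i) = f 0 + f 1 + f 2 + f 3 + f 4 + f (5::nat)"
proof -
  have "{..<6} = {0, 1, 2, 3, 4, 5::nat}" by auto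
  then show ?thesis by (simp add: add.assoc)
qed

lemma side_eq_segment: "i < 6 \<Longrightarrow> side p i = closed_segment (p i) (p (nx i))"
  by (simp add: side_def Suc_eq_plus1)

lemma path_image_hexagon_path: "path_image (hexagon_path p) = (\<Union>i<6. side p i)"
proof -
  have "{..<6} = {0, 1, 2, 3, 4, 5::nat}" by auto
  then show ?thesis by (simp add: hexagon_path_def path_image_join side_def Un_assoc)
qed

lemma hexagon_path_loop: "pathfinish (hexagon_path p) = pathstart (hexagon_path p)"
  by (simp add: hexagon_path_def)

lemma valid_hexagon_path: "valid_path (hexagon_path p)"
  by (simp add: hexagon_path_def)

lemma total_ang_winding_number:
  assumes z: "z \<notin> path_image (hexagon_path p)"
  shows "total_ang p z = 2 * pi * Re (winding_number (hexagon_path p) z)"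
proof -
  have n: "z \<notin> closed_segment (p 0) (p 1)" "z \<notin> closed_segment (p 1) (p 2)"
    "z \<notin> closed_segment (p 2) (p 3)" "z \<notin> closed_segment (p 3) (p 4)"
    "z \<notin> closed_segment (p 4) (p 5)" "z \<notin> closed_segment (p 5) (p 0)"
    using z by (simp_all add: hexagon_path_def path_image_join)
  have "Re (winding_number (hexagon_path p) z) = total_ang p z / (2 * pi)"
    unfolding hexagon_path_def total_ang_def sum_lessThan_6
    unfolding Suc_mod_6
    using n by (simp add: winding_number_join path_image_join winding_number_linepath_ang
        add_divide_distrib)
  then show ?thesis by simp
qed

text \<open>Thales: \<open>h\<^sup>2 < t * (1 - t)\<close> places the point inside the circle with
  diameter from \<open>a\<close> to \<open>b\<close>, where the segment is seen under an obtuse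
  angle; the sign of \<open>h\<close> gives the sign of the angle.\<close>

lemma ang_cross:
  assumes ab: "a \<noteq> b" and t: "0 < t" "t < 1" and x: "x = a + of_real t * (b - a)"
    and h: "h\<^sup>2 < t * (1 - t)"
  shows "0 < h \<Longrightarrow> pi / 2 \<le> ang a b (x + of_real h * \<i> * (b - a))"
    and "h < 0 \<Longrightarrow> ang a b (x + of_real h * \<i> * (b - a)) \<le> - (pi / 2)"
proof -
  let ?z = "x + of_real h * \<i> * (b - a)"
  let ?w = "Complex (1 - t) (- h) / Complex (- t) (- h)"
  have "b - ?z = (b - a) * Complex (1 - t) (- h)" "a - ?z = (b - a) * Complex (- t) (- h)"
    by (simp_all add: x Complex_eq algebra_simps)
  then have ang: "ang a b ?z = Arg ?w"
    using ab by (simp add: ang_def)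
  have d: "0 < t\<^sup>2 + h\<^sup>2" using t by (simp add: add_pos_nonneg)
  have "Re ?w = (h\<^sup>2 - t * (1 - t)) / (t\<^sup>2 + h\<^sup>2)"
    by (simp add: Re_divide power2_eq_square algebra_simps)
  then have re: "Re ?w < 0" using d h by (simp add: divide_less_0_iff)
  have im: "Im ?w = h / (t\<^sup>2 + h\<^sup>2)"
    by (simp add: Im_divide power2_eq_square algebra_simps)
  have "\<not> \<bar>Arg ?w\<bar> < pi / 2" using re unfolding Arg_Re_pos by auto
  moreover have "0 < h \<Longrightarrow> 0 < Arg ?w" using Arg_lt_pi[of ?w] im d by simp
  moreover have "h < 0 \<Longrightarrow> Arg ?w < 0" using Arg_less_0[of ?w] im d by (simp add: zero_le_divide_iff)
  ultimately show "0 < h \<Longrightarrow> pi / 2 \<le> ang a b ?z" "h < 0 \<Longrightarrow> ang a b ?z \<le> - (pi / 2)"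
    unfolding ang by linarith+
qed

section \<open>The boundary, interior and exterior of a simple hexagon\<close>

locale simple_hex =
  fixes p :: "nat \<Rightarrow> complex"
  assumes simple: "simple_hexagon p"
begin

abbreviation tile :: "(complex \<Rightarrow> complex) \<Rightarrow> polygon" where "tile g \<equiv> move g (hexagon p)"
definition bd :: "complex set" where "bd = path_image (hexagon_path p)"
definition ins :: "complex set" where "ins = inside bd"
definition reg :: "complex set" where "reg = bd \<union> ins"
definition sg :: real where "sg = ori (counterclockwise p)"

text \<open>Simplicity of the joined path unfolds to conditions on each side and the union of the
  later ones, where the first side may also meet them in \<open>p 0\<close>. Distinctness of
  non-adjacent corners follows, since equal corners would put a corner on a forbidden side; only
  then can the exceptional points be sharpened.\<close>

lemma side_intersections:
  shows "p 0 \<noteq> p 1" "p 0 \<noteq> p 2" "p 0 \<noteq> p 3" "p 0 \<noteq> p 4" "p 0 \<noteq> p 5"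
    "p 1 \<noteq> p 2" "p 1 \<noteq> p 3" "p 1 \<noteq> p 4" "p 1 \<noteq> p 5" "p 2 \<noteq> p 3" "p 2 \<noteq> p 4" "p 2 \<noteq> p 5"
    "p 3 \<noteq> p 4" "p 3 \<noteq> p 5" "p 4 \<noteq> p 5"
    and "side p 0 \<inter> side p 1 \<subseteq> {p 1}" "side p 1 \<inter> side p 2 \<subseteq> {p 2}" "side p 2 \<inter> side p 3 \<subseteq> {p 3}"
    "side p 3 \<inter> side p 4 \<subseteq> {p 4}" "side p 4 \<inter> side p 5 \<subseteq> {p 5}" "side p 0 \<inter> side p 5 \<subseteq> {p 0}"
    "side p 0 \<inter> side p 2 = {}" "side p 0 \<inter> side p 3 = {}" "side p 0 \<inter> side p 4 = {}"
    "side p 1 \<inter> side p 3 = {}" "side p 1 \<inter> side p 4 = {}" "side p 1 \<inter> side p 5 = {}"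
    "side p 2 \<inter> side p 4 = {}" "side p 2 \<inter> side p 5 = {}" "side p 3 \<inter> side p 5 = {}"
proof -
  let ?S = "side p"
  have s: "?S 0 = closed_segment (p 0) (p 1)" "?S 1 = closed_segment (p 1) (p 2)"
    "?S 2 = closed_segment (p 2) (p 3)" "?S 3 = closed_segment (p 3) (p 4)"
    "?S 4 = closed_segment (p 4) (p 5)" "?S 5 = closed_segment (p 5) (p 0)"
    by (simp_all add: side_def)
  have "simple_path (hexagon_path p)" using simple by (simp add: simple_hexagon_def)
  moreover have al: "arc (linepath a b) \<longleftrightarrow> a \<noteq> b" for a b :: complex
    using arc_distinct_ends[of "linepath a b"] arc_linepath by auto
  ultimately have F: "p 0 \<noteq> p 1" "p 1 \<noteq> p 2" "p 2 \<noteq> p 3" "p 3 \<noteq> p 4" "p 4 \<noteq> p 5" "p 5 \<noteq> p 0"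
    "?S 0 \<inter> (?S 1 \<union> (?S 2 \<union> (?S 3 \<union> (?S 4 \<union> ?S 5)))) \<subseteq> {p 0, p 1}"
    "?S 1 \<inter> (?S 2 \<union> (?S 3 \<union> (?S 4 \<union> ?S 5))) \<subseteq> {p 2}"
    "?S 2 \<inter> (?S 3 \<union> (?S 4 \<union> ?S 5)) \<subseteq> {p 3}" "?S 3 \<inter> (?S 4 \<union> ?S 5) \<subseteq> {p 4}"
    "?S 4 \<inter> ?S 5 \<subseteq> {p 5}"
    unfolding hexagon_path_def s
    by (simp_all add: simple_path_join_loop_eq arc_join_eq path_image_join)
  have m: "p 0 \<in> ?S 0" "p 1 \<in> ?S 0" "p 1 \<in> ?S 1" "p 2 \<in> ?S 1" "p 2 \<in> ?S 2" "p 3 \<in> ?S 2"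
    "p 3 \<in> ?S 3" "p 4 \<in> ?S 3" "p 4 \<in> ?S 4" "p 5 \<in> ?S 4" "p 5 \<in> ?S 5" "p 0 \<in> ?S 5"
    by (simp_all add: s)
  have G: "x \<in> ?S 1 \<Longrightarrow> x \<in> ?S 2 \<Longrightarrow> x = p 2" "x \<in> ?S 1 \<Longrightarrow> x \<in> ?S 3 \<Longrightarrow> x = p 2"
    "x \<in> ?S 1 \<Longrightarrow> x \<in> ?S 4 \<Longrightarrow> x = p 2" "x \<in> ?S 1 \<Longrightarrow> x \<in> ?S 5 \<Longrightarrow> x = p 2"
    "x \<in> ?S 2 \<Longrightarrow> x \<in> ?S 3 \<Longrightarrow> x = p 3" "x \<in> ?S 2 \<Longrightarrow> x \<in> ?S 4 \<Longrightarrow> x = p 3"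
    "x \<in> ?S 2 \<Longrightarrow> x \<in> ?S 5 \<Longrightarrow> x = p 3" "x \<in> ?S 3 \<Longrightarrow> x \<in> ?S 4 \<Longrightarrow> x = p 4"
    "x \<in> ?S 3 \<Longrightarrow> x \<in> ?S 5 \<Longrightarrow> x = p 4" "x \<in> ?S 4 \<Longrightarrow> x \<in> ?S 5 \<Longrightarrow> x = p 5"
    "x \<in> ?S 0 \<Longrightarrow> x \<in> ?S 1 \<Longrightarrow> x = p 0 \<or> x = p 1" "x \<in> ?S 0 \<Longrightarrow> x \<in> ?S 2 \<Longrightarrow> x = p 0 \<or> x = p 1"
    "x \<in> ?S 0 \<Longrightarrow> x \<in> ?S 3 \<Longrightarrow> x = p 0 \<or> x = p 1" "x \<in> ?S 0 \<Longrightarrow> x \<in> ?S 4 \<Longrightarrow> x = p 0 \<or> x = p 1"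
    "x \<in> ?S 0 \<Longrightarrow> x \<in> ?S 5 \<Longrightarrow> x = p 0 \<or> x = p 1" for x
    using F(7-11) by blast+
  show ne: "p 0 \<noteq> p 1" "p 1 \<noteq> p 2" "p 2 \<noteq> p 3" "p 3 \<noteq> p 4" "p 4 \<noteq> p 5" using F by auto
  show "?S 1 \<inter> ?S 2 \<subseteq> {p 2}" "?S 2 \<inter> ?S 3 \<subseteq> {p 3}" "?S 3 \<inter> ?S 4 \<subseteq> {p 4}" "?S 4 \<inter> ?S 5 \<subseteq> {p 5}"
    using G by blast+
  have p1: "p 1 \<notin> ?S 2" "p 1 \<notin> ?S 3" "p 1 \<notin> ?S 4" "p 1 \<notin> ?S 5"
    using G(1-4)[OF m(3)] ne by blast+
  have p2: "p 2 \<notin> ?S 3" "p 2 \<notin> ?S 4" "p 2 \<notin> ?S 5" using G(5-7)[OF m(5)] ne by blast+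
  have p3: "p 3 \<notin> ?S 4" "p 3 \<notin> ?S 5" using G(8,9)[OF m(7)] ne by blast+
  have p4: "p 4 \<notin> ?S 5" using G(10)[OF m(9)] ne by blast
  show n1: "p 0 \<noteq> p 5" using F(6) by (rule not_sym)
  show n2: "p 0 \<noteq> p 4" using p4 m(12) by metis
  show n3: "p 0 \<noteq> p 3" using p3(2) m(12) by metis
  show n4: "p 0 \<noteq> p 2" using p2(3) m(12) by metis
  show "p 3 \<noteq> p 5" using p3(2) m(11) by metis
  show "p 2 \<noteq> p 5" using p2(3) m(11) by metis
  show "p 1 \<noteq> p 5" using p1(4) m(11) by metis
  show "p 2 \<noteq> p 4" using p2(1) m(8) by metis
  show "p 1 \<noteq> p 4" using p1(2) m(8) by metis
  show "p 1 \<noteq> p 3" using p1(2) m(7) by metis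
  have p0: "p 0 \<notin> ?S 1" "p 0 \<notin> ?S 2" "p 0 \<notin> ?S 3" "p 0 \<notin> ?S 4"
    using G(4)[OF _ m(12)] G(7)[OF _ m(12)] G(9)[OF _ m(12)] G(10)[OF _ m(12)] n1 n2 n3 n4 by blast+
  show "?S 0 \<inter> ?S 1 \<subseteq> {p 1}" using G(11) p0(1) by blast
  show "?S 0 \<inter> ?S 5 \<subseteq> {p 0}" using G(15) p1(4) by blast
  show "?S 0 \<inter> ?S 2 = {}" using G(12) p0(2) p1(1) by blast
  show "?S 0 \<inter> ?S 3 = {}" using G(13) p0(3) p1(2) by blast
  show "?S 0 \<inter> ?S 4 = {}" using G(14) p0(4) p1(3) by blast
  show "?S 1 \<inter> ?S 3 = {}" using G(2) p2(1) by blast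
  show "?S 1 \<inter> ?S 4 = {}" using G(3) p2(2) by blast
  show "?S 1 \<inter> ?S 5 = {}" using G(4) p2(3) by blast
  show "?S 2 \<inter> ?S 4 = {}" using G(6) p3(1) by blast
  show "?S 2 \<inter> ?S 5 = {}" using G(7) p3(2) by blast
  show "?S 3 \<inter> ?S 5 = {}" using G(9) p4 by blast
qed

lemma corner_eq:
  assumes "i < 6" "j < 6" shows "p i = p j \<longleftrightarrow> i = j"
proof -
  note S = side_intersections(1-15)
  show ?thesis
    using assms by (elim less_6_cases) (use S in auto)
qed

lemma side_Int:
  assumes "i < 6" "j < 6" "i \<noteq> j"
  shows "side p i \<inter> side p j \<subseteq> {p i, p (nx i)}"
proof -
  note S = side_intersections(16-30)
  have M: "side p 0 \<inter> side p 1 \<subseteq> {p 0, p 1}"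
    "side p 1 \<inter> side p 0 \<subseteq> {p 1, p 2}"
    "side p 1 \<inter> side p 2 \<subseteq> {p 1, p 2}"
    "side p 2 \<inter> side p 1 \<subseteq> {p 2, p 3}"
    "side p 2 \<inter> side p 3 \<subseteq> {p 2, p 3}"
    "side p 3 \<inter> side p 2 \<subseteq> {p 3, p 4}"
    "side p 3 \<inter> side p 4 \<subseteq> {p 3, p 4}"
    "side p 4 \<inter> side p 3 \<subseteq> {p 4, p 5}"
    "side p 4 \<inter> side p 5 \<subseteq> {p 4, p 5}"
    "side p 5 \<inter> side p 4 \<subseteq> {p 5, p 0}"
    "side p 0 \<inter> side p 5 \<subseteq> {p 0, p 1}"
    "side p 5 \<inter> side p 0 \<subseteq> {p 5, p 0}"
        using S(1-6) by blast+
  show ?thesis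
    using assms by (elim less_6_cases; hypsubst) (simp_all only: Suc_mod_6 M S(7-15) S(7-15)[THEN trans[OF Int_commute]] empty_subsetI simp_thms)
qed

lemma jordan:
  shows "ins \<noteq> {}" "open ins" "bounded ins" "ins \<inter> outside bd = {}"
    "open (outside bd)" "ins \<union> outside bd = - bd" "frontier ins = bd" "frontier (outside bd) = bd"
    "compact bd"
proof -
  have "simple_path (hexagon_path p)" using simple by (simp add: simple_hexagon_def)
  from Jordan_inside_outside[OF this hexagon_path_loop]
  show "ins \<noteq> {}" "open ins" "bounded ins" "ins \<inter> outside bd = {}"
    "open (outside bd)" "ins \<union> outside bd = - bd" "frontier ins = bd" "frontier (outside bd) = bd"
    unfolding ins_def bd_def by blast+
  show "compact bd" unfolding bd_def
    using valid_path_imp_path[OF valid_hexagon_path] by (rule compact_path_image)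
qed

lemma not_reg: "z \<notin> reg \<longleftrightarrow> z \<in> outside bd"
  using jordan(4,6) unfolding reg_def by blast

lemma ins_bd_disjoint: "ins \<inter> bd = {}"
  using jordan(6) by blast

lemma closure_ins: "closure ins = reg"
  using jordan(7) by (simp add: closure_Un_frontier reg_def Un_commute)

lemma compact_reg: "compact reg"
  unfolding closure_ins[symmetric] using jordan(3) by (simp add: compact_closure)

lemma closed_reg: "closed reg"
  using compact_reg by (rule compact_imp_closed)

lemma ins_subset_reg: "ins \<subseteq> reg" by (simp add: reg_def)

text \<open>The boundary is the frontier of the exterior too, so every boundary point has exterior
  points nearby and cannot be interior to the region.\<close>

lemma interior_reg: "interior reg = ins"
proof
  show "ins \<subseteq> interior reg" by (rule interior_maximal[OF ins_subset_reg jordan(2)])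
  show "interior reg \<subseteq> ins"
  proof
    fix x assume x: "x \<in> interior reg"
    show "x \<in> ins"
    proof (rule ccontr)
      assume "x \<notin> ins"
      then have "x \<in> bd" using x interior_subset[of reg] unfolding reg_def by blast
      then have "x \<in> closure (outside bd)" using jordan(8) by (auto simp: frontier_def)
      then have "interior reg \<inter> outside bd \<noteq> {}"
        using x open_Int_closure_eq_empty[OF open_interior, of reg "outside bd"] by blast
      then show False using interior_subset[of reg] not_reg by blast
    qed
  qed
qed

lemma sg_cases: "sg = 1 \<or> sg = -1"
  by (simp add: sg_def ori_def)

lemma total_ang_ins:
  assumes "z \<in> ins" shows "total_ang p z = 2 * pi * sg"
proof -
  have z: "z \<notin> bd" using assms ins_bd_disjoint by blast
  have sp: "simple_path (hexagon_path p)" using simple by (simp add: simple_hexagon_def)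
  have "Re (winding_number (hexagon_path p) z) = sg"
  proof (cases "counterclockwise p")
    case True
    then have "winding_number (hexagon_path p) z = 1"
      using assms unfolding counterclockwise_def ins_def bd_def by blast
    then show ?thesis using True by (simp add: sg_def ori_def)
  next
    case False
    \<comment> \<open>The winding number is constantly 1 or constantly -1 inside, so a single
      failure of the value 1 decides.\<close>
    then have "winding_number (hexagon_path p) w = -1" if "w \<in> ins" for w
      using simple_closed_path_winding_number_inside[OF sp] that
      unfolding counterclockwise_def ins_def bd_def by metis
    then show ?thesis using False assms by (simp add: sg_def ori_def)
  qed
  then show ?thesis
    using total_ang_winding_number[of z p] z unfolding bd_def by simp
qed

lemma total_ang_outside:
  assumes "z \<notin> reg" shows "total_ang p z = 0"
proof -
  have "winding_number (hexagon_path p) z = 0"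
    using assms unfolding not_reg bd_def
    by (intro winding_number_zero_in_outside valid_path_imp_path valid_hexagon_path hexagon_path_loop)
  moreover have "z \<notin> bd" using assms by (simp add: reg_def)
  ultimately show ?thesis using total_ang_winding_number[of z p] unfolding bd_def by simp
qed

lemma bd_eq: "bd = (\<Union>i<6. side p i)"
  by (simp add: bd_def path_image_hexagon_path)

lemma corner_in_side: "i < 6 \<Longrightarrow> p i \<in> side p i" "i < 6 \<Longrightarrow> p (nx i) \<in> side p i"
  by (simp_all add: side_eq_segment)

lemma open_side_notin_other:
  assumes "k < 6" "j < 6" "j \<noteq> k" "x \<in> open_segment (p k) (p (nx k))"
  shows "x \<notin> side p j"
proof
  assume "x \<in> side p j"
  moreover have "x \<in> side p k" using assms by (simp add: side_eq_segment open_segment_def)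
  ultimately have "x \<in> {p k, p (nx k)}" using side_Int[of k j] assms by blast
  then show False using assms(4) by (auto simp: open_segment_def)
qed

text \<open>Each open half disc at \<open>x\<close> misses the boundary and is connected, so it lies
  wholly inside or wholly outside. Crossing the side changes its own angle by at least pi, while the
  angles of the other sides vary continuously, so the winding number is larger on the left. This
  decides which half is inside.\<close>

lemma local_side:
  assumes k: "k < 6" and x: "x \<in> open_segment (p k) (p (nx k))"
  obtains r where "0 < r"
    "\<And>z. z \<in> ball x r \<Longrightarrow> 0 < sg * Im ((z - x) / (p (nx k) - p k)) \<Longrightarrow> z \<in> ins"
    "\<And>z. z \<in> ball x r \<Longrightarrow> sg * Im ((z - x) / (p (nx k) - p k)) < 0 \<Longrightarrow> z \<notin> reg"
    "\<And>z. z \<in> ball x r \<Longrightarrow> Im ((z - x) / (p (nx k) - p k)) = 0 \<Longrightarrow> z \<in> side p k"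
proof -
  define a where "a = p k"
  define b where "b = p (nx k)"
  define e where "e = b - a"
  have sk: "side p k = closed_segment a b" using k by (simp add: side_eq_segment a_def b_def)
  obtain t where t: "0 < t" "t < 1" and xt0: "x = (1 - t) *\<^sub>R a + t *\<^sub>R b" and ab: "a \<noteq> b"
    using x unfolding in_segment a_def[symmetric] b_def[symmetric] by blast
  have xt: "x = a + of_real t * e"
    unfolding xt0 e_def by (simp add: scaleR_conv_of_real algebra_simps)
  have e0: "e \<noteq> 0" using ab by (simp add: e_def)
  define U where "U = (\<Union>j\<in>{..<6} - {k}. side p j)"
  have "closed U" unfolding U_def by (intro closed_UN) (auto simp: side_def)
  moreover have "x \<notin> U" using open_side_notin_other[OF k _ _ x] by (auto simp: U_def)
  ultimately obtain r1 where r1: "0 < r1" "ball x r1 \<inter> U = {}"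
    using open_contains_ball[of "- U"] by (metis ComplI disjoint_eq_subset_Compl open_Compl)
  \<comment> \<open>\<open>r1\<close> keeps away from the other sides; the second bound keeps points
    on the line of this side between its ends.\<close>
  define r where "r = min r1 (min t (1 - t) * norm e)"
  have r: "0 < r" using r1 t e0 by (simp add: r_def)
  define H where "H d = {z \<in> ball x r. 0 < d * Im ((z - x) / e)}" for d :: real
  have online: "z \<in> closed_segment a b" if z: "z \<in> ball x r" "Im ((z - x) / e) = 0" for z
  proof -
    define s where "s = Re ((z - x) / e)"
    have "(z - x) / e = of_real s" using z(2) by (simp add: s_def complex_eq_iff)
    then have zx: "z - x = of_real s * e" using e0 by (simp add: nonzero_divide_eq_eq)
    have "norm (z - x) < min t (1 - t) * norm e"
      using z(1) by (simp add: r_def dist_norm norm_minus_commute)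
    then have "\<bar>s\<bar> < min t (1 - t)" using e0 unfolding zx norm_mult by simp
    then have s: "0 \<le> t + s" "t + s \<le> 1" by auto
    have "z = x + of_real s * e" using zx by (simp add: algebra_simps)
    then have "z = (1 - (t + s)) *\<^sub>R a + (t + s) *\<^sub>R b"
      unfolding xt e_def by (simp add: scaleR_conv_of_real algebra_simps)
    then show ?thesis using s unfolding closed_segment_def by blast
  qed
  have onseg: "Im ((z - x) / e) = 0" if z: "z \<in> closed_segment a b" for z
  proof -
    obtain u where "z = (1 - u) *\<^sub>R a + u *\<^sub>R b" using z unfolding closed_segment_def by blast
    then have "z - x = of_real (u - t) * e"
      unfolding xt e_def by (simp add: scaleR_conv_of_real algebra_simps)
    then have "(z - x) / e = of_real (u - t)" using e0 by simp
    then show ?thesis by (simp only: Im_complex_of_real)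
  qed
  have H_bd: "H d \<inter> bd = {}" for d
  proof -
    have "z \<notin> bd" if z: "z \<in> H d" for z
    proof
      assume "z \<in> bd"
      then obtain j where j: "j < 6" "z \<in> side p j" unfolding bd_eq by auto
      have zr: "z \<in> ball x r" "Im ((z - x) / e) \<noteq> 0" using z by (auto simp: H_def)
      then have "z \<in> ball x r1" by (simp add: r_def)
      then have "j = k" using j r1(2) unfolding U_def by blast
      then show False using j sk onseg zr by blast
    qed
    then show ?thesis by blast
  qed
  have "convex {z. 0 < d * Im ((z - x) / e)}" for d
  proof (rule convexI)
    fix y z :: complex and u v :: real
    assume y: "y \<in> {z. 0 < d * Im ((z - x) / e)}" and z: "z \<in> {z. 0 < d * Im ((z - x) / e)}"
      and uv: "0 \<le> u" "0 \<le> v" "u + v = 1"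
    have "(u *\<^sub>R y + v *\<^sub>R z - x) / e = u *\<^sub>R ((y - x) / e) + v *\<^sub>R ((z - x) / e)"
    proof -
      have "u *\<^sub>R y + v *\<^sub>R z - x = u *\<^sub>R (y - x) + v *\<^sub>R (z - x) + ((u + v) *\<^sub>R x - x)"
        by (simp add: algebra_simps)
      then show ?thesis unfolding uv(3) by (simp add: add_divide_distrib scaleR_conv_of_real)
    qed
    then have "d * Im ((u *\<^sub>R y + v *\<^sub>R z - x) / e)
      = u * (d * Im ((y - x) / e)) + v * (d * Im ((z - x) / e))"
      by (simp add: algebra_simps)
    also have "\<dots> > 0"
    proof (cases "u = 0")
      case True then show ?thesis using z uv by simp
    next
      case False
      then show ?thesis using y z uv by (intro add_pos_nonneg mult_pos_pos[of u] mult_nonneg_nonneg[of v]) auto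
    qed
    finally show "u *\<^sub>R y + v *\<^sub>R z \<in> {z. 0 < d * Im ((z - x) / e)}" by simp
  qed
  moreover have "H d = ball x r \<inter> {z. 0 < d * Im ((z - x) / e)}" for d by (auto simp: H_def)
  ultimately have "connected (H d)" for d by (metis convex_Int convex_ball convex_connected)
  then have H_io: "H d \<subseteq> ins \<or> H d \<subseteq> outside bd" for d
    using connectedD[of "H d" ins "outside bd"] jordan(2,4,5,6) H_bd[of d] by blast
  define g where "g z = (\<Sum>j\<in>{..<6} - {k}. ang (p j) (p (nx j)) z)" for z
  have "isCont g x"
    unfolding g_def
  proof (intro continuous_sum isCont_ang)
    fix j assume "j \<in> {..<6} - {k}"
    then show "x \<notin> closed_segment (p j) (p (nx j))"
      using open_side_notin_other[OF k, of j x] x by (simp add: side_eq_segment)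
  qed
  then obtain \<delta> where \<delta>: "0 < \<delta>" "\<And>z. dist z x < \<delta> \<Longrightarrow> dist (g z) (g x) < pi / 2"
    unfolding continuous_at_eps_delta by (metis pi_half_gt_zero)
  have tg: "total_ang p z = g z + ang a b z" for z
    unfolding total_ang_def g_def a_def b_def
    using k by (subst sum.remove[of _ k]) auto
  \<comment> \<open>Small enough for three purposes: the test points stay in the ball, the other
    angles vary by less than pi / 2, and \<open>ang_cross\<close> applies.\<close>
  define h where "h = min (min r \<delta> / (2 * norm e)) (min t (1 - t) / 2)"
  have h: "0 < h" using r \<delta> e0 t by (simp add: h_def)
  have hh: "h\<^sup>2 < t * (1 - t)"
  proof -
    have "h < t" "h < 1 - t" using t by (auto simp: h_def min_def)
    then show ?thesis using h by (simp add: power2_eq_square mult_strict_mono)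
  qed
  have hn: "h * norm e < r" "h * norm e < \<delta>"
  proof -
    have "h * norm e \<le> min r \<delta> / (2 * norm e) * norm e" by (intro mult_right_mono) (auto simp: h_def)
    also have "\<dots> = min r \<delta> / 2" using e0 by simp
    finally show "h * norm e < r" "h * norm e < \<delta>" using r \<delta> by auto
  qed
  define zp where "zp = x + of_real h * \<i> * e"
  define zm where "zm = x + of_real (- h) * \<i> * e"
  have d: "dist zp x < r" "dist zm x < r" "dist zp x < \<delta>" "dist zm x < \<delta>"
    using hn h by (auto simp: zp_def zm_def dist_norm norm_mult)
  have ratio: "(zp - x) / e = of_real h * \<i>" "(zm - x) / e = of_real (- h) * \<i>"
    using e0 by (auto simp: zp_def zm_def)
  have "Im ((zp - x) / e) = h" "Im ((zm - x) / e) = - h" unfolding ratio by simp_all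
  then have inH: "zp \<in> H 1" "zm \<in> H (-1)"
    using d h by (auto simp: H_def dist_commute)
  have "total_ang p zm < total_ang p zp"
  proof -
    have "dist (g zp) (g x) < pi / 2" "dist (g zm) (g x) < pi / 2" using \<delta>(2) d by blast+
    moreover have "pi / 2 \<le> ang a b zp" "ang a b zm \<le> - (pi / 2)"
      using ang_cross(1)[OF ab t, of x h] ang_cross(2)[OF ab t, of x "- h"] h hh xt
      by (simp_all add: zp_def zm_def e_def)
    ultimately show ?thesis unfolding tg dist_real_def by linarith
  qed
  moreover have "zp \<in> ins \<or> zp \<notin> reg" "zm \<in> ins \<or> zm \<notin> reg"
    using inH H_bd unfolding reg_def by blast+
  ultimately have "(sg = 1 \<and> zp \<in> ins \<and> zm \<notin> reg) \<or> (sg = -1 \<and> zp \<notin> reg \<and> zm \<in> ins)"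
    using sg_cases total_ang_ins[of zp] total_ang_ins[of zm]
      total_ang_outside[of zp] total_ang_outside[of zm] by auto
  then have "H sg \<subseteq> ins" "H (- sg) \<subseteq> outside bd"
    using H_io[of 1] H_io[of "-1"] inH not_reg jordan(4) by auto
  then have "z \<in> ball x r \<Longrightarrow> 0 < sg * Im ((z - x) / e) \<Longrightarrow> z \<in> ins"
    "z \<in> ball x r \<Longrightarrow> sg * Im ((z - x) / e) < 0 \<Longrightarrow> z \<notin> reg" for z
    unfolding not_reg by (auto simp: H_def)
  then show thesis using that[OF r] online sk unfolding e_def a_def b_def by blast
qed

end

section \<open>The group and orbit sums\<close>

definition ps :: "int \<Rightarrow> int" where
  "ps k = (if even k then 1 else -1)"

lemma ps_sq: "ps k * ps k = 1" "ps k * (ps k * x) = x" "\<bar>ps k\<bar> = 1"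
  "real_of_int (ps k) * (real_of_int (ps k) * y) = y" "\<bar>real_of_int (ps k)\<bar> = 1"
  by (auto simp: ps_def)

lemma ps_add: "ps (m + n) = ps m * ps n" "ps (- m) = ps m" "ps (m * ps n) = ps m" "ps (ps n * m) = ps m"
  by (auto simp: ps_def)

text \<open>\<open>gg a b 1 0\<close> and \<open>gg a b 0 1\<close> are the glide reflections along the two axes. For \<open>a = 0\<close> or \<open>b = 0\<close> the
  parametrization is not injective, but the finiteness of orbits in balls still holds.\<close>

definition gg :: "real \<Rightarrow> real \<Rightarrow> int \<Rightarrow> int \<Rightarrow> complex \<Rightarrow> complex" where
  "gg a b m n z = Complex (ps n * Re z + m * a) (ps m * Im z + n * b)"

lemma gg_rigid: "rigid (even m = even n) (gg a b m n)"
  by (rule rigidI[of "of_int (ps n)" _ _ "Complex (m * a) (n * b)"])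
    (auto simp: gg_def ps_def complex_eq_iff)

lemma gg_comp: "gg a b m n \<circ> gg a b m' n' = gg a b (m + ps n * m') (n + ps m * n')"
  by (rule ext) (simp add: gg_def complex_eq_iff ps_add algebra_simps)

lemma gg_comp_apply: "gg a b m n (gg a b m' n' z) = gg a b (m + ps n * m') (n + ps m * n') z"
  using gg_comp[of a b m n m' n'] by (simp add: fun_eq_iff)

lemma gg_0: "gg a b 0 0 = id"
  by (rule ext) (simp add: gg_def complex_eq_iff ps_def)

lemma gg_inv: "gg a b (- (ps n * m)) (- (ps m * n)) \<circ> gg a b m n = id"
  "gg a b m n \<circ> gg a b (- (ps n * m)) (- (ps m * n)) = id"
  unfolding gg_comp by (simp_all add: gg_0 ps_add ps_sq)

lemma gg_inv_apply: "gg a b (- (ps n * m)) (- (ps m * n)) (gg a b m n z) = z"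
  "gg a b m n (gg a b (- (ps n * m)) (- (ps m * n)) z) = z"
  using gg_inv(1)[of a b n m] gg_inv(2)[of a b m n] by (simp_all add: fun_eq_iff)

definition orbit :: "real \<Rightarrow> real \<Rightarrow> complex \<Rightarrow> complex set" where
  "orbit a b z = {gg a b m n z | m n. True}"

lemma orbitI: "gg a b m n z \<in> orbit a b z"
  unfolding orbit_def by blast

lemma orbit_self: "z \<in> orbit a b z"
  using orbitI[of a b 0 0 z] by (simp add: gg_0)

lemma orbit_gg: "gg a b m n ` orbit a b z = orbit a b z"
proof
  show "gg a b m n ` orbit a b z \<subseteq> orbit a b z"
    by (clarsimp simp: orbit_def gg_comp_apply) blast
  show "orbit a b z \<subseteq> gg a b m n ` orbit a b z"
  proof
    fix w assume "w \<in> orbit a b z"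
    then have "gg a b (- (ps n * m)) (- (ps m * n)) w \<in> orbit a b z"
      by (clarsimp simp: orbit_def gg_comp_apply) blast
    then show "w \<in> gg a b m n ` orbit a b z" using gg_inv_apply(2)[of a b m n w] by (metis image_eqI)
  qed
qed

text \<open>The case \<open>a = 0\<close> is included since \<open>a\<close> and \<open>b\<close>
  are shown to be nonzero only by means of the orbit sums.\<close>

lemma finite_progression:
  "finite {x. (\<exists>m k::int. x = real_of_int (ps k) * c + real_of_int m * a) \<and> \<bar>x\<bar> \<le> R}" (is "finite ?X")
proof (cases "a = 0")
  case True
  then have "?X \<subseteq> {c, - c}" by (auto simp: ps_def)
  then show ?thesis by (rule finite_subset) simp
next
  case False
  define N where "N = \<lceil>(R + \<bar>c\<bar>) / \<bar>a\<bar>\<rceil>"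
  have "?X \<subseteq> (\<lambda>(s, m). s * c + real_of_int m * a) ` ({1, -1} \<times> {- N..N})"
  proof
    fix x assume "x \<in> ?X"
    then obtain m k where x: "x = real_of_int (ps k) * c + real_of_int m * a" "\<bar>x\<bar> \<le> R" by auto
    have "\<bar>real_of_int (ps k) * c\<bar> = \<bar>c\<bar>" by (simp add: abs_mult ps_sq)
    then have "\<bar>real_of_int m * a\<bar> \<le> R + \<bar>c\<bar>" using x by linarith
    then have "\<bar>real_of_int m\<bar> \<le> (R + \<bar>c\<bar>) / \<bar>a\<bar>" using False by (simp add: abs_mult field_simps)
    then have "\<bar>m\<bar> \<le> N" unfolding N_def by linarith
    then show "x \<in> (\<lambda>(s, m). s * c + real_of_int m * a) ` ({1, -1} \<times> {- N..N})"
      using x by (intro image_eqI[of _ _ "(real_of_int (ps k), m)"]) (auto simp: ps_def)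
  qed
  then show ?thesis by (rule finite_subset) simp
qed

lemma orbit_finite: "finite (orbit a b z \<inter> cball 0 R)"
proof -
  let ?X = "{x. (\<exists>m k::int. x = real_of_int (ps k) * Re z + real_of_int m * a) \<and> \<bar>x\<bar> \<le> R}"
  let ?Y = "{x. (\<exists>m k::int. x = real_of_int (ps k) * Im z + real_of_int m * b) \<and> \<bar>x\<bar> \<le> R}"
  have "orbit a b z \<inter> cball 0 R \<subseteq> (\<lambda>(x, y). Complex x y) ` (?X \<times> ?Y)"
  proof
    fix w assume w: "w \<in> orbit a b z \<inter> cball 0 R"
    then obtain m n where wm: "w = gg a b m n z" by (auto simp: orbit_def)
    have "\<bar>Re w\<bar> \<le> R" "\<bar>Im w\<bar> \<le> R"
      using w abs_Re_le_cmod[of w] abs_Im_le_cmod[of w] by auto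
    then show "w \<in> (\<lambda>(x, y). Complex x y) ` (?X \<times> ?Y)"
      by (intro image_eqI[of _ _ "(Re w, Im w)"]) (auto simp: wm gg_def)
  qed
  then show ?thesis by (rule finite_subset) (intro finite_imageI finite_cartesian_product finite_progression)
qed

text \<open>The ball is not invariant under \<open>gg a b m n\<close>, but the sums only see the
  orbit points with a nonzero summand, and these sets correspond under the map.\<close>

lemma orbit_sum_invariant:
  fixes f :: "complex \<Rightarrow> real"
  assumes f: "\<And>w. w \<in> orbit a b z \<Longrightarrow> R < norm w \<Longrightarrow> f w = 0"
    and fh: "\<And>w. w \<in> orbit a b z \<Longrightarrow> R < norm w \<Longrightarrow> f (gg a b m n w) = 0"
  shows "(\<Sum>w\<in>orbit a b z \<inter> cball 0 R. f (gg a b m n w)) = (\<Sum>w\<in>orbit a b z \<inter> cball 0 R. f w)"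
proof -
  let ?h = "gg a b m n" and ?O = "orbit a b z"
  have "(\<Sum>w\<in>?O \<inter> cball 0 R. f (?h w)) = (\<Sum>w\<in>{w \<in> ?O. f (?h w) \<noteq> 0}. f (?h w))"
    using fh by (intro sum.mono_neutral_right orbit_finite) (force simp: not_less[symmetric])+
  also have "\<dots> = (\<Sum>w\<in>{w \<in> ?O. f w \<noteq> 0}. f w)"
  proof (rule sum.reindex_bij_betw)
    have "inj ?h" using gg_rigid by (rule rigid_inj)
    moreover have "?h ` {w \<in> ?O. f (?h w) \<noteq> 0} = {w \<in> ?O. f w \<noteq> 0}"
      using orbit_gg[of a b m n z] by (auto simp: set_eq_iff image_iff) metis+
    ultimately show "bij_betw ?h {w \<in> ?O. f (?h w) \<noteq> 0} {w \<in> ?O. f w \<noteq> 0}"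
      unfolding bij_betw_def by (auto intro: inj_on_subset)
  qed
  also have "\<dots> = (\<Sum>w\<in>?O \<inter> cball 0 R. f w)"
    using f by (intro sum.mono_neutral_left orbit_finite) (force simp: not_less[symmetric])+
  finally show ?thesis .
qed

text \<open>The contribution of one side when a hexagon with corners \<open>c, d, \<dots>\<close> is replaced by one with corners
  \<open>c', d', \<dots>\<close>: the closed quadrilateral \<open>c d d' c'\<close>.\<close>

definition quad_ang :: "complex \<Rightarrow> complex \<Rightarrow> complex \<Rightarrow> complex \<Rightarrow> complex \<Rightarrow> real" where
  "quad_ang c d c' d' w = ang c d w + ang d d' w - ang c' d' w - ang c c' w"

definition off_quad :: "complex \<Rightarrow> complex \<Rightarrow> complex \<Rightarrow> complex \<Rightarrow> complex \<Rightarrow> bool" where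
  "off_quad c d c' d' w \<longleftrightarrow> w \<notin> closed_segment c d \<and> w \<notin> closed_segment d d' \<and>
     w \<notin> closed_segment c' d' \<and> w \<notin> closed_segment c c'"

lemma quad_ang_far:
  "norm c < norm w \<Longrightarrow> norm d < norm w \<Longrightarrow> norm c' < norm w \<Longrightarrow> norm d' < norm w \<Longrightarrow>
    quad_ang c d c' d' w = 0"
  by (simp add: quad_ang_def ang_far)

lemma quad_ang_swap: "off_quad c d c' d' w \<Longrightarrow> quad_ang d c d' c' w = - quad_ang c d c' d' w"
  using ang_swap[of w c d] ang_swap[of w c' d'] by (simp add: quad_ang_def off_quad_def)

lemma quad_ang_rigid:
  "rigid e f \<Longrightarrow> off_quad c d c' d' w \<Longrightarrow>
    quad_ang (f c) (f d) (f c') (f d') (f w) = ori e * quad_ang c d c' d' w"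
  by (simp add: quad_ang_def off_quad_def ang_rigid algebra_simps)

text \<open>The quadrilateral and the point are moved together, and then the orbit is reindexed. The
  sign -1 of a glide reflection is what makes two paired sides cancel.\<close>

lemma orbit_sum_paired:
  fixes a b :: real and z :: complex and R :: real
  defines "X \<equiv> orbit a b z"
  defines "S \<equiv> \<lambda>c d c' d'. (\<Sum>w\<in>X \<inter> cball 0 R. quad_ang c d c' d' w)"
  assumes off: "\<And>w. w \<in> X \<Longrightarrow> off_quad c d c' d' w"
    and R: "norm c \<le> R" "norm d \<le> R" "norm c' \<le> R" "norm d' \<le> R"
      "norm (gg a b m n c) \<le> R" "norm (gg a b m n d) \<le> R" "norm (gg a b m n c') \<le> R" "norm (gg a b m n d') \<le> R"
  shows "S (gg a b m n c) (gg a b m n d) (gg a b m n c') (gg a b m n d') = ori (even m = even n) * S c d c' d'"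
proof -
  let ?h = "gg a b m n"
  have eq: "quad_ang (?h c) (?h d) (?h c') (?h d') (?h w) = ori (even m = even n) * quad_ang c d c' d' w"
    if "w \<in> X" for w
    using off[OF that] by (rule quad_ang_rigid[OF gg_rigid])
  have "S (?h c) (?h d) (?h c') (?h d') = (\<Sum>w\<in>X \<inter> cball 0 R. quad_ang (?h c) (?h d) (?h c') (?h d') (?h w))"
    unfolding S_def X_def
  proof (rule orbit_sum_invariant[symmetric])
    fix w :: complex assume "R < norm w"
    then show "quad_ang (?h c) (?h d) (?h c') (?h d') w = 0" using R by (intro quad_ang_far) auto
  next
    fix w assume w: "w \<in> orbit a b z" "R < norm w"
    then have "quad_ang c d c' d' w = 0" using R by (intro quad_ang_far) auto
    then show "quad_ang (?h c) (?h d) (?h c') (?h d') (?h w) = 0" using eq w unfolding X_def by simp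
  qed
  also have "\<dots> = ori (even m = even n) * S c d c' d'"
    using eq by (simp add: S_def sum_distrib_left)
  finally show ?thesis .
qed

text \<open>Side 3 is carried to side 1 and side 5 to side 2; the half-turns about the midpoints of sides 0
  and 4 are the products of these glide reflections, see \<open>paired_halfturns\<close>.\<close>

definition paired :: "real \<Rightarrow> real \<Rightarrow> (nat \<Rightarrow> complex) \<Rightarrow> bool" where
  "paired a b q \<longleftrightarrow> q 1 = gg a b 1 0 (q 3) \<and> q 2 = gg a b 1 0 (q 4) \<and>
     q 3 = gg a b 0 1 (q 0) \<and> q 2 = gg a b 0 1 (q 5)"

lemma paired_halfturns:
  assumes "paired a b q"
  shows "gg a b 1 (-1) (q 0) = q 1" "gg a b 1 (-1) (q 1) = q 0"
    "gg a b (-1) (-1) (q 4) = q 5" "gg a b (-1) (-1) (q 5) = q 4"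
proof -
  have 1: "gg a b 1 0 (gg a b 0 1 z) = gg a b 1 (-1) z" "gg a b 1 (-1) (gg a b 1 (-1) z) = z"
    "gg a b (-1) (-1) (gg a b (-1) (-1) z) = z"
    "gg a b 0 (-1) (gg a b 1 0 z) = gg a b (-1) (-1) z" "gg a b 0 (-1) (gg a b 0 1 z) = z" for z
    by (simp_all add: gg_comp_apply ps_def gg_0)
  note P = assms[unfolded paired_def]
  show "gg a b 1 (-1) (q 0) = q 1" using P 1(1) by metis
  then show "gg a b 1 (-1) (q 1) = q 0" using 1(2) by metis
  have "gg a b 0 (-1) (q 2) = q 5" using P 1(5) by metis
  then show "gg a b (-1) (-1) (q 4) = q 5" using P 1(4) by metis
  then show "gg a b (-1) (-1) (q 5) = q 4" using 1(3) by metis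
qed

text \<open>The angles of the segments from \<open>q i\<close> to \<open>q' i\<close> cancel around
  the cycle, leaving one quadrilateral for each side. Those of sides 1 and 3, and of 2 and 5,
  correspond under glide reflections and have opposite sums; sides 0 and 4 are reversed by a
  half-turn, so their sums equal their own negatives.\<close>

lemma orbit_sum_total_ang:
  assumes P: "paired a b q" "paired a b q'"
    and R: "\<And>i. i < 6 \<Longrightarrow> norm (q i) \<le> R" "\<And>i. i < 6 \<Longrightarrow> norm (q' i) \<le> R"
    and off: "\<And>w i. w \<in> orbit a b z \<Longrightarrow> i < 6 \<Longrightarrow>
      off_quad (q i) (q (nx i)) (q' i) (q' (nx i)) w"
  shows "(\<Sum>w\<in>orbit a b z \<inter> cball 0 R. total_ang q w) = (\<Sum>w\<in>orbit a b z \<inter> cball 0 R. total_ang q' w)"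
proof -
  define S where "S c d c' d' = (\<Sum>w\<in>orbit a b z \<inter> cball 0 R. quad_ang c d c' d' w)" for c d c' d'
  have offs: "off_quad (q 0) (q 1) (q' 0) (q' 1) w" "off_quad (q 1) (q 2) (q' 1) (q' 2) w"
    "off_quad (q 2) (q 3) (q' 2) (q' 3) w" "off_quad (q 3) (q 4) (q' 3) (q' 4) w"
    "off_quad (q 4) (q 5) (q' 4) (q' 5) w" "off_quad (q 5) (q 0) (q' 5) (q' 0) w"
    if w: "w \<in> orbit a b z" for w
    using off[OF w, of 0] off[OF w, of 1] off[OF w, of 2] off[OF w, of 3] off[OF w, of 4] off[OF w, of 5]
    unfolding Suc_mod_6 by simp_all
  have Rs: "norm (q 0) \<le> R" "norm (q 1) \<le> R" "norm (q 2) \<le> R" "norm (q 3) \<le> R" "norm (q 4) \<le> R"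
    "norm (q 5) \<le> R" "norm (q' 0) \<le> R" "norm (q' 1) \<le> R" "norm (q' 2) \<le> R" "norm (q' 3) \<le> R"
    "norm (q' 4) \<le> R" "norm (q' 5) \<le> R"
    using R by simp_all
  note pair = orbit_sum_paired[of a b z, folded S_def]
  have P1: "gg a b 1 0 (q 3) = q 1" "gg a b 1 0 (q 4) = q 2" "gg a b 0 1 (q 0) = q 3" "gg a b 0 1 (q 5) = q 2"
    "gg a b 1 0 (q' 3) = q' 1" "gg a b 1 0 (q' 4) = q' 2" "gg a b 0 1 (q' 0) = q' 3" "gg a b 0 1 (q' 5) = q' 2"
    using P unfolding paired_def by metis+
  note P2 = paired_halfturns[OF P(1)] paired_halfturns[OF P(2)]
  have swap: "S (q 1) (q 0) (q' 1) (q' 0) = - S (q 0) (q 1) (q' 0) (q' 1)"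
    "S (q 5) (q 4) (q' 5) (q' 4) = - S (q 4) (q 5) (q' 4) (q' 5)"
    unfolding S_def sum_negf[symmetric]
    using offs(1,5) by (auto intro!: sum.cong quad_ang_swap)
  have "S (q 1) (q 0) (q' 1) (q' 0) = S (q 0) (q 1) (q' 0) (q' 1)"
    using pair[OF offs(1) Rs(1,2,7,8), of 1 "-1"] Rs by (simp add: P2 ori_def S_def)
  then have S0: "S (q 0) (q 1) (q' 0) (q' 1) = 0" using swap by simp
  have "S (q 5) (q 4) (q' 5) (q' 4) = S (q 4) (q 5) (q' 4) (q' 5)"
    using pair[OF offs(5) Rs(5,6,11,12), of "-1" "-1"] Rs by (simp add: P2 ori_def S_def)
  then have S4: "S (q 4) (q 5) (q' 4) (q' 5) = 0" using swap by simp
  have S1: "S (q 1) (q 2) (q' 1) (q' 2) = - S (q 3) (q 4) (q' 3) (q' 4)"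
    using pair[OF offs(4) Rs(4,5,10,11), of 1 0] Rs by (simp add: P1 ori_def S_def)
  have S2: "S (q 2) (q 3) (q' 2) (q' 3) = - S (q 5) (q 0) (q' 5) (q' 0)"
    using pair[OF offs(6) Rs(6,1,12,7), of 0 1] Rs by (simp add: P1 ori_def S_def)
  have "total_ang q w - total_ang q' w = quad_ang (q 0) (q 1) (q' 0) (q' 1) w + quad_ang (q 1) (q 2) (q' 1) (q' 2) w
     + quad_ang (q 2) (q 3) (q' 2) (q' 3) w + quad_ang (q 3) (q 4) (q' 3) (q' 4) w
     + quad_ang (q 4) (q 5) (q' 4) (q' 5) w + quad_ang (q 5) (q 0) (q' 5) (q' 0) w" for w
    unfolding total_ang_def sum_lessThan_6 Suc_mod_6 quad_ang_def by simp
  then have "(\<Sum>w\<in>orbit a b z \<inter> cball 0 R. total_ang q w - total_ang q' w) =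
      S (q 0) (q 1) (q' 0) (q' 1) + S (q 1) (q 2) (q' 1) (q' 2) + S (q 2) (q 3) (q' 2) (q' 3)
      + S (q 3) (q 4) (q' 3) (q' 4) + S (q 4) (q 5) (q' 4) (q' 5) + S (q 5) (q 0) (q' 5) (q' 0)"
    by (simp add: S_def sum.distrib)
  also have "\<dots> = 0" using S0 S1 S2 S4 by simp
  finally show ?thesis by (simp add: sum_subtractf)
qed

text \<open>The degenerate hexagon with \<open>p 0 = p 1\<close> at the centre of the half-turn about side 0 and
  \<open>p 4 = p 5\<close> at the centre of the one about side 4.\<close>

definition rect :: "real \<Rightarrow> real \<Rightarrow> nat \<Rightarrow> complex" where
  "rect a b i = (if i \<le> 1 then Complex (a / 2) (- b / 2) else if i = 2 then Complex (a / 2) (b / 2)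
     else if i = 3 then Complex (- a / 2) (b / 2) else Complex (- a / 2) (- b / 2))"

lemma paired_rect: "paired a b (rect a b)"
  unfolding paired_def rect_def gg_def ps_def by (simp add: complex_eq_iff field_simps)

definition off_hexagon :: "(nat \<Rightarrow> complex) \<Rightarrow> complex \<Rightarrow> bool" where
  "off_hexagon q w \<longleftrightarrow> (\<forall>i<6. w \<notin> closed_segment (q i) (q (nx i)))"

lemma off_hexagon_rigid:
  assumes "rigid d f" shows "off_hexagon (f \<circ> q) (f w) \<longleftrightarrow> off_hexagon q w"
  unfolding off_hexagon_def o_apply rigid_segment(1)[OF assms, symmetric]
  using rigid_inj[OF assms] by (simp add: inj_image_mem_iff)

lemma total_ang_rigid:
  "rigid d f \<Longrightarrow> off_hexagon q w \<Longrightarrow> total_ang (f \<circ> q) (f w) = ori d * total_ang q w"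
  unfolding total_ang_def off_hexagon_def by (simp add: ang_rigid sum_distrib_left)

lemma total_ang_rect_pos:
  assumes ab: "0 \<le> a" "0 \<le> b" and w: "off_hexagon (rect a b) w"
  shows "total_ang (rect a b) w = (if \<bar>Re w\<bar> < a / 2 \<and> \<bar>Im w\<bar> < b / 2 then 2 * pi else 0)"
proof -
  define A B C D where "A = Complex (a / 2) (- b / 2)" and "B = Complex (- a / 2) (- b / 2)"
    and "C = Complex (a / 2) (b / 2)" and "D = Complex (- a / 2) (b / 2)"
  have r: "rect a b 0 = A" "rect a b 1 = A" "rect a b 2 = C" "rect a b 3 = D" "rect a b 4 = B" "rect a b 5 = B"
    by (simp_all add: rect_def A_def B_def C_def D_def)
  have off: "w \<notin> closed_segment B A" "w \<notin> closed_segment A C" "w \<notin> closed_segment C D" "w \<notin> closed_segment D B"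
    using w[unfolded off_hexagon_def, rule_format, of 1] w[unfolded off_hexagon_def, rule_format, of 2]
      w[unfolded off_hexagon_def, rule_format, of 3] w[unfolded off_hexagon_def, rule_format, of 5]
    unfolding Suc_mod_6 r by simp_all
  have ta: "total_ang (rect a b) w = ang B A w + ang A C w + ang C D w + ang D B w"
    unfolding total_ang_def sum_lessThan_6 Suc_mod_6 r ang_self by simp
  \<comment> \<open>Starting the cycle at \<open>B\<close> turns the four sides that are left into a
    \<open>rectpath\<close>.\<close>
  have rp: "rectpath B C = linepath B A +++ linepath A C +++ linepath C D +++ linepath D B"
    by (simp add: rectpath_def Let_def A_def B_def C_def D_def)
  have "Re (winding_number (rectpath B C) w) = total_ang (rect a b) w / (2 * pi)"
    unfolding rp ta using off
    by (simp add: winding_number_join path_image_join winding_number_linepath_ang add_divide_distrib)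
  then have eq: "total_ang (rect a b) w = 2 * pi * Re (winding_number (rectpath B C) w)" by simp
  have le: "Re B \<le> Re C" "Im B \<le> Im C" using ab by (auto simp: B_def C_def)
  have "w \<notin> path_image (rectpath B C)" using off unfolding rp by (simp add: path_image_join)
  then have nb: "w \<in> box B C \<or> w \<notin> cbox B C"
    unfolding path_image_rectpath_cbox_minus_box[OF le] by blast
  have bx: "w \<in> box B C \<longleftrightarrow> \<bar>Re w\<bar> < a / 2 \<and> \<bar>Im w\<bar> < b / 2"
    unfolding in_box_complex_iff B_def C_def by auto
  show ?thesis
  proof (cases "w \<in> box B C")
    case True
    then show ?thesis using winding_number_rectpath[OF True] eq bx by simp
  next
    case False
    then have "winding_number (rectpath B C) w = 0"
      using winding_number_rectpath_outside[OF le] nb by blast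
    then show ?thesis using eq bx False by simp
  qed
qed

text \<open>Changing the sign of \<open>a\<close> or of \<open>b\<close> amounts to a reflection of
  the plane, which reverses the sense of the rectangle and hence the sign.\<close>

lemma total_ang_rect:
  assumes w: "off_hexagon (rect a b) w"
  shows "total_ang (rect a b) w =
    (if \<bar>Re w\<bar> < \<bar>a\<bar> / 2 \<and> \<bar>Im w\<bar> < \<bar>b\<bar> / 2 then 2 * pi * (sgn a * sgn b) else 0)"
proof -
  have flip: "off_hexagon (rect a' b') (f w) \<and> total_ang (rect a b) w = - total_ang (rect a' b') (f w)"
    if f: "rigid False f" "\<And>z. f (f z) = z" "rect a b = f \<circ> rect a' b'" "off_hexagon (rect a b) w" for f a b a' b' w
  proof -
    have "off_hexagon (rect a' b') (f w)"
      using f(4) off_hexagon_rigid[OF f(1), of "rect a' b'" "f w"] unfolding f(2,3) by blast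
    then show ?thesis using total_ang_rigid[OF f(1), of "rect a' b'" "f w"] unfolding f(2,3)
      by (simp add: ori_def)
  qed
  have r1: "rigid False (\<lambda>z. - cnj z)" by (rule rigidI[of "-1" _ _ 0]) auto
  have r2: "rigid False cnj" by (rule rigidI[of 1 _ _ 0]) auto
  have e1: "rect a b = (\<lambda>z. - cnj z) \<circ> rect (- a) b" for a b
    by (auto simp: fun_eq_iff rect_def complex_eq_iff)
  have e2: "rect a b = cnj \<circ> rect a (- b)" for a b
    by (auto simp: fun_eq_iff rect_def complex_eq_iff)
  have 1: "total_ang (rect a b) w =
    (if \<bar>Re w\<bar> < \<bar>a\<bar> / 2 \<and> \<bar>Im w\<bar> < \<bar>b\<bar> / 2 then 2 * pi * (sgn a * sgn b) else 0)"
    if "0 \<le> a" "0 \<le> b" "off_hexagon (rect a b) w" for a b w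
    using total_ang_rect_pos[OF that] that by (auto simp: sgn_if)
  have 2: "total_ang (rect a b) w =
    (if \<bar>Re w\<bar> < \<bar>a\<bar> / 2 \<and> \<bar>Im w\<bar> < \<bar>b\<bar> / 2 then 2 * pi * (sgn a * sgn b) else 0)"
    if "0 \<le> a" "off_hexagon (rect a b) w" for a b w
  proof (cases "0 \<le> b")
    case True then show ?thesis using 1 that by blast
  next
    case False
    then show ?thesis
      using flip[OF r2 _ e2 that(2)] 1[OF that(1), of "- b" "cnj w"] by simp
  qed
  show ?thesis
  proof (cases "0 \<le> a")
    case True then show ?thesis using 2 w by blast
  next
    case False
    then show ?thesis
      using flip[OF r1 _ e1 w] 2[of "- a" b "- cnj w"] by simp
  qed
qed

text \<open>The signs preserve the open box, and its width and height are the translation lengths: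
  two numbers of absolute value below |c| / 2 differ by less than |c|, so the multiple of c between
  them is 0.\<close>

lemma gg_box_fixed:
  assumes "\<bar>Re w\<bar> < \<bar>a\<bar> / 2" "\<bar>Im w\<bar> < \<bar>b\<bar> / 2"
    "\<bar>Re (gg a b m n w)\<bar> < \<bar>a\<bar> / 2" "\<bar>Im (gg a b m n w)\<bar> < \<bar>b\<bar> / 2"
  shows "m = 0 \<and> n = 0"
proof -
  have aux: "k = 0" if "\<bar>x\<bar> < \<bar>c\<bar> / 2" "\<bar>real_of_int (ps l) * x + real_of_int k * c\<bar> < \<bar>c\<bar> / 2" for x c :: real and k l
  proof -
    have "\<bar>real_of_int (ps l) * x\<bar> = \<bar>x\<bar>" by (simp add: abs_mult ps_sq)
    then have "\<bar>real_of_int k * c\<bar> < \<bar>c\<bar>" using that by linarith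
    then have "\<bar>real_of_int k\<bar> * \<bar>c\<bar> < 1 * \<bar>c\<bar>" by (simp add: abs_mult)
    then have "\<bar>real_of_int k\<bar> < 1" by (rule mult_right_less_imp_less) simp
    then show ?thesis by linarith
  qed
  show ?thesis
    using aux[of "Re w" a n m] aux[of "Im w" b m n] assms by (simp add: gg_def)
qed

lemma orbit_meets_cbox:
  assumes ab: "a \<noteq> 0" "b \<noteq> 0"
  obtains m n where "\<bar>Re (gg a b m n z)\<bar> \<le> \<bar>a\<bar> / 2" "\<bar>Im (gg a b m n z)\<bar> \<le> \<bar>b\<bar> / 2"
proof -
  have near: "\<exists>k::int. \<bar>x - k * c\<bar> \<le> \<bar>c\<bar> / 2" if c: "c \<noteq> 0" for x c :: real
  proof -
    have "\<bar>of_int (round (x / c)) - x / c\<bar> \<le> 1 / 2" by (rule of_int_round_abs_le)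
    then have "\<bar>of_int (round (x / c)) - x / c\<bar> * \<bar>c\<bar> \<le> 1 / 2 * \<bar>c\<bar>" by (rule mult_right_mono) simp
    also have "\<bar>of_int (round (x / c)) - x / c\<bar> * \<bar>c\<bar> = \<bar>x - of_int (round (x / c)) * c\<bar>"
      unfolding abs_mult[symmetric] using c by (simp add: left_diff_distrib abs_minus_commute)
    finally show ?thesis by (intro exI[of _ "round (x / c)"]) simp
  qed
  obtain m :: int where m: "\<bar>Re z - m * a\<bar> \<le> \<bar>a\<bar> / 2" using near[OF ab(1)] by blast
  obtain n :: int where n: "\<bar>Im z - n * b\<bar> \<le> \<bar>b\<bar> / 2" using near[OF ab(2)] by blast
  have "Re (gg a b (- (ps n * m)) (- (ps m * n)) z) = ps n * (Re z - m * a)"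
    "Im (gg a b (- (ps n * m)) (- (ps m * n)) z) = ps m * (Im z - n * b)"
    by (auto simp: gg_def ps_def)
  then show thesis using m n that[of "- (ps n * m)" "- (ps m * n)"] by (simp add: abs_mult ps_sq)
qed

section \<open>Counting the orbit of a generic point in the hexagon\<close>

locale normal_hex = simple_hex +
  fixes a b :: real
  assumes paired: "paired a b p"
begin

text \<open>The whole orbit has to avoid the sides of the hexagon, those of \<open>rect a b\<close>
  and the segments joining corresponding corners, which are the places where an angle in the orbit
  sums could be junk.\<close>

definition generic :: "complex \<Rightarrow> bool" where
  "generic z \<longleftrightarrow> (\<forall>w\<in>orbit a b z. \<forall>i<6.
     off_quad (p i) (p (nx i)) (rect a b i) (rect a b (nx i)) w)"

text \<open>The excluded points lie on countably many segments, preimages of the quadrilateral sides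
  under the elements of the group, and these are null sets.\<close>

lemma generic_exists:
  assumes "open U" "U \<noteq> {}" shows "\<exists>z\<in>U. generic z"
proof (rule ccontr)
  assume no: "\<not> (\<exists>z\<in>U. generic z)"
  define N where "N = (\<lambda>(m, n, i). {z. \<not> off_quad (p i) (p (nx i)) (rect a b i) (rect a b (nx i)) (gg a b m n z)})"
  have seg: "negligible {z. gg a b m n z \<in> closed_segment c d}" for m n c d
  proof -
    let ?h = "gg a b (- (ps n * m)) (- (ps m * n))"
    have "{z. gg a b m n z \<in> closed_segment c d} \<subseteq> ?h ` closed_segment c d"
    proof
      fix z assume "z \<in> {z. gg a b m n z \<in> closed_segment c d}"
      then show "z \<in> ?h ` closed_segment c d"
        using image_eqI[of z ?h "gg a b m n z"] gg_inv_apply(1) by simp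
    qed
    also have "\<dots> = closed_segment (?h c) (?h d)" by (rule rigid_segment(1)[OF gg_rigid])
    finally have "{z. gg a b m n z \<in> closed_segment c d} \<subseteq> closed_segment (?h c) (?h d)" .
    moreover have "negligible (closed_segment (?h c) (?h d))"
      by (simp add: negligible_convex_interior interior_closed_segment_ge2)
    ultimately show ?thesis using negligible_subset by blast
  qed
  have "negligible (N x)" for x
  proof -
    obtain m n i where x: "x = (m, n, i)" by (cases x) auto
    show ?thesis unfolding x N_def off_quad_def
      by (simp only: prod.case de_Morgan_conj not_not Collect_disj_eq) (intro negligible_Un seg)
  qed
  then have "negligible (\<Union>(range N))" by (intro negligible_countable_Union) auto
  moreover have "U \<subseteq> \<Union>(range N)"
  proof
    fix z assume "z \<in> U"
    then have "\<not> generic z" using no by blast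
    then obtain m n i where "\<not> off_quad (p i) (p (nx i)) (rect a b i) (rect a b (nx i)) (gg a b m n z)"
      unfolding generic_def orbit_def by blast
    then have "z \<in> N (m, n, i)" by (simp add: N_def)
    then show "z \<in> \<Union>(range N)" by blast
  qed
  ultimately have "negligible U" using negligible_subset by blast
  then show False using open_not_negligible[OF assms] by blast
qed

lemma generic_off:
  assumes "generic z" "w \<in> orbit a b z"
  shows "off_hexagon p w" "off_hexagon (rect a b) w" "w \<notin> bd"
proof -
  show "off_hexagon p w" "off_hexagon (rect a b) w"
    using assms by (auto simp: generic_def off_quad_def off_hexagon_def)
  then show "w \<notin> bd" by (auto simp: bd_eq off_hexagon_def side_eq_segment)
qed

text \<open>Both sides are the same orbit sum of winding numbers, evaluated once for the hexagon and
  once for \<open>rect a b\<close>. As the polygon is fixed and only the point moves, every interior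
  orbit point counts with the one sign \<open>sg\<close>, whatever the orientation of the group
  element behind it.\<close>

lemma orbit_count:
  assumes z: "generic z"
  shows "finite (orbit a b z \<inter> ins)"
    "sg * card (orbit a b z \<inter> ins) =
     sgn a * sgn b * card {w \<in> orbit a b z. \<bar>Re w\<bar> < \<bar>a\<bar> / 2 \<and> \<bar>Im w\<bar> < \<bar>b\<bar> / 2}"
proof -
  let ?O = "orbit a b z"
  define Q where "Q = {w. \<bar>Re w\<bar> < \<bar>a\<bar> / 2 \<and> \<bar>Im w\<bar> < \<bar>b\<bar> / 2}"
  have "Q \<subseteq> cball 0 (\<bar>a\<bar> / 2 + \<bar>b\<bar> / 2)"
  proof
    fix w assume "w \<in> Q"
    then show "w \<in> cball 0 (\<bar>a\<bar> / 2 + \<bar>b\<bar> / 2)" using cmod_le[of w] by (auto simp: Q_def)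
  qed
  then have "bounded Q" using bounded_subset bounded_cball by blast
  then have "bounded (ins \<union> Q \<union> p ` {..<6} \<union> rect a b ` {..<6})"
    using jordan(3) by (simp add: finite_imp_bounded)
  then obtain R where "\<forall>x\<in>ins \<union> Q \<union> p ` {..<6} \<union> rect a b ` {..<6}. norm x \<le> R"
    unfolding bounded_iff by blast
  then have R: "ins \<union> Q \<union> p ` {..<6} \<union> rect a b ` {..<6} \<subseteq> cball 0 R"
    by (auto simp: subset_iff)
  have fin: "finite (?O \<inter> cball 0 R)" by (rule orbit_finite)
  then show "finite (?O \<inter> ins)" using R by (elim finite_subset[rotated]) auto
  have "(\<Sum>w\<in>?O \<inter> cball 0 R. total_ang p w) = (\<Sum>w\<in>?O \<inter> cball 0 R. total_ang (rect a b) w)"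
  proof (rule orbit_sum_total_ang[OF paired paired_rect])
    show "\<And>i. i < 6 \<Longrightarrow> norm (p i) \<le> R" "\<And>i. i < 6 \<Longrightarrow> norm (rect a b i) \<le> R"
      using R by (auto simp: subset_iff)
  qed (use z in \<open>auto simp: generic_def\<close>)
  moreover have "(\<Sum>w\<in>?O \<inter> cball 0 R. total_ang p w) = (\<Sum>w\<in>?O \<inter> ins. 2 * pi * sg)"
  proof -
    have "(\<Sum>w\<in>?O \<inter> cball 0 R. total_ang p w) = (\<Sum>w\<in>?O \<inter> ins. total_ang p w)"
    proof (rule sum.mono_neutral_right[OF fin])
      show "?O \<inter> ins \<subseteq> ?O \<inter> cball 0 R" using R by auto
      show "\<forall>w\<in>?O \<inter> cball 0 R - ?O \<inter> ins. total_ang p w = 0"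
        using generic_off(3)[OF z] by (auto intro!: total_ang_outside simp: reg_def)
    qed
    then show ?thesis using total_ang_ins by simp
  qed
  moreover have "(\<Sum>w\<in>?O \<inter> cball 0 R. total_ang (rect a b) w) = (\<Sum>w\<in>?O \<inter> Q. 2 * pi * (sgn a * sgn b))"
  proof -
    have "(\<Sum>w\<in>?O \<inter> cball 0 R. total_ang (rect a b) w) = (\<Sum>w\<in>?O \<inter> Q. total_ang (rect a b) w)"
    proof (rule sum.mono_neutral_right[OF fin])
      show "?O \<inter> Q \<subseteq> ?O \<inter> cball 0 R" using R by auto
      show "\<forall>w\<in>?O \<inter> cball 0 R - ?O \<inter> Q. total_ang (rect a b) w = 0"
        using total_ang_rect[OF generic_off(2)[OF z]] by (auto simp: Q_def)
    qed
    also have "\<dots> = (\<Sum>w\<in>?O \<inter> Q. 2 * pi * (sgn a * sgn b))"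
      using total_ang_rect[OF generic_off(2)[OF z]] by (intro sum.cong) (auto simp: Q_def)
    finally show ?thesis .
  qed
  ultimately have "2 * pi * (sg * card (?O \<inter> ins)) = 2 * pi * (sgn a * sgn b * card (?O \<inter> Q))"
    by (simp add: algebra_simps)
  then have "sg * card (?O \<inter> ins) = sgn a * sgn b * card (?O \<inter> Q)"
    using mult_left_cancel[of "2 * pi"] by simp
  moreover have "?O \<inter> Q = {w \<in> ?O. \<bar>Re w\<bar> < \<bar>a\<bar> / 2 \<and> \<bar>Im w\<bar> < \<bar>b\<bar> / 2}" by (auto simp: Q_def)
  ultimately show "sg * card (?O \<inter> ins) =
     sgn a * sgn b * card {w \<in> ?O. \<bar>Re w\<bar> < \<bar>a\<bar> / 2 \<and> \<bar>Im w\<bar> < \<bar>b\<bar> / 2}" by simp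
qed

text \<open>A generic point inside the hexagon makes the left side of \<open>orbit_count\<close>
  nonzero, so the factor on the right cannot vanish.\<close>

lemma nondegenerate: "a \<noteq> 0" "b \<noteq> 0"
proof -
  obtain z where z: "z \<in> ins" "generic z" using generic_exists[OF jordan(2,1)] by blast
  have "z \<in> orbit a b z \<inter> ins" using z orbit_self by blast
  then have "card (orbit a b z \<inter> ins) \<noteq> 0" using orbit_count(1)[OF z(2)] by auto
  then have "sgn a * sgn b \<noteq> 0" using orbit_count(2)[OF z(2)] sg_cases by auto
  then show "a \<noteq> 0" "b \<noteq> 0" by auto
qed

text \<open>Sides 1, 2, 3 and 5 of \<open>rect a b\<close> form the boundary of the box, so a
  generic point moved into the closed box lies in the open one.\<close>

lemma generic_box:
  assumes z: "generic z"
  obtains m n where "\<bar>Re (gg a b m n z)\<bar> < \<bar>a\<bar> / 2" "\<bar>Im (gg a b m n z)\<bar> < \<bar>b\<bar> / 2"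
proof -
  obtain m n where mn: "\<bar>Re (gg a b m n z)\<bar> \<le> \<bar>a\<bar> / 2" "\<bar>Im (gg a b m n z)\<bar> \<le> \<bar>b\<bar> / 2"
    using orbit_meets_cbox[OF nondegenerate] .
  define w where "w = gg a b m n z"
  have off: "w \<notin> closed_segment (rect a b i) (rect a b (nx i))" if "i < 6" for i
    using generic_off(2)[OF z orbitI[of a b m n z]] that by (simp add: off_hexagon_def w_def)
  have seg: "Complex x y \<in> closed_segment (Complex x y1) (Complex x y2)"
    "Complex y x \<in> closed_segment (Complex y1 x) (Complex y2 x)"
    if "\<bar>y\<bar> \<le> \<bar>c\<bar> / 2" "(y1 = c / 2 \<and> y2 = - c / 2) \<or> (y1 = - c / 2 \<and> y2 = c / 2)" for x y y1 y2 c
    using that by (auto simp: closed_segment_same_Re closed_segment_same_Im closed_segment_eq_real_ivl)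
  have w: "w = Complex (Re w) (Im w)" by simp
  have "Re w \<noteq> a / 2" "Re w \<noteq> - a / 2" "Im w \<noteq> b / 2" "Im w \<noteq> - b / 2"
    using off[of 1] off[of 3] off[of 2] off[of 5] mn seg(1)[of "Im w" b "- b / 2" "b / 2" "Re w"]
      seg(1)[of "Im w" b "b / 2" "- b / 2" "Re w"] seg(2)[of "Re w" a "a / 2" "- a / 2" "Im w"]
      seg(2)[of "Re w" a "- a / 2" "a / 2" "Im w"]
    unfolding Suc_mod_6 w_def[symmetric] by (auto simp: rect_def)
  then have "\<bar>Re w\<bar> \<noteq> \<bar>a\<bar> / 2" "\<bar>Im w\<bar> \<noteq> \<bar>b\<bar> / 2" by (auto simp: abs_if split: if_splits)
  then show thesis using mn that[of m n] unfolding w_def by linarith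
qed

text \<open>The open box contains exactly one point of the orbit, so \<open>orbit_count\<close>
  equates a cardinality with 1 up to sign.\<close>

lemma orbit_ins_unique:
  assumes z: "generic z"
  obtains w where "orbit a b z \<inter> ins = {w}"
proof -
  obtain m n where mn: "\<bar>Re (gg a b m n z)\<bar> < \<bar>a\<bar> / 2" "\<bar>Im (gg a b m n z)\<bar> < \<bar>b\<bar> / 2"
    using generic_box[OF z] .
  let ?Q = "{w \<in> orbit a b z. \<bar>Re w\<bar> < \<bar>a\<bar> / 2 \<and> \<bar>Im w\<bar> < \<bar>b\<bar> / 2}"
  have "w = gg a b m n z" if wQ: "w \<in> ?Q" for w
  proof -
    obtain m' n' where w: "w = gg a b m' n' z" using wQ unfolding orbit_def by blast
    have "w = gg a b m' n' (gg a b (- (ps n * m)) (- (ps m * n)) (gg a b m n z))"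
      using w gg_inv_apply(1) by simp
    then obtain k l where kl: "w = gg a b k l (gg a b m n z)"
      unfolding gg_comp_apply[of a b m' n' _ _ "gg a b m n z"] by blast
    then have "k = 0 \<and> l = 0" using gg_box_fixed[OF mn, of k l] wQ by auto
    then show ?thesis using kl by (simp add: gg_0)
  qed
  then have "?Q = {gg a b m n z}" using mn orbitI[of a b m n z] by blast
  then have "sg * card (orbit a b z \<inter> ins) = sgn a * sgn b"
    using orbit_count(2)[OF z] by simp
  then have "real (card (orbit a b z \<inter> ins)) = 1"
    using nondegenerate sg_cases by (auto simp: sgn_if split: if_splits)
  then show thesis using that by (metis card_1_singletonE of_nat_eq_1_iff)
qed

text \<open>The quotient of the two elements fixes \<open>z\<close>. Conjugated so as to fix a point
  of the open box, it is trivial by \<open>gg_box_fixed\<close>.\<close>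

lemma generic_free:
  assumes z: "generic z" and eq: "gg a b m n z = gg a b m' n' z"
  shows "gg a b m n = gg a b m' n'"
proof -
  obtain k l where kl: "\<bar>Re (gg a b k l z)\<bar> < \<bar>a\<bar> / 2" "\<bar>Im (gg a b k l z)\<bar> < \<bar>b\<bar> / 2"
    using generic_box[OF z] .
  define w where "w = gg a b k l z"
  let ?u = "gg a b (- (ps l * k)) (- (ps k * l))"
  have zu: "z = ?u w" unfolding w_def by (simp add: gg_inv_apply)
  let ?i = "gg a b (- (ps n' * m')) (- (ps m' * n'))"
  obtain x y where xy: "gg a b k l \<circ> (?i \<circ> (gg a b m n \<circ> ?u)) = gg a b x y"
    unfolding gg_comp by blast
  have "gg a b x y w = gg a b k l (?i (gg a b m n z))"
    unfolding xy[symmetric] o_apply zu[symmetric] ..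
  also have "\<dots> = w" unfolding eq gg_inv_apply(1) w_def ..
  finally have "gg a b x y w = w" .
  then have "x = 0 \<and> y = 0" using gg_box_fixed[of w a b x y] kl unfolding w_def by simp
  then have id: "gg a b k l (?i (gg a b m n (?u v))) = v" for v
    using fun_cong[OF xy, of v] by (simp add: gg_0)
  show ?thesis
  proof
    fix v
    have "gg a b k l (?i (gg a b m n v)) = gg a b k l v"
      using id[of "gg a b k l v"] by (simp add: gg_inv_apply)
    then have "?i (gg a b m n v) = v"
      using rigid_inj[OF gg_rigid, of a b k l] by (simp add: inj_eq)
    then show "gg a b m n v = gg a b m' n' v" using gg_inv_apply(2)[of a b m' n' "gg a b m n v"] by simp
  qed
qed

end

section \<open>The orbit of the hexagon is a tiling\<close>

lemma rigid_image_closure: "rigid d f \<Longrightarrow> f ` closure S \<subseteq> closure (f ` S)"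
  by (rule image_closure_subset[OF rigid_continuous]) (auto simp: closure_subset)

lemma gg_eq:
  assumes "a \<noteq> 0" "b \<noteq> 0" shows "gg a b m n = gg a b m' n' \<longleftrightarrow> m = m' \<and> n = n'"
proof
  assume "gg a b m n = gg a b m' n'"
  then have "gg a b m n 0 = gg a b m' n' 0" by simp
  then show "m = m' \<and> n = n'" using assms by (simp add: gg_def)
qed simp

text \<open>\<open>nbr a b k\<close> maps side \<open>partner k\<close> to side \<open>k\<close>, so it gives the neighbour across side \<open>k\<close>.\<close>

definition nbr :: "real \<Rightarrow> real \<Rightarrow> nat \<Rightarrow> complex \<Rightarrow> complex" where
  "nbr a b k = (if k = 0 then gg a b 1 (-1) else if k = 1 then gg a b 1 0 else if k = 2 then gg a b 0 1
     else if k = 3 then gg a b (-1) 0 else if k = 4 then gg a b (-1) (-1) else gg a b 0 (-1))"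

definition partner :: "nat \<Rightarrow> nat" where
  "partner k = (if k = 1 then 3 else if k = 2 then 5 else if k = 3 then 1 else if k = 5 then 2 else k)"

definition pgg :: "real \<Rightarrow> real \<Rightarrow> (complex \<Rightarrow> complex) set" where
  "pgg a b = {gg a b m n | m n. True}"

lemma gg_in_pgg: "gg a b m n \<in> pgg a b" unfolding pgg_def by blast
lemma id_in_pgg: "id \<in> pgg a b" using gg_in_pgg[of a b 0 0] by (simp add: gg_0)
lemma nbr_in_pgg: "nbr a b k \<in> pgg a b" by (simp add: nbr_def gg_in_pgg)
lemma pggE: "g \<in> pgg a b \<Longrightarrow> (\<And>m n. g = gg a b m n \<Longrightarrow> thesis) \<Longrightarrow> thesis"
  unfolding pgg_def by blast
lemma pgg_comp: "g \<in> pgg a b \<Longrightarrow> h \<in> pgg a b \<Longrightarrow> g \<circ> h \<in> pgg a b"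
  by (elim pggE) (simp add: gg_comp gg_in_pgg)
lemma pgg_inverse: "g \<in> pgg a b \<Longrightarrow> \<exists>h\<in>pgg a b. g \<circ> h = id \<and> h \<circ> g = id"
  by (elim pggE) (metis gg_inv gg_in_pgg)
lemma pgg_rigid: "g \<in> pgg a b \<Longrightarrow> \<exists>d. rigid d g"
  by (elim pggE) (use gg_rigid in blast)

context simple_hex
begin

lemma Suc_pred_mod_6: "k < 6 \<Longrightarrow> Suc ((k + 5) mod 6) mod 6 = k"
  by presburger

lemma local_tile:
  assumes f: "rigid d f" and k: "k < 6" and x: "x \<in> open_segment (f (p k)) (f (p (nx k)))"
  obtains r where "0 < r"
    "\<And>z. z \<in> ball x r \<Longrightarrow> 0 < sg * ori d * Im ((z - x) / (f (p (nx k)) - f (p k))) \<Longrightarrow> z \<in> f ` ins"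
    "\<And>z. z \<in> ball x r \<Longrightarrow> sg * ori d * Im ((z - x) / (f (p (nx k)) - f (p k))) < 0 \<Longrightarrow> z \<notin> f ` reg"
    "\<And>z. z \<in> ball x r \<Longrightarrow> Im ((z - x) / (f (p (nx k)) - f (p k))) = 0 \<Longrightarrow> z \<in> f ` side p k"
proof -
  obtain y where y: "y \<in> open_segment (p k) (p (nx k))" "x = f y"
    using x unfolding rigid_segment(2)[OF f, symmetric] by blast
  obtain r where r: "0 < r"
    "\<And>z. z \<in> ball y r \<Longrightarrow> 0 < sg * Im ((z - y) / (p (nx k) - p k)) \<Longrightarrow> z \<in> ins"
    "\<And>z. z \<in> ball y r \<Longrightarrow> sg * Im ((z - y) / (p (nx k) - p k)) < 0 \<Longrightarrow> z \<notin> reg"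
    "\<And>z. z \<in> ball y r \<Longrightarrow> Im ((z - y) / (p (nx k) - p k)) = 0 \<Longrightarrow> z \<in> side p k"
    using local_side[OF k y(1)] by blast
  have o2: "ori d * ori d = 1" by (simp add: ori_def)
  have im: "Im ((f w - x) / (f (p (nx k)) - f (p k))) = ori d * Im ((w - y) / (p (nx k) - p k))" for w
    unfolding y(2) by (rule rigid_Im_ratio[OF f])
  have o0: "sg * ori d * (ori d * t) = sg * t" for t :: real by (simp add: o2 mult.assoc mult.left_commute)
  have w: "\<exists>w. z = f w \<and> w \<in> ball y r" if "z \<in> ball x r" for z
    using that rigid_ball[OF f, of y r] y(2) by blast
  have inj: "f w \<in> f ` X \<longleftrightarrow> w \<in> X" for w X using rigid_inj[OF f] by (simp add: inj_image_mem_iff)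
  show thesis
  proof (rule that[OF r(1)])
    fix z assume z: "z \<in> ball x r"
    then obtain w where w': "z = f w" "w \<in> ball y r" using w by blast
    show "0 < sg * ori d * Im ((z - x) / (f (p (nx k)) - f (p k))) \<Longrightarrow> z \<in> f ` ins"
      using r(2)[OF w'(2)] unfolding w'(1) im o0 inj by blast
    show "sg * ori d * Im ((z - x) / (f (p (nx k)) - f (p k))) < 0 \<Longrightarrow> z \<notin> f ` reg"
      using r(3)[OF w'(2)] unfolding w'(1) im o0 inj by blast
    have "ori d \<noteq> 0" by (simp add: ori_def)
    then show "Im ((z - x) / (f (p (nx k)) - f (p k))) = 0 \<Longrightarrow> z \<in> f ` side p k"
      using r(4)[OF w'(2)] unfolding w'(1) im inj by simp
  qed
qed

text \<open>One radius serves all six corners, because in \<open>corner_nbhd\<close> the tiles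
  around a vertex may have different corners there.\<close>

lemma corner_isolated:
  obtains r where "0 < r"
    "\<And>k j y. k < 6 \<Longrightarrow> j < 6 \<Longrightarrow> y \<in> ball (p k) r \<Longrightarrow> y \<in> side p j \<Longrightarrow> y \<noteq> p k \<Longrightarrow>
      (j = k \<or> j = (k + 5) mod 6) \<and> y \<in> open_segment (p j) (p (nx j))"
proof -
  have ex: "\<exists>r>0. \<forall>y\<in>ball (p k) r. (\<forall>j<6. p k \<notin> side p j \<longrightarrow> y \<notin> side p j) \<and> (\<forall>j<6. j \<noteq> k \<longrightarrow> y \<noteq> p j)"
    if k: "k < 6" for k
  proof -
    define U where "U = (\<Union>j\<in>{j. j < 6 \<and> p k \<notin> side p j}. side p j) \<union> p ` ({..<6} - {k})"
    have "closed U" unfolding U_def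
      by (intro closed_Un closed_UN finite_imp_closed) (auto simp: side_def)
    moreover have "p k \<notin> U" using k corner_eq by (auto simp: U_def)
    ultimately obtain r where "0 < r" "ball (p k) r \<subseteq> - U"
      using open_contains_ball[of "- U"] by (metis ComplI open_Compl)
    then show ?thesis unfolding U_def by (intro exI[of _ r]) blast
  qed
  then obtain r where r: "\<And>k. k < 6 \<Longrightarrow> 0 < r k \<and> (\<forall>y\<in>ball (p k) (r k).
      (\<forall>j<6. p k \<notin> side p j \<longrightarrow> y \<notin> side p j) \<and> (\<forall>j<6. j \<noteq> k \<longrightarrow> y \<noteq> p j))"
    by metis
  define R where "R = Min (r ` {..<6})"
  have R0: "0 < R" unfolding R_def using r by (subst Min_gr_iff) (auto simp: lessThan_empty_iff)
  have Rk: "R \<le> r k" if "k < 6" for k unfolding R_def using that by (intro Min_le) auto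
  show thesis
  proof (rule that[OF R0])
    fix k j y assume kj: "k < 6" "j < 6" and y: "y \<in> ball (p k) R" "y \<in> side p j" "y \<noteq> p k"
    have yr: "y \<in> ball (p k) (r k)" using y(1) Rk[OF kj(1)] by auto
    then have pk: "p k \<in> side p j" and ny: "\<And>i. i < 6 \<Longrightarrow> y \<noteq> p i" using r[OF kj(1)] kj y by blast+
    have "y \<in> open_segment (p j) (p (nx j))"
      using y(2) ny[of j] ny[of "nx j"] kj by (auto simp: side_eq_segment open_segment_def)
    moreover have "j = k \<or> j = (k + 5) mod 6"
    proof (cases "j = k")
      case False
      then have "p k \<in> {p j, p (nx j)}"
        using side_Int[of j k] pk corner_in_side(1)[OF kj(1)] kj by blast
      then have "k = nx j" using corner_eq[of k j] corner_eq[of k "nx j"] kj False by auto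
      then have "j = (k + 5) mod 6" using kj by presburger
      then show ?thesis by simp
    qed simp
    ultimately show "(j = k \<or> j = (k + 5) mod 6) \<and> y \<in> open_segment (p j) (p (nx j))" by simp
  qed
qed

end

context normal_hex
begin

abbreviation "G \<equiv> pgg a b"
abbreviation "nb \<equiv> nbr a b"

lemma paired_eqs: "gg a b 1 0 (p 3) = p 1" "gg a b 1 0 (p 4) = p 2" "gg a b 0 1 (p 0) = p 3" "gg a b 0 1 (p 5) = p 2"
  "gg a b (-1) 0 (p 1) = p 3" "gg a b (-1) 0 (p 2) = p 4" "gg a b 0 (-1) (p 3) = p 0" "gg a b 0 (-1) (p 2) = p 5"
proof -
  show 1: "gg a b 1 0 (p 3) = p 1" "gg a b 1 0 (p 4) = p 2" "gg a b 0 1 (p 0) = p 3" "gg a b 0 1 (p 5) = p 2"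
    using paired unfolding paired_def by metis+
  have 2: "gg a b (-1) 0 (gg a b 1 0 z) = z" "gg a b 0 (-1) (gg a b 0 1 z) = z" for z
    by (simp_all add: gg_comp_apply ps_def gg_0)
  show "gg a b (-1) 0 (p 1) = p 3" "gg a b (-1) 0 (p 2) = p 4" "gg a b 0 (-1) (p 3) = p 0" "gg a b 0 (-1) (p 2) = p 5"
    unfolding 1[symmetric] by (simp_all add: 2) (metis 1 2)+
qed

lemmas halfturns = paired_halfturns[OF paired]

text \<open>The factor \<open>- ori d\<close> says that half-turns reverse the side while glide
  reflections keep its direction. In both cases the interior of the neighbour comes to lie beyond
  the side.\<close>

lemma nbr_spec:
  assumes "k < 6"
  shows "partner k < 6"
    "\<exists>d. rigid d (nb k) \<and>
      nb k (p (nx (partner k))) - nb k (p (partner k)) = of_real (- ori d) * (p (nx k) - p k)"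
    "{nb k (p (partner k)), nb k (p (nx (partner k)))} = {p k, p (nx k)}"
proof -
  show "partner k < 6" using assms by (simp add: partner_def)
  show "\<exists>d. rigid d (nb k) \<and>
      nb k (p (nx (partner k))) - nb k (p (partner k)) = of_real (- ori d) * (p (nx k) - p k)"
    using assms
  proof (cases rule: less_6_cases)
    case 1 then show ?thesis using gg_rigid[of 1 "-1" a b]
      by (intro exI[of _ True]) (simp add: nbr_def partner_def Suc_mod_6 halfturns ori_def)
  next
    case 2 then show ?thesis using gg_rigid[of 1 0 a b]
      by (intro exI[of _ False]) (simp add: nbr_def partner_def Suc_mod_6 paired_eqs ori_def)
  next
    case 3 then show ?thesis using gg_rigid[of 0 1 a b]
      by (intro exI[of _ False]) (simp add: nbr_def partner_def Suc_mod_6 paired_eqs ori_def)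
  next
    case 4 then show ?thesis using gg_rigid[of "-1" 0 a b]
      by (intro exI[of _ False]) (simp add: nbr_def partner_def Suc_mod_6 paired_eqs ori_def)
  next
    case 5 then show ?thesis using gg_rigid[of "-1" "-1" a b]
      by (intro exI[of _ True]) (simp add: nbr_def partner_def Suc_mod_6 halfturns ori_def)
  next
    case 6 then show ?thesis using gg_rigid[of 0 "-1" a b]
      by (intro exI[of _ False]) (simp add: nbr_def partner_def Suc_mod_6 paired_eqs ori_def)
  qed
  show "{nb k (p (partner k)), nb k (p (nx (partner k)))} = {p k, p (nx k)}"
    using assms by (cases rule: less_6_cases) (auto simp: nbr_def partner_def Suc_mod_6 halfturns paired_eqs)
qed

lemma nbr_side: "k < 6 \<Longrightarrow> nb k ` side p (partner k) = side p k"
proof -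
  assume k: "k < 6"
  obtain d where d: "rigid d (nb k)" using nbr_spec(2)[OF k] by blast
  show ?thesis
    using nbr_spec(1,3)[OF k] k by (simp add: side_eq_segment rigid_segment(1)[OF d])
qed

text \<open>By \<open>local_side\<close> the tile fills one half disc and the diameter, and the sign
  in \<open>nbr_spec\<close> makes the neighbour fill the other half.\<close>

lemma side_nbhd:
  assumes g: "g \<in> G" and k: "k < 6" and x: "x \<in> g ` open_segment (p k) (p (nx k))"
  shows "\<exists>r>0. ball x r \<subseteq> g ` reg \<union> (g \<circ> nb k) ` reg"
proof -
  obtain y where y: "y \<in> open_segment (p k) (p (nx k))" "x = g y" using x by blast
  define e where "e = p (nx k) - p k"
  obtain d where d: "rigid d (nb k)"
    and e: "nb k (p (nx (partner k))) - nb k (p (partner k)) = of_real (- ori d) * e"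
    using nbr_spec(2)[OF k] unfolding e_def by blast
  have seg: "open_segment (nb k (p (partner k))) (nb k (p (nx (partner k)))) = open_segment (p k) (p (nx k))"
    using nbr_spec(3)[OF k] by (auto simp: doubleton_eq_iff open_segment_commute)
  have y2: "y \<in> open_segment (nb k (p (partner k))) (nb k (p (nx (partner k))))"
    unfolding seg by (rule y(1))
  obtain r1 where r1: "0 < r1" "\<And>z. z \<in> ball y r1 \<Longrightarrow> 0 < sg * Im ((z - y) / e) \<Longrightarrow> z \<in> ins"
     "\<And>z. z \<in> ball y r1 \<Longrightarrow> Im ((z - y) / e) = 0 \<Longrightarrow> z \<in> side p k"
    using local_side[OF k y(1)] unfolding e_def by metis
  obtain r2 where r2: "0 < r2"
    "\<And>z. z \<in> ball y r2 \<Longrightarrow> 0 < sg * ori d * Im ((z - y) / (of_real (- ori d) * e)) \<Longrightarrow> z \<in> nb k ` ins"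
    using local_tile[OF d nbr_spec(1)[OF k] y2] unfolding e by metis
  have im: "sg * ori d * Im (w / (of_real (- ori d) * e)) = - (sg * Im (w / e))" for w
    by (auto simp: ori_def)
  have "ball y (min r1 r2) \<subseteq> reg \<union> nb k ` reg"
  proof
    fix z assume z: "z \<in> ball y (min r1 r2)"
    consider "0 < sg * Im ((z - y) / e)" | "sg * Im ((z - y) / e) < 0" | "Im ((z - y) / e) = 0"
      using sg_cases by fastforce
    then show "z \<in> reg \<union> nb k ` reg"
    proof cases
      case 1 then show ?thesis using z r1(2) ins_subset_reg by auto
    next
      case 2 then show ?thesis using z r2(2)[of z] ins_subset_reg unfolding im by auto
    next
      case 3 then show ?thesis using z r1(3)[of z] k unfolding reg_def bd_eq by auto
    qed
  qed
  then have "g ` ball y (min r1 r2) \<subseteq> g ` reg \<union> (g \<circ> nb k) ` reg"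
    by (auto simp: image_comp[symmetric])
  moreover obtain d' where "rigid d' g" using pgg_rigid[OF g] by blast
  ultimately show ?thesis
    using r1(1) r2(1) y(2) rigid_ball by (intro exI[of _ "min r1 r2"]) auto
qed

text \<open>In a small punctured ball around the vertex, the union of the tiles is closed, and it is open since
  every side ending at the vertex belongs to two of the tiles.\<close>

lemma corner_nbhd:
  assumes fin: "finite C" and ne: "C \<noteq> {}"
    and C: "\<And>h k. (h, k) \<in> C \<Longrightarrow> h \<in> G \<and> k < 6 \<and> h (p k) = v \<and>
      (h \<circ> nb k) \<in> fst ` C \<and> (h \<circ> nb ((k + 5) mod 6)) \<in> fst ` C"
  shows "\<exists>r>0. ball v r \<subseteq> (\<Union>h\<in>fst ` C. h ` reg)"
proof -
  define K where "K = (\<Union>h\<in>fst ` C. h ` reg)"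
  have grp: "h \<in> G" if "h \<in> fst ` C" for h using that C by force
  have "closed K" unfolding K_def
  proof (intro closed_UN finite_imageI fin ballI)
    fix h assume "h \<in> fst ` C"
    then obtain d where "rigid d h" using pgg_rigid grp by blast
    then show "closed (h ` reg)" using closed_reg by (rule rigid_closed)
  qed
  obtain r where r: "0 < r"
    "\<And>k j y. k < 6 \<Longrightarrow> j < 6 \<Longrightarrow> y \<in> ball (p k) r \<Longrightarrow> y \<in> side p j \<Longrightarrow> y \<noteq> p k \<Longrightarrow>
      (j = k \<or> j = (k + 5) mod 6) \<and> y \<in> open_segment (p j) (p (nx j))"
    using corner_isolated by blast
  define D where "D = ball v r - {v}"
  have "connected D" unfolding D_def by (rule connected_punctured_ball) simp
  moreover have "y \<in> interior K" if y: "y \<in> D" "y \<in> K" for y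
  proof -
    obtain h k where hk: "(h, k) \<in> C" "y \<in> h ` reg" using y(2) unfolding K_def by auto
    note Chk = C[OF hk(1)]
    then obtain d where d: "rigid d h" using pgg_rigid by blast
    obtain z where z: "z \<in> reg" "y = h z" using hk(2) by blast
    have hK: "g ` reg \<subseteq> K" if "g \<in> fst ` C" for g using that unfolding K_def by blast
    have hC: "h \<in> fst ` C" using hk(1) by force
    show ?thesis
    proof (cases "z \<in> ins")
      case True
      have "h ` ins \<subseteq> K" using hK[OF hC] ins_subset_reg by blast
      then have "h ` ins \<subseteq> interior K" by (rule interior_maximal[OF _ rigid_open[OF d jordan(2)]])
      then show ?thesis using True z by blast
    next
      case False
      then obtain j where j: "j < 6" "z \<in> side p j" using z(1) unfolding reg_def bd_eq by auto
      have "dist z (p k) = dist y v" using z(2) Chk rigid_imp_dist[OF d] by metis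
      then have zb: "z \<in> ball (p k) r" "z \<noteq> p k" using y(1) unfolding D_def by (auto simp: dist_commute)
      then have jk: "j = k \<or> j = (k + 5) mod 6" "z \<in> open_segment (p j) (p (nx j))"
        using r(2)[of k j z] Chk j by blast+
      obtain s where s: "0 < s" "ball y s \<subseteq> h ` reg \<union> (h \<circ> nb j) ` reg"
        using side_nbhd[of h j y] Chk j(1) jk(2) z(2) by blast
      moreover have "h \<circ> nb j \<in> fst ` C" using jk(1) Chk by blast
      ultimately have "ball y s \<subseteq> K" using hK hC by blast
      then show ?thesis using s(1) by (meson centre_in_ball interior_maximal open_ball subsetD)
    qed
  qed
  then have "D \<subseteq> interior K \<union> - K" by blast
  moreover have "D \<inter> interior K \<noteq> {}"
  proof -
    obtain h k where hk: "(h, k) \<in> C" using ne by auto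
    note Chk = C[OF hk]
    then obtain d where d: "rigid d h" using pgg_rigid by blast
    have "p k \<in> closure ins" using Chk unfolding closure_ins reg_def bd_eq
      using corner_in_side(1) by blast
    then obtain z where z: "z \<in> ins" "dist z (p k) < r" using r(1) closure_approachable by blast
    have "p k \<in> bd" using Chk corner_in_side(1) unfolding bd_eq by blast
    then have "z \<noteq> p k" using z ins_bd_disjoint by blast
    then have "h z \<noteq> v" using Chk rigid_inj[OF d] by (metis injD)
    moreover have "dist (h z) v < r" using z Chk rigid_imp_dist[OF d] by metis
    ultimately have "h z \<in> D" by (simp add: D_def dist_commute)
    moreover have "h z \<in> K" using z hk ins_subset_reg unfolding K_def by force
    ultimately show ?thesis using \<open>\<And>y. y \<in> D \<Longrightarrow> y \<in> K \<Longrightarrow> y \<in> interior K\<close> by blast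
  qed
  moreover have "interior K \<inter> - K = {}" using interior_subset by blast
  ultimately have "D \<inter> - K = {}"
    using connectedD[of D "interior K" "- K"] \<open>closed K\<close> by blast
  moreover have "v \<in> K"
  proof -
    obtain h k where hk: "(h, k) \<in> C" using ne by auto
    note Chk = C[OF hk]
    have "p k \<in> reg" using Chk corner_in_side(1) unfolding reg_def bd_eq by blast
    then show ?thesis using hk Chk unfolding K_def by force
  qed
  ultimately have "ball v r \<subseteq> K" unfolding D_def by blast
  then show ?thesis using r(1) unfolding K_def by blast
qed

end

lemma move_hexagon_sel:
  "region (move g (hexagon q)) = g ` (path_image (hexagon_path q) \<union> inside (path_image (hexagon_path q)))"
  "corners (move g (hexagon q)) = g ` q ` {..<6}" "sides (move g (hexagon q)) = (`) g ` side q ` {..<6}"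
  by (simp_all add: move_def hexagon_def)

context simple_hex
begin

lemma region_tile: "region (tile g) = g ` reg"
  unfolding move_hexagon_sel reg_def ins_def bd_def ..

lemma interior_tile: "rigid d g \<Longrightarrow> interior (region (tile g)) = g ` ins"
  unfolding region_tile by (simp add: rigid_interior interior_reg)

lemma tile_closure: "rigid d g \<Longrightarrow> g ` reg \<subseteq> closure (g ` ins)"
  using rigid_image_closure[of d g ins] by (simp add: closure_ins)

lemma open_meets_tile:
  "rigid d g \<Longrightarrow> open U \<Longrightarrow> U \<inter> g ` reg \<noteq> {} \<Longrightarrow> U \<inter> g ` ins \<noteq> {}"
  using tile_closure[of d g] open_Int_closure_eq_empty[of U "g ` ins"] by blast

end

context normal_hex
begin

definition T :: "polygon set" where "T = tile ` G"

lemma generic_orbit: "generic z \<Longrightarrow> w \<in> orbit a b z \<Longrightarrow> generic w"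
proof -
  assume z: "generic z" and "w \<in> orbit a b z"
  then obtain m n where w: "w = gg a b m n z" unfolding orbit_def by blast
  have "orbit a b w \<subseteq> orbit a b z" unfolding w orbit_def gg_comp_apply by blast
  then show ?thesis using z unfolding generic_def by blast
qed

text \<open>An open overlap contains a generic point. Its preimages in the interior belong to its
  orbit and agree by \<open>orbit_ins_unique\<close>, and then the maps agree by
  \<open>generic_free\<close>.\<close>

lemma tiles_disjoint:
  assumes g: "g \<in> G" and h: "h \<in> G" and ne: "g ` ins \<inter> h ` ins \<noteq> {}"
  shows "g = h"
proof -
  obtain d e where "rigid d g" "rigid e h" using pgg_rigid g h by blast
  then have "open (g ` ins \<inter> h ` ins)" using rigid_open jordan(2) by blast
  then obtain z where z: "z \<in> g ` ins" "z \<in> h ` ins" "generic z" using generic_exists ne by blast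
  obtain w1 w2 where w: "w1 \<in> ins" "z = g w1" "w2 \<in> ins" "z = h w2" using z by blast
  have orb: "w \<in> orbit a b z" if f: "f \<in> G" "z = f w" for f w
  proof -
    obtain f' where "f' \<in> G" "f' \<circ> f = id" using pgg_inverse[OF f(1)] by blast
    moreover from this obtain m n where "f' = gg a b m n" by (elim pggE)
    ultimately have "w = gg a b m n z" using f(2) by (metis comp_apply id_apply)
    then show ?thesis using orbitI by simp
  qed
  have "w1 \<in> orbit a b z \<inter> ins" "w2 \<in> orbit a b z \<inter> ins" using w orb g h by blast+
  then have "w1 = w2" using orbit_ins_unique[OF z(3)] by (metis singletonD)
  moreover have "generic w1" using generic_orbit[OF z(3)] orb g w by blast
  moreover obtain m n where "g = gg a b m n" using g by (rule pggE)
  moreover obtain m' n' where "h = gg a b m' n'" using h by (rule pggE)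
  ultimately show ?thesis using generic_free[of w1 m n m' n'] w by simp
qed

text \<open>A tile is the closure of its interior, so a tile meeting an open set covered by
  \<open>S\<close> overlaps a member of \<open>S\<close> in an open set and equals it. Thus tiles
  that fill a neighbourhood of a point are all the tiles at that point.\<close>

lemma tiles_overlap:
  assumes h: "h \<in> G" and U: "open U" "U \<inter> h ` reg \<noteq> {}" and S: "S \<subseteq> G" "U \<subseteq> (\<Union>g\<in>S. g ` reg)"
  shows "h \<in> S"
proof -
  obtain d where d: "rigid d h" using pgg_rigid h by blast
  let ?V = "U \<inter> h ` ins"
  have V: "?V \<noteq> {}" "open ?V" using open_meets_tile[OF d U] U(1) rigid_open[OF d jordan(2)] by auto
  then obtain y where "y \<in> ?V" by blast
  then obtain g where g: "g \<in> S" "?V \<inter> g ` reg \<noteq> {}" using S(2) by blast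
  then obtain e where e: "rigid e g" using pgg_rigid S(1) by blast
  have "?V \<inter> g ` ins \<noteq> {}" by (rule open_meets_tile[OF e V(2) g(2)])
  then have "h = g" using tiles_disjoint[OF h, of g] g(1) S(1) by blast
  then show ?thesis using g by simp
qed

lemma locally_finite: "finite {g \<in> G. g ` reg \<inter> cball x r \<noteq> {}}"
proof -
  obtain B where B: "\<And>z. z \<in> reg \<Longrightarrow> norm z \<le> B"
    using compact_imp_bounded[OF compact_reg] unfolding bounded_iff by blast
  define M where "M c = \<lceil>(B + norm x + r) / \<bar>c\<bar>\<rceil>" for c :: real
  have bd: "\<bar>k\<bar> \<le> M c" if "c \<noteq> 0" "\<bar>real_of_int k * c\<bar> \<le> B + norm x + r" for k c
  proof -
    have "\<bar>real_of_int k\<bar> \<le> (B + norm x + r) / \<bar>c\<bar>" using that by (simp add: abs_mult field_simps)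
    then show ?thesis unfolding M_def by linarith
  qed
  have "{g \<in> G. g ` reg \<inter> cball x r \<noteq> {}} \<subseteq> (\<lambda>(m, n). gg a b m n) ` ({- M a..M a} \<times> {- M b..M b})"
  proof
    fix g assume "g \<in> {g \<in> G. g ` reg \<inter> cball x r \<noteq> {}}"
    then have gG: "g \<in> G" and "g ` reg \<inter> cball x r \<noteq> {}" by auto
    moreover obtain m n where g: "g = gg a b m n" using gG by (rule pggE)
    ultimately obtain z where z: "z \<in> reg" "gg a b m n z \<in> cball x r" by blast
    have "norm (gg a b m n z) \<le> norm x + r"
      using z(2) norm_triangle_ineq2[of "gg a b m n z" x] by (simp add: dist_norm norm_minus_commute)
    then have re: "\<bar>Re (gg a b m n z)\<bar> \<le> norm x + r" "\<bar>Im (gg a b m n z)\<bar> \<le> norm x + r"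
      using abs_Re_le_cmod abs_Im_le_cmod order_trans by blast+
    have "\<bar>real_of_int (ps n) * Re z\<bar> \<le> B" "\<bar>real_of_int (ps m) * Im z\<bar> \<le> B"
      using B[OF z(1)] abs_Re_le_cmod[of z] abs_Im_le_cmod[of z] by (auto simp: abs_mult ps_sq)
    then have "\<bar>real_of_int m * a\<bar> \<le> B + norm x + r" "\<bar>real_of_int n * b\<bar> \<le> B + norm x + r"
      using re by (auto simp: gg_def)
    then have "\<bar>m\<bar> \<le> M a" "\<bar>n\<bar> \<le> M b" using bd nondegenerate by blast+
    then show "g \<in> (\<lambda>(m, n). gg a b m n) ` ({- M a..M a} \<times> {- M b..M b})"
      unfolding g by (intro image_eqI[of _ _ "(m, n)"]) auto
  qed
  then show ?thesis by (rule finite_subset) simp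
qed

text \<open>Near \<open>x\<close> only finitely many tiles matter, and their union is closed. If
  they missed \<open>x\<close>, they would miss a whole disc; but this contains a generic point, and
  generic points are covered.\<close>

lemma tiles_cover: "\<exists>g\<in>G. x \<in> g ` reg"
proof (rule ccontr)
  assume no: "\<not> (\<exists>g\<in>G. x \<in> g ` reg)"
  define F where "F = {g \<in> G. g ` reg \<inter> cball x 1 \<noteq> {}}"
  have "closed (\<Union>g\<in>F. g ` reg)"
  proof (intro closed_UN ballI)
    show "finite F" unfolding F_def by (rule locally_finite)
    fix g assume "g \<in> F"
    then obtain d where "rigid d g" using pgg_rigid unfolding F_def by blast
    then show "closed (g ` reg)" using closed_reg by (rule rigid_closed)
  qed
  moreover have "x \<notin> (\<Union>g\<in>F. g ` reg)" using no unfolding F_def by blast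
  ultimately obtain r where r: "0 < r" "ball x r \<subseteq> - (\<Union>g\<in>F. g ` reg)"
    using open_contains_ball[of "- (\<Union>g\<in>F. g ` reg)"] by (metis ComplI open_Compl)
  obtain z where z: "z \<in> ball x (min r 1)" "generic z"
    using generic_exists[of "ball x (min r 1)"] r(1)
    by (metis centre_in_ball empty_iff min_less_iff_conj open_ball zero_less_one)
  obtain w where w: "w \<in> orbit a b z" "w \<in> ins" using orbit_ins_unique[OF z(2)] by blast
  then obtain m n where "w = gg a b m n z" unfolding orbit_def by blast
  then have zz: "z = gg a b (- (ps n * m)) (- (ps m * n)) w" by (simp add: gg_inv_apply)
  let ?g = "gg a b (- (ps n * m)) (- (ps m * n))"
  have "z \<in> ?g ` reg" using zz w(2) ins_subset_reg by blast
  moreover have "z \<in> cball x 1" using z(1) by auto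
  ultimately have "?g \<in> F" using gg_in_pgg unfolding F_def by blast
  moreover have "z \<in> ball x r" using z(1) by simp
  ultimately show False using \<open>z \<in> ?g ` reg\<close> r(2) by blast
qed

lemma plane_tiling_T: "plane_tiling (hexagon p) T"
  unfolding plane_tiling_def
proof (intro conjI ballI impI)
  fix t assume "t \<in> T"
  then obtain g where g: "g \<in> G" "t = tile g" unfolding T_def by blast
  then obtain d where "rigid d g" using pgg_rigid by blast
  then show "congruent_copy (hexagon p) t"
    unfolding congruent_copy_def using g(2) rigid_isometry by blast
next
  show "(\<Union>t\<in>T. region t) = UNIV"
  proof (intro set_eqI iffI UNIV_I)
    fix x :: complex
    obtain g where "g \<in> G" "x \<in> g ` reg" using tiles_cover[of x] by (elim bexE)
    then show "x \<in> (\<Union>t\<in>T. region t)"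
      unfolding T_def by (intro UN_I[of "tile g"] imageI) (simp_all only: region_tile)
  qed
next
  fix s t assume "s \<in> T" "t \<in> T" and ne: "s \<noteq> t"
  then obtain g h where gh: "g \<in> G" "h \<in> G" "s = tile g" "t = tile h"
    unfolding T_def by blast
  then have "g \<noteq> h" using ne by auto
  then have "g ` ins \<inter> h ` ins = {}" using tiles_disjoint[OF gh(1,2)] by argo
  moreover obtain d where "rigid d g" using pgg_rigid gh(1) by blast
  moreover obtain e where "rigid e h" using pgg_rigid gh(2) by blast
  ultimately show "interior (region s) \<inter> interior (region t) = {}"
    using interior_tile gh by simp
qed

section \<open>The tiles at a vertex, and the side-to-side property\<close>

lemma vertex_nbhd_0:
  "\<exists>r>0. ball (p 0) r \<subseteq> (\<Union>h\<in>{id, gg a b 1 (-1), gg a b 0 (-1)}. h ` reg)"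
proof -
  \<comment> \<open>The listed tiles have their corners 0, 1 and 3 at \<open>p 0\<close>; crossing
    either side there leads from each of them to another one of the list.\<close>
  let ?C = "{(id, 0::nat), (gg a b 1 (-1), 1), (gg a b 0 (-1), 3)}"
  have f: "fst ` ?C = {id, gg a b 1 (-1), gg a b 0 (-1)}" by auto
  have "\<exists>r>0. ball (p 0) r \<subseteq> (\<Union>h\<in>fst ` ?C. h ` reg)"
  proof (rule corner_nbhd)
    fix h k assume "(h, k) \<in> ?C"
    then show "h \<in> G \<and> k < 6 \<and> h (p k) = p 0 \<and> (h \<circ> nb k) \<in> fst ` ?C \<and> (h \<circ> nb ((k + 5) mod 6)) \<in> fst ` ?C"
      unfolding f
      by (auto simp: id_in_pgg gg_in_pgg paired_eqs halfturns nbr_def gg_comp ps_def gg_0)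
  qed auto
  then show ?thesis unfolding f .
qed

lemma vertex_nbhd_4:
  "\<exists>r>0. ball (p 4) r \<subseteq> (\<Union>h\<in>{id, gg a b (-1) (-1), gg a b (-1) 0}. h ` reg)"
proof -
  \<comment> \<open>Here the corners 4, 5 and 2 come together.\<close>
  let ?C = "{(id, 4::nat), (gg a b (-1) (-1), 5), (gg a b (-1) 0, 2)}"
  have f: "fst ` ?C = {id, gg a b (-1) (-1), gg a b (-1) 0}" by auto
  have "\<exists>r>0. ball (p 4) r \<subseteq> (\<Union>h\<in>fst ` ?C. h ` reg)"
  proof (rule corner_nbhd)
    fix h k assume "(h, k) \<in> ?C"
    then show "h \<in> G \<and> k < 6 \<and> h (p k) = p 4 \<and> (h \<circ> nb k) \<in> fst ` ?C \<and> (h \<circ> nb ((k + 5) mod 6)) \<in> fst ` ?C"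
      unfolding f
      by (auto simp: id_in_pgg gg_in_pgg paired_eqs halfturns nbr_def gg_comp ps_def gg_0)
  qed auto
  then show ?thesis unfolding f .
qed

text \<open>Collects what is needed of the tiles at a vertex in a form that elements of the group
  transport.\<close>

definition surrounds :: "(complex \<Rightarrow> complex) set \<Rightarrow> complex \<Rightarrow> bool" where
  "surrounds S v \<longleftrightarrow> S \<subseteq> G \<and> card S = 3 \<and> (\<exists>r>0. ball v r \<subseteq> (\<Union>h\<in>S. h ` reg)) \<and>
     (\<forall>h\<in>S. \<exists>i<6. h (p i) = v)"

lemma surrounds_0: "surrounds {id, gg a b 1 (-1), gg a b 0 (-1)} (p 0)"
  unfolding surrounds_def
proof (intro conjI vertex_nbhd_0)
  show "{id, gg a b 1 (-1), gg a b 0 (-1)} \<subseteq> G" using id_in_pgg gg_in_pgg by simp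
  show "card {id, gg a b 1 (-1), gg a b 0 (-1)} = 3"
    unfolding gg_0[of a b, symmetric] by (simp add: gg_eq[OF nondegenerate])
  have "\<exists>i<6. id (p i) = p 0" by (rule exI[of _ 0]) simp
  moreover have "\<exists>i<6. gg a b 1 (-1) (p i) = p 0" by (rule exI[of _ 1]) (simp add: halfturns)
  moreover have "\<exists>i<6. gg a b 0 (-1) (p i) = p 0" by (rule exI[of _ 3]) (simp add: paired_eqs)
  ultimately show "\<forall>h\<in>{id, gg a b 1 (-1), gg a b 0 (-1)}. \<exists>i<6. h (p i) = p 0"
    by (simp only: ball_simps simp_thms)
qed

lemma surrounds_4: "surrounds {id, gg a b (-1) (-1), gg a b (-1) 0} (p 4)"
  unfolding surrounds_def
proof (intro conjI vertex_nbhd_4)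
  show "{id, gg a b (-1) (-1), gg a b (-1) 0} \<subseteq> G" using id_in_pgg gg_in_pgg by simp
  show "card {id, gg a b (-1) (-1), gg a b (-1) 0} = 3"
    unfolding gg_0[of a b, symmetric] by (simp add: gg_eq[OF nondegenerate])
  have "\<exists>i<6. id (p i) = p 4" by (rule exI[of _ 4]) simp
  moreover have "\<exists>i<6. gg a b (-1) (-1) (p i) = p 4" by (rule exI[of _ 5]) (simp add: halfturns)
  moreover have "\<exists>i<6. gg a b (-1) 0 (p i) = p 4" by (rule exI[of _ 2]) (simp add: paired_eqs)
  ultimately show "\<forall>h\<in>{id, gg a b (-1) (-1), gg a b (-1) 0}. \<exists>i<6. h (p i) = p 4"
    by (simp only: ball_simps simp_thms)
qed

lemma surrounds_image:
  assumes f: "f \<in> G" and S: "surrounds S v" shows "surrounds ((\<lambda>h. f \<circ> h) ` S) (f v)"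
  unfolding surrounds_def
proof (intro conjI ballI)
  obtain d where d: "rigid d f" using pgg_rigid[OF f] by blast
  show "(\<lambda>h. f \<circ> h) ` S \<subseteq> G" using f S pgg_comp unfolding surrounds_def by blast
  have "inj_on (\<lambda>h. f \<circ> h) S"
  proof (rule inj_onI)
    fix h h' assume "f \<circ> h = f \<circ> h'"
    then have "f (h z) = f (h' z)" for z by (metis comp_apply)
    then show "h = h'" using rigid_inj[OF d] by (intro ext) (rule injD)
  qed
  then show "card ((\<lambda>h. f \<circ> h) ` S) = 3" using S by (simp add: card_image surrounds_def)
  obtain r where r: "0 < r" "ball v r \<subseteq> (\<Union>h\<in>S. h ` reg)" using S unfolding surrounds_def by blast
  have "ball (f v) r \<subseteq> f ` (\<Union>h\<in>S. h ` reg)"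
    using image_mono[OF r(2), of f] unfolding rigid_ball[OF d] .
  also have "\<dots> = (\<Union>h\<in>(\<lambda>h. f \<circ> h) ` S. h ` reg)" by (simp add: image_UN image_image)
  finally show "\<exists>r>0. ball (f v) r \<subseteq> (\<Union>h\<in>(\<lambda>h. f \<circ> h) ` S. h ` reg)" using r(1) by blast
  fix h assume "h \<in> (\<lambda>h. f \<circ> h) ` S"
  then obtain h' where h': "h' \<in> S" "h = f \<circ> h'" by blast
  then obtain i where "i < 6" "h' (p i) = v" using S unfolding surrounds_def by blast
  then show "\<exists>i<6. h (p i) = f v" using h'(2) by (intro exI[of _ i]) simp
qed

text \<open>The pairing divides the corners into the classes {0, 1, 3} and {2, 4, 5}, so two
  vertices represent all.\<close>

lemma corner_orbits:
  assumes "k < 6" obtains u where "u \<in> G" "p k = u (p 0) \<or> p k = u (p 4)"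
  using assms
proof (cases rule: less_6_cases)
  case 1 then show ?thesis using that[OF id_in_pgg] by simp
next
  case 2 then show ?thesis using that[OF gg_in_pgg[of a b 1 "-1"]] by (simp add: halfturns)
next
  case 3 then show ?thesis using that[OF gg_in_pgg[of a b 1 0]] by (simp add: paired_eqs)
next
  case 4 then show ?thesis using that[OF gg_in_pgg[of a b 0 1]] by (simp add: paired_eqs)
next
  case 5 then show ?thesis using that[OF id_in_pgg] by simp
next
  case 6 then show ?thesis using that[OF gg_in_pgg[of a b "-1" "-1"]] by (simp add: halfturns)
qed

lemma vertex_surrounded:
  assumes g: "g \<in> G" and k: "k < 6"
  obtains S where "surrounds S (g (p k))"
proof -
  obtain u where u: "u \<in> G" "p k = u (p 0) \<or> p k = u (p 4)" using corner_orbits[OF k] .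
  have gu: "g \<circ> u \<in> G" by (rule pgg_comp[OF g u(1)])
  from u(2) show thesis
  proof
    assume "p k = u (p 0)"
    then have "(g \<circ> u) (p 0) = g (p k)" by simp
    then show thesis using that surrounds_image[OF gu surrounds_0] by simp
  next
    assume "p k = u (p 4)"
    then have "(g \<circ> u) (p 4) = g (p k)" by simp
    then show thesis using that surrounds_image[OF gu surrounds_4] by simp
  qed
qed

lemma vertex_three:
  assumes g: "g \<in> G" and k: "k < 6"
  obtains S r where "S \<subseteq> G" "card S = 3" "0 < r" "ball (g (p k)) r \<subseteq> (\<Union>h\<in>S. h ` reg)"
    "\<And>h. h \<in> S \<Longrightarrow> \<exists>j<6. h (p j) = g (p k)"
proof -
  obtain S where S: "surrounds S (g (p k))" using vertex_surrounded[OF g k] .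
  then obtain r where "0 < r" "ball (g (p k)) r \<subseteq> (\<Union>h\<in>S. h ` reg)" unfolding surrounds_def by blast
  then show thesis using that[of S r] S unfolding surrounds_def by simp
qed

text \<open>The common point is on the boundary of \<open>g\<close>. Within a side only the
  neighbour across it can be the other tile, and at a corner only the three surrounding tiles, all
  of which have a corner there.\<close>

lemma region_meet_cases:
  assumes g: "g \<in> G" and h: "h \<in> G" and gh: "g \<noteq> h" and x: "x \<in> g ` reg" "x \<in> h ` reg"
  shows "(\<exists>k<6. \<exists>j<6. x \<in> g ` side p k \<and> g ` side p k = h ` side p j) \<or>
    (\<exists>k<6. \<exists>j<6. x = g (p k) \<and> x = h (p j))"
proof -
  obtain y where y: "y \<in> reg" "x = g y" using x(1) by blast
  obtain d where d: "rigid d g" using pgg_rigid[OF g] by blast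
  have "y \<notin> ins"
  proof
    assume "y \<in> ins"
    then have "g ` ins \<inter> h ` reg \<noteq> {}" using x y by blast
    moreover have "open (g ` ins)" using rigid_open[OF d jordan(2)] .
    ultimately have "h \<in> {g}" using g ins_subset_reg by (intro tiles_overlap[OF h, of "g ` ins" "{g}"]) auto
    then show False using gh by simp
  qed
  then obtain k where k: "k < 6" "y \<in> side p k" using y(1) unfolding reg_def bd_eq by blast
  show ?thesis
  proof (cases "y \<in> open_segment (p k) (p (nx k))")
    case True
    then obtain r where r: "0 < r" "ball x r \<subseteq> g ` reg \<union> (g \<circ> nb k) ` reg"
      using side_nbhd[OF g k(1)] y(2) by blast
    have "h \<in> {g, g \<circ> nb k}"
    proof (rule tiles_overlap[OF h, of "ball x r"])
      show "ball x r \<inter> h ` reg \<noteq> {}" using x(2) r(1) by (metis IntI centre_in_ball empty_iff)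
      show "{g, g \<circ> nb k} \<subseteq> G" using g pgg_comp nbr_in_pgg by blast
      show "ball x r \<subseteq> (\<Union>g\<in>{g, g \<circ> nb k}. g ` reg)" using r(2) by simp
    qed simp
    then have "h = g \<circ> nb k" using gh by blast
    then have "h ` side p (partner k) = g ` side p k"
      using nbr_side[OF k(1)] by (simp only: image_comp[symmetric])
    then show ?thesis using k y(2) nbr_spec(1)[OF k(1)] by blast
  next
    case False
    then have "y = p k \<or> y = p (nx k)" using k by (auto simp: side_eq_segment open_segment_def)
    then obtain i where i: "i < 6" "y = p i" using k(1) by (metis mod_less_divisor zero_less_numeral)
    obtain S r where S: "S \<subseteq> G" "0 < r" "ball (g (p i)) r \<subseteq> (\<Union>h\<in>S. h ` reg)"
      "\<And>h. h \<in> S \<Longrightarrow> \<exists>j<6. h (p j) = g (p i)"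
      using vertex_three[OF g i(1)] by metis
    have "h \<in> S"
    proof (rule tiles_overlap[OF h _ _ S(1,3)])
      show "ball (g (p i)) r \<inter> h ` reg \<noteq> {}" using x(2) S(2) y(2) i(2) by (metis IntI centre_in_ball empty_iff)
    qed simp
    then show ?thesis using S(4) i y(2) by metis
  qed
qed

lemma side_to_side_T: "side_to_side T"
  unfolding side_to_side_def
proof (intro ballI impI)
  fix s t assume "s \<in> T" "t \<in> T" and ne: "s \<noteq> t"
  then obtain g h where gh: "g \<in> G" "h \<in> G" "s = tile g" "t = tile h"
    unfolding T_def by blast
  then have "g \<noteq> h" using ne by auto
  have sub: "side p k \<subseteq> reg" if "k < 6" for k using that unfolding reg_def bd_eq by blast
  have subp: "p k \<in> reg" if "k < 6" for k using that sub corner_in_side(1) by blast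
  show "region s \<inter> region t = \<Union>(sides s \<inter> sides t) \<union> (corners s \<inter> corners t)"
  proof
    show "region s \<inter> region t \<subseteq> \<Union>(sides s \<inter> sides t) \<union> (corners s \<inter> corners t)"
    proof
      fix x assume "x \<in> region s \<inter> region t"
      then have "x \<in> g ` reg" "x \<in> h ` reg" unfolding gh region_tile by auto
      from region_meet_cases[OF gh(1,2) \<open>g \<noteq> h\<close> this]
      show "x \<in> \<Union>(sides s \<inter> sides t) \<union> (corners s \<inter> corners t)"
      proof
        assume "\<exists>k<6. \<exists>j<6. x \<in> g ` side p k \<and> g ` side p k = h ` side p j"
        then obtain k j where kj: "k < 6" "j < 6" "x \<in> g ` side p k" "g ` side p k = h ` side p j" by blast
        have "g ` side p k \<in> sides s" "h ` side p j \<in> sides t"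
          unfolding gh move_hexagon_sel using kj(1,2) by auto
        then show ?thesis using kj by auto
      next
        assume "\<exists>k<6. \<exists>j<6. x = g (p k) \<and> x = h (p j)"
        then obtain k j where kj: "k < 6" "j < 6" "x = g (p k)" "x = h (p j)" by blast
        have "g (p k) \<in> corners s" "h (p j) \<in> corners t"
          unfolding gh move_hexagon_sel using kj(1,2) by auto
        then show ?thesis using kj(3,4) by simp
      qed
    qed
    show "\<Union>(sides s \<inter> sides t) \<union> (corners s \<inter> corners t) \<subseteq> region s \<inter> region t"
    proof -
      have "X \<subseteq> region (tile f)" if "X \<in> sides (tile f)" for f X
        using that sub unfolding move_hexagon_sel(3) region_tile by (auto intro!: image_mono)
      then have "\<Union>(sides s \<inter> sides t) \<subseteq> region s \<inter> region t" unfolding gh(3,4) by fast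
      moreover have "corners (tile f) \<subseteq> region (tile f)" for f
        using subp unfolding move_hexagon_sel(2) region_tile by (auto intro!: image_mono)
      then have "corners s \<inter> corners t \<subseteq> region s \<inter> region t" unfolding gh(3,4) by fast
      ultimately show ?thesis by (rule Un_least)
    qed
  qed
qed

lemma vertex_degree_T:
  assumes "v \<in> tiling_vertices T" shows "vertex_degree T v = 3"
proof -
  obtain g k where g: "g \<in> G" "k < 6" "v = g (p k)"
    using assms unfolding tiling_vertices_def T_def by (auto simp: move_hexagon_sel)
  obtain S r where S: "S \<subseteq> G" "card S = 3" "0 < r" "ball v r \<subseteq> (\<Union>h\<in>S. h ` reg)"
      "\<And>h. h \<in> S \<Longrightarrow> \<exists>j<6. h (p j) = v"
    using vertex_three[OF g(1,2)] unfolding g(3) by metis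
  have "{t \<in> T. v \<in> region t} = tile ` S"
  proof
    show "{t \<in> T. v \<in> region t} \<subseteq> tile ` S"
    proof
      fix t assume t: "t \<in> {t \<in> T. v \<in> region t}"
      then obtain h where h: "h \<in> G" "t = tile h" unfolding T_def by blast
      then have "v \<in> h ` reg" using t by (simp add: region_tile)
      then have "ball v r \<inter> h ` reg \<noteq> {}" using S(3) by (metis IntI centre_in_ball empty_iff)
      then have "h \<in> S" using tiles_overlap[OF h(1) _ _ S(1,4)] by simp
      then show "t \<in> tile ` S" using h by blast
    qed
    show "tile ` S \<subseteq> {t \<in> T. v \<in> region t}"
    proof clarify
      fix h assume h: "h \<in> S"
      then obtain j where j: "j < 6" "h (p j) = v" using S(5) by blast
      have "p j \<in> reg" using j(1) corner_in_side(1) unfolding reg_def bd_eq by blast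
      then have "v \<in> region (tile h)" unfolding region_tile j(2)[symmetric] by (rule imageI)
      moreover have "tile h \<in> T" unfolding T_def using h S(1) by (intro imageI) auto
      ultimately show "tile h \<in> T \<and> v \<in> region (tile h)" by (intro conjI)
    qed
  qed
  moreover have "inj_on tile S"
  proof (rule inj_onI)
    fix g h assume gh: "g \<in> S" "h \<in> S" "tile g = tile h"
    have G: "g \<in> G" "h \<in> G" using gh(1,2) S(1) by auto
    obtain d where d: "rigid d g" using pgg_rigid G(1) by blast
    obtain e where e: "rigid e h" using pgg_rigid G(2) by blast
    note de = d e
    then have "g ` ins = h ` ins" using gh(3) interior_tile[OF de(1)] interior_tile[OF de(2)] by simp
    then show "g = h" using tiles_disjoint[of g h] gh S(1) jordan(1) by auto
  qed
  ultimately show ?thesis unfolding vertex_degree_def using S(2) by (simp add: card_image)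
qed

lemma degree3_tiling_T: "degree3_tiling (hexagon p) T"
  unfolding degree3_tiling_def using plane_tiling_T side_to_side_T vertex_degree_T by blast

end

section \<open>Uniqueness\<close>

context simple_hex
begin

text \<open>Provides explicit points on the normal at the midpoint, so that two tiles with a common
  side can be tested at one and the same point.\<close>

lemma side_ray:
  assumes f: "rigid d f" and k: "k < 6"
  defines "E \<equiv> f (p (nx k)) - f (p k)" and "x \<equiv> midpoint (f (p k)) (f (p (nx k)))"
  obtains r where "0 < r"
    "\<And>h. 0 < h \<Longrightarrow> h < r \<Longrightarrow> x + of_real (h * sg * ori d) * \<i> * E \<in> f ` ins"
    "\<And>h. 0 < h \<Longrightarrow> h < r \<Longrightarrow> x - of_real (h * sg * ori d) * \<i> * E \<notin> f ` reg"
proof -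
  have "p k \<noteq> p (nx k)" using corner_eq[OF k, of "nx k"] k by (auto simp: mod_Suc)
  then have ne: "f (p k) \<noteq> f (p (nx k))" using rigid_inj[OF f] by (simp add: inj_eq)
  then have E0: "E \<noteq> 0" by (simp add: E_def)
  have x: "x \<in> open_segment (f (p k)) (f (p (nx k)))" using ne unfolding x_def by simp
  obtain r where r: "0 < r"
    "\<And>z. z \<in> ball x r \<Longrightarrow> 0 < sg * ori d * Im ((z - x) / E) \<Longrightarrow> z \<in> f ` ins"
    "\<And>z. z \<in> ball x r \<Longrightarrow> sg * ori d * Im ((z - x) / E) < 0 \<Longrightarrow> z \<notin> f ` reg"
    using local_tile[OF f k x] unfolding E_def by metis
  have so: "\<bar>sg\<bar> = 1" "\<bar>ori d\<bar> = 1" "sg * sg = 1" "ori d * ori d = 1" using sg_cases by (auto simp: ori_def)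
  have b: "x + of_real (s * h * sg * ori d) * \<i> * E \<in> ball x r \<and>
      sg * ori d * Im ((x + of_real (s * h * sg * ori d) * \<i> * E - x) / E) = s * h"
    if "0 < h" "h < r / norm E" "\<bar>s\<bar> = 1" for h s
  proof
    have "norm (of_real (s * h * sg * ori d) * \<i> * E) = h * norm E"
      using that so by (simp only: norm_mult norm_of_real abs_mult) simp
    also have "\<dots> < r" using that E0 by (simp add: pos_less_divide_eq)
    finally show "x + of_real (s * h * sg * ori d) * \<i> * E \<in> ball x r"
      by (simp add: dist_norm)
    have "(x + of_real (s * h * sg * ori d) * \<i> * E - x) / E = of_real (s * h * sg * ori d) * \<i>"
      using E0 by simp
    then have "Im ((x + of_real (s * h * sg * ori d) * \<i> * E - x) / E) = s * h * sg * ori d" by simp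
    then have "sg * ori d * Im ((x + of_real (s * h * sg * ori d) * \<i> * E - x) / E) = s * h * (sg * sg) * (ori d * ori d)"
      by (simp only: mult.assoc mult.left_commute mult.commute)
    then show "sg * ori d * Im ((x + of_real (s * h * sg * ori d) * \<i> * E - x) / E) = s * h"
      unfolding so by simp
  qed
  show thesis
  proof (rule that[of "r / norm E"])
    show "0 < r / norm E" using r(1) E0 by simp
    fix h :: real assume h: "0 < h" "h < r / norm E"
    show "x + of_real (h * sg * ori d) * \<i> * E \<in> f ` ins"
      using b[OF h, of 1] r(2) h(1) by simp
    have "x + of_real (-1 * h * sg * ori d) * \<i> * E \<notin> f ` reg"
      using b[OF h, of "-1"] h(1) by (intro r(3)) simp_all
    then show "x - of_real (h * sg * ori d) * \<i> * E \<notin> f ` reg" by simp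
  qed
qed

text \<open>\<open>s\<close> tells whether both boundaries run along the common side in the same
  direction. The interiors are on the same side of it exactly when the orientations agree up to
  \<open>s\<close>.\<close>

lemma shared_side_cases:
  assumes f: "rigid d f" and g: "rigid e g" and k: "k < 6" and j: "j < 6"
    and s: "(f (p k) = g (p j) \<and> f (p (nx k)) = g (p (nx j)) \<and> s = 1) \<or>
      (f (p k) = g (p (nx j)) \<and> f (p (nx k)) = g (p j) \<and> s = -1)"
  shows "ori d = s * ori e \<Longrightarrow> f ` ins \<inter> g ` ins \<noteq> {}"
    and "ori d \<noteq> s * ori e \<Longrightarrow> f ` ins \<noteq> g ` ins"
proof -
  define E where "E = f (p (nx k)) - f (p k)"
  define x where "x = midpoint (f (p k)) (f (p (nx k)))"
  obtain r1 where r1: "0 < r1"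
    "\<And>h. 0 < h \<Longrightarrow> h < r1 \<Longrightarrow> x + of_real (h * sg * ori d) * \<i> * E \<in> f ` ins"
    using side_ray[OF f k] unfolding E_def x_def by metis
  have gx: "midpoint (g (p j)) (g (p (nx j))) = x" "g (p (nx j)) - g (p j) = of_real s * E"
    using s by (auto simp: x_def E_def midpoint_sym)
  obtain r2 where r2: "0 < r2"
    "\<And>h. 0 < h \<Longrightarrow> h < r2 \<Longrightarrow> x + of_real (h * sg * ori e) * \<i> * (of_real s * E) \<in> g ` ins"
    "\<And>h. 0 < h \<Longrightarrow> h < r2 \<Longrightarrow> x - of_real (h * sg * ori e) * \<i> * (of_real s * E) \<notin> g ` reg"
    using side_ray[OF g j] unfolding gx by metis
  define h where "h = min r1 r2 / 2"
  have h: "0 < h" "h < r1" "h < r2" using r1(1) r2(1) by (auto simp: h_def)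
  have F: "x + of_real (h * sg * ori d) * \<i> * E \<in> f ` ins" using r1(2) h by blast
  show "f ` ins \<inter> g ` ins \<noteq> {}" if eq: "ori d = s * ori e"
  proof -
    have z: "x + of_real (h * sg * ori e) * \<i> * (of_real s * E) = x + of_real (h * sg * ori d) * \<i> * E"
      unfolding eq by simp
    have "x + of_real (h * sg * ori d) * \<i> * E \<in> g ` ins" using r2(2)[OF h(1,3)] unfolding z .
    then show ?thesis using F by blast
  qed
  show "f ` ins \<noteq> g ` ins" if ne: "ori d \<noteq> s * ori e"
  proof -
    have eq: "ori d = - (s * ori e)" using ne s by (auto simp: ori_def split: if_splits)
    have z: "x - of_real (h * sg * ori e) * \<i> * (of_real s * E) = x + of_real (h * sg * ori d) * \<i> * E"
      unfolding eq by simp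
    have "x + of_real (h * sg * ori d) * \<i> * E \<notin> g ` reg" using r2(3)[OF h(1,3)] unfolding z .
    then show ?thesis using F ins_subset_reg by blast
  qed
qed

lemma side_length_eq: "k < 6 \<Longrightarrow> side_length p k = dist (p k) (p (nx k))"
  by (simp add: side_length_def Suc_eq_plus1)

lemma moved_side_eq:
  assumes f: "rigid d f" and g: "rigid e g" and k: "k < 6" and j: "j < 6"
    and eq: "f ` side p k = g ` side p j"
  shows "(f (p k) = g (p j) \<and> f (p (nx k)) = g (p (nx j))) \<or>
      (f (p k) = g (p (nx j)) \<and> f (p (nx k)) = g (p j))"
    "side_length p k = side_length p j"
proof -
  have "closed_segment (f (p k)) (f (p (nx k))) = closed_segment (g (p j)) (g (p (nx j)))"
    using eq k j by (simp add: side_eq_segment rigid_segment(1)[OF f] rigid_segment(1)[OF g])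
  then show c: "(f (p k) = g (p j) \<and> f (p (nx k)) = g (p (nx j))) \<or>
      (f (p k) = g (p (nx j)) \<and> f (p (nx k)) = g (p j))"
    by (simp add: doubleton_eq_iff)
  have "dist (f (p k)) (f (p (nx k))) = dist (g (p j)) (g (p (nx j)))"
    using c by (auto simp: dist_commute)
  then show "side_length p k = side_length p j"
    using k j by (simp add: side_length_eq rigid_imp_dist[OF f] rigid_imp_dist[OF g])
qed

end

text \<open>The interior angle as a point of the unit circle, conjugated if the hexagon runs
  clockwise. Angle sums become products, with no multiples of 2 pi to track.\<close>

definition corner_dir :: "(nat \<Rightarrow> complex) \<Rightarrow> nat \<Rightarrow> complex" where
  "corner_dir p k = sgn ((p ((k + 5) mod 6) - p k) / (p (nx k) - p k))"

locale labelled_hex = normal_hex +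
  assumes len13: "side_length p 3 = side_length p 1"
    and len25: "side_length p 5 = side_length p 2"
    and len_ne: "side_length p 0 \<noteq> side_length p 1" "side_length p 0 \<noteq> side_length p 2"
      "side_length p 0 \<noteq> side_length p 4" "side_length p 4 \<noteq> side_length p 1"
      "side_length p 4 \<noteq> side_length p 2" "side_length p 1 \<noteq> side_length p 2"
    and dir013: "corner_dir p 0 * corner_dir p 1 * corner_dir p 3 = 1"
    and dir245: "corner_dir p 2 * corner_dir p 4 * corner_dir p 5 = 1"
    and dir23: "corner_dir p 2 \<noteq> corner_dir p 3"
begin

text \<open>The hexagon has no symmetry: side 0 is recognized by its length, its ends by the
  different lengths of the adjacent sides, and the orientation by where the interior lies.\<close>

lemma tile_inj:
  assumes f: "rigid d f" and g: "rigid e g" and eq: "tile f = tile g"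
  shows "f = g"
proof -
  have ins: "f ` ins = g ` ins" using eq interior_tile[OF f] interior_tile[OF g] by simp
  have sides: "\<exists>j<6. f ` side p k = g ` side p j" if "k < 6" for k
  proof -
    have "f ` side p k \<in> sides (tile g)" unfolding eq[symmetric] move_hexagon_sel using that by blast
    then show ?thesis unfolding move_hexagon_sel by auto
  qed
  obtain j where j: "j < 6" "f ` side p 0 = g ` side p j" using sides[of 0] by auto
  note m = moved_side_eq[OF f g _ j]
  have "j = 0" using m(2) j(1) len_ne len13 len25 by (elim less_6_cases) auto
  then have "(f (p 0) = g (p 0) \<and> f (p 1) = g (p 1)) \<or> (f (p 0) = g (p 1) \<and> f (p 1) = g (p 0))"
    using m(1) by (simp add: Suc_mod_6)
  moreover have "\<not> (f (p 0) = g (p 1) \<and> f (p 1) = g (p 0))"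
  proof
    \<comment> \<open>A reversal would take side 5 to a side at corner 1, that is to side 0 or 1,
      but its length is that of side 2.\<close>
    assume sw: "f (p 0) = g (p 1) \<and> f (p 1) = g (p 0)"
    obtain i where i: "i < 6" "f ` side p 5 = g ` side p i" using sides[of 5] by auto
    note m5 = moved_side_eq[OF f g _ i]
    have "f (p 0) = g (p i) \<or> f (p 0) = g (p (nx i))" using m5(1) by (auto simp: Suc_mod_6)
    then have "p 1 = p i \<or> p 1 = p (nx i)" using sw rigid_inj[OF g] by (auto simp: inj_eq)
    then have "1 = i \<or> 1 = nx i" using corner_eq[of 1 i] corner_eq[of 1 "nx i"] i(1) by auto
    then have "i = 0 \<or> i = 1" using i(1) by (auto simp: mod_Suc split: if_splits)
    then show False using m5(2) len_ne len25 by auto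
  qed
  ultimately have s: "f (p 0) = g (p 0)" "f (p 1) = g (p 1)" by auto
  have "ori d = 1 * ori e"
    using shared_side_cases(2)[OF f g, of 0 0 1] s ins by (auto simp: Suc_mod_6)
  then have "d = e" by (auto simp: ori_def split: if_splits)
  then show ?thesis using rigid_eqI[of d f g "p 0" "p 1"] f g s corner_eq[of 0 1] by auto
qed

end

section \<open>An arbitrary side-to-side tiling with vertices of degree 3\<close>

locale deg3_hex = labelled_hex +
  fixes T' :: "polygon set"
  assumes T': "degree3_tiling (hexagon p) T'"
begin

text \<open>Isometries replace the tiles because they carry the corner labels;
  \<open>tile_inj\<close> makes the correspondence one to one.\<close>

definition F :: "(complex \<Rightarrow> complex) set" where
  "F = {f. plane_isometry f \<and> tile f \<in> T'}"

definition pos :: "(complex \<Rightarrow> complex) \<Rightarrow> bool" where "pos f \<longleftrightarrow> rigid True f"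

lemma degree3_facts:
  shows T'_copy: "\<And>t. t \<in> T' \<Longrightarrow> congruent_copy (hexagon p) t"
    and T'_cover: "(\<Union>t\<in>T'. region t) = UNIV"
    and T'_disjoint: "\<And>s t. s \<in> T' \<Longrightarrow> t \<in> T' \<Longrightarrow> s \<noteq> t \<Longrightarrow>
      interior (region s) \<inter> interior (region t) = {}"
    and T'_meet: "\<And>s t. s \<in> T' \<Longrightarrow> t \<in> T' \<Longrightarrow> s \<noteq> t \<Longrightarrow>
      region s \<inter> region t = \<Union>(sides s \<inter> sides t) \<union> (corners s \<inter> corners t)"
    and T'_degree: "\<And>v. v \<in> tiling_vertices T' \<Longrightarrow> card {t \<in> T'. v \<in> region t} = 3"
  using T' unfolding degree3_tiling_def plane_tiling_def side_to_side_def vertex_degree_def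
  by simp_all

lemma F_rigid: "f \<in> F \<Longrightarrow> rigid (pos f) f"
proof -
  assume "f \<in> F"
  then obtain d where "rigid d f" unfolding F_def plane_isometry_iff_rigid by auto
  then show ?thesis unfolding pos_def by (cases d; cases "rigid True f") auto
qed

lemma T'_F: "t \<in> T' \<Longrightarrow> \<exists>f\<in>F. t = tile f"
proof -
  assume t: "t \<in> T'"
  obtain f where "plane_isometry f" "t = tile f"
    using T'_copy[OF t] unfolding congruent_copy_def by blast
  then show ?thesis using t by (intro bexI[of _ f]) (simp_all add: F_def)
qed

lemma F_T': "f \<in> F \<Longrightarrow> tile f \<in> T'"
  unfolding F_def by simp

lemma F_inj: "f \<in> F \<Longrightarrow> g \<in> F \<Longrightarrow> tile f = tile g \<Longrightarrow> f = g"
  using tile_inj[OF F_rigid F_rigid] .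

lemma F_disjoint:
  assumes "f \<in> F" "g \<in> F" "f \<noteq> g" shows "f ` ins \<inter> g ` ins = {}"
proof -
  have "tile f \<noteq> tile g" using F_inj[OF assms(1,2)] assms(3) by argo
  then have "interior (region (tile f)) \<inter> interior (region (tile g)) = {}"
    using T'_disjoint F_T' assms(1,2) by simp
  then show ?thesis unfolding interior_tile[OF F_rigid[OF assms(1)]] interior_tile[OF F_rigid[OF assms(2)]] .
qed

lemma F_cover: "\<exists>f\<in>F. x \<in> f ` reg"
proof -
  have "x \<in> (\<Union>t\<in>T'. region t)" unfolding T'_cover by simp
  then obtain t where t: "t \<in> T'" "x \<in> region t" by (elim UN_E)
  obtain f where f: "f \<in> F" "t = tile f" using T'_F[OF t(1)] by (elim bexE)
  then have "x \<in> f ` reg" using t(2) by (simp only: region_tile)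
  then show ?thesis using f(1) by (intro bexI)
qed

lemma F_meet:
  assumes "f \<in> F" "g \<in> F" "f \<noteq> g" "x \<in> f ` reg" "x \<in> g ` reg"
  shows "(\<exists>k<6. \<exists>j<6. x \<in> f ` side p k \<and> f ` side p k = g ` side p j) \<or>
    (\<exists>k<6. \<exists>j<6. x = f (p k) \<and> x = g (p j))"
proof -
  let ?s = "tile f" and ?t = "tile g"
  have "?s \<noteq> ?t" using F_inj[OF assms(1,2)] assms(3) by argo
  then have eq: "region ?s \<inter> region ?t = \<Union>(sides ?s \<inter> sides ?t) \<union> (corners ?s \<inter> corners ?t)"
    using T'_meet F_T' assms(1,2) by simp
  have "x \<in> region ?s \<inter> region ?t" using assms(4,5) by (simp add: region_tile)
  then have "x \<in> \<Union>(sides ?s \<inter> sides ?t) \<union> (corners ?s \<inter> corners ?t)" unfolding eq .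
  then show ?thesis
  proof
    assume "x \<in> \<Union>(sides ?s \<inter> sides ?t)"
    then obtain X where X: "x \<in> X" "X \<in> sides ?s" "X \<in> sides ?t" by blast
    obtain k where k: "k < 6" "X = f ` side p k" using X(2) unfolding move_hexagon_sel by auto
    obtain j where j: "j < 6" "X = g ` side p j" using X(3) unfolding move_hexagon_sel by auto
    have "x \<in> f ` side p k" "f ` side p k = g ` side p j" using k j X(1) by auto
    then show ?thesis using k(1) j(1) by blast
  next
    assume x: "x \<in> corners ?s \<inter> corners ?t"
    obtain k where k: "k < 6" "x = f (p k)" using x unfolding move_hexagon_sel by auto
    obtain j where j: "j < 6" "x = g (p j)" using x unfolding move_hexagon_sel by auto
    show ?thesis
    proof (rule disjI2)
      show "\<exists>k<6. \<exists>j<6. x = f (p k) \<and> x = g (p j)"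
        by (rule exI[of _ k], rule conjI[OF k(1)], rule exI[of _ j], intro conjI j(1) k(2) j(2))
    qed
  qed
qed

lemma F_degree:
  assumes "f \<in> F" "k < 6" shows "card {g \<in> F. f (p k) \<in> g ` reg} = 3"
proof -
  let ?v = "f (p k)"
  have "?v \<in> tiling_vertices T'"
    unfolding tiling_vertices_def
    by (rule UN_I[OF F_T'[OF assms(1)]]) (use assms(2) in \<open>auto simp: move_hexagon_sel\<close>)
  then have "card {t \<in> T'. ?v \<in> region t} = 3"
    by (rule T'_degree)
  moreover have "{t \<in> T'. ?v \<in> region t} = tile ` {g \<in> F. ?v \<in> g ` reg}"
  proof
    show "{t \<in> T'. ?v \<in> region t} \<subseteq> tile ` {g \<in> F. ?v \<in> g ` reg}"
    proof
      fix t assume t: "t \<in> {t \<in> T'. ?v \<in> region t}"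
      then have "\<exists>f\<in>F. t = tile f" using T'_F by simp
      then obtain g where g: "g \<in> F" "t = tile g" by (elim bexE)
      then have "?v \<in> g ` reg" using t region_tile by simp
      then show "t \<in> tile ` {g \<in> F. ?v \<in> g ` reg}" using g by simp
    qed
    show "tile ` {g \<in> F. ?v \<in> g ` reg} \<subseteq> {t \<in> T'. ?v \<in> region t}"
    proof (intro image_subsetI CollectI conjI)
      fix g assume g: "g \<in> {g \<in> F. ?v \<in> g ` reg}"
      then show "tile g \<in> T'" using F_T' by simp
      show "?v \<in> region (tile g)" using g by (simp add: region_tile)
    qed
  qed
  moreover have "inj_on tile {g \<in> F. ?v \<in> g ` reg}"
    by (rule inj_onI, rule F_inj) simp_all
  ultimately show ?thesis by (simp add: card_image)
qed

text \<open>Every tile contains a disc of radius \<open>s\<close> about the image of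
  \<open>c\<close>, and no other such image lies in it. These separated points cannot accumulate, so
  a bounded region contains finitely many.\<close>

lemma F_locally_finite: "finite {f \<in> F. f ` reg \<inter> cball x r \<noteq> {}}"
proof -
  obtain c where "c \<in> ins" using jordan(1) by blast
  then obtain s where s: "0 < s" "ball c s \<subseteq> ins"
    using jordan(2) open_contains_ball by blast
  obtain B0 where B0: "\<And>z. z \<in> reg \<Longrightarrow> norm z \<le> B0"
    using compact_imp_bounded[OF compact_reg] unfolding bounded_iff by blast
  define B where "B = B0 + norm c"
  have B: "dist z c \<le> B" if "z \<in> reg" for z
    using B0[OF that] norm_triangle_ineq4[of z c] by (simp add: dist_norm B_def)
  let ?X = "{f \<in> F. f ` reg \<inter> cball x r \<noteq> {}}"
  have sep: "s \<le> dist (f c) (g c)" if "f \<in> F" "g \<in> F" "f \<noteq> g" for f g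
  proof (rule ccontr)
    assume "\<not> s \<le> dist (f c) (g c)"
    then have "f c \<in> ball (g c) s" by (simp add: dist_commute)
    then have "f c \<in> g ` ins" using s(2) rigid_ball[OF F_rigid[OF that(2)], of c s] by blast
    moreover have "f c \<in> f ` ins" using s by (intro imageI) (simp add: subset_iff)
    ultimately show False using F_disjoint[OF that] by blast
  qed
  have inj: "inj_on (\<lambda>f. f c) ?X"
  proof (rule inj_onI, rule ccontr)
    fix f g assume "f \<in> ?X" "g \<in> ?X" "f c = g c" "f \<noteq> g"
    then show False using sep[of f g] s(1) by simp
  qed
  have sub: "(\<lambda>f. f c) ` ?X \<subseteq> cball x (r + B)"
  proof
    fix y assume "y \<in> (\<lambda>f. f c) ` ?X"
    then obtain f where f: "f \<in> F" "f ` reg \<inter> cball x r \<noteq> {}" "y = f c" by blast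
    then obtain z where z: "z \<in> reg" "dist x (f z) \<le> r" by auto
    have "dist (f z) (f c) \<le> B" using B[OF z(1)] rigid_imp_dist[OF F_rigid[OF f(1)]] by simp
    then show "y \<in> cball x (r + B)" using z(2) dist_triangle[of x "f c" "f z"] f(3) by simp
  qed
  have "finite ((\<lambda>f. f c) ` ?X)"
  proof (rule ccontr)
    assume "infinite ((\<lambda>f. f c) ` ?X)"
    then obtain l where "l islimpt ((\<lambda>f. f c) ` ?X)"
      using compact_eq_Bolzano_Weierstrass[of "cball x (r + B)"] compact_cball sub by blast
    then have inf: "infinite ((\<lambda>f. f c) ` ?X \<inter> ball l (s / 2))"
      using islimpt_eq_infinite_ball[of l] s(1) by simp
    then obtain y where y: "y \<in> (\<lambda>f. f c) ` ?X \<inter> ball l (s / 2)"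
      using infinite_imp_nonempty[OF inf] by blast
    have "infinite ((\<lambda>f. f c) ` ?X \<inter> ball l (s / 2) - {y})" using inf by simp
    from infinite_imp_nonempty[OF this]
    obtain y' where y': "y' \<in> (\<lambda>f. f c) ` ?X \<inter> ball l (s / 2) - {y}" by blast
    obtain f g where fg: "f \<in> F" "g \<in> F" "y = f c" "y' = g c" using y y' by blast
    then have "f \<noteq> g" using y' by blast
    then have "s \<le> dist y y'" using sep fg by simp
    moreover have "dist l y < s / 2" "dist l y' < s / 2" using y y' by auto
    ultimately show False using dist_triangle3[of y y' l] by simp
  qed
  then show ?thesis using finite_image_iff[OF inj] by blast
qed

text \<open>Just beyond the midpoint of the side there are points of other tiles, and by local
  finiteness the other tiles nearby form a closed set; so one of them contains the midpoint. As the
  midpoint is no corner, the side-to-side property leaves only a common side.\<close>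

lemma side_shared:
  assumes f: "f \<in> F" and k: "k < 6"
  obtains g j where "g \<in> F" "g \<noteq> f" "j < 6" "f ` side p k = g ` side p j"
proof -
  define E where "E = f (p (nx k)) - f (p k)"
  define x where "x = midpoint (f (p k)) (f (p (nx k)))"
  note rf = F_rigid[OF f]
  define N where "N = {g \<in> F. g ` reg \<inter> cball x 1 \<noteq> {}} - {f}"
  have "closed (\<Union>g\<in>N. g ` reg)"
  proof (intro closed_UN ballI)
    show "finite N" unfolding N_def using F_locally_finite by simp
    fix g assume "g \<in> N"
    then have "g \<in> F" by (simp add: N_def)
    then show "closed (g ` reg)" using rigid_closed[OF F_rigid closed_reg] by simp
  qed
  have "x \<in> (\<Union>g\<in>N. g ` reg)"
  proof (rule ccontr)
    assume "x \<notin> (\<Union>g\<in>N. g ` reg)"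
    then obtain s where s: "0 < s" "ball x s \<subseteq> - (\<Union>g\<in>N. g ` reg)"
      using open_contains_ball[of "- (\<Union>g\<in>N. g ` reg)"] \<open>closed _\<close>
      by (metis ComplI open_Compl)
    obtain r where r: "0 < r" "\<And>h. 0 < h \<Longrightarrow> h < r \<Longrightarrow> x - of_real (h * sg * ori (pos f)) * \<i> * E \<notin> f ` reg"
      using side_ray[OF rf k] unfolding E_def x_def by metis
    \<comment> \<open>Keeps \<open>z\<close> within the distances \<open>s\<close> and 1 of
      \<open>x\<close>; adding 1 to \<open>norm E\<close> makes the denominator positive.\<close>
    define h where "h = min (r / 2) (min s 1 / (2 * (norm E + 1)))"
    have n: "0 < norm E + 1" by (simp add: add_nonneg_pos)
    then have h: "0 < h" "h < r" using r(1) s(1) by (auto simp: h_def)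
    define z where "z = x - of_real (h * sg * ori (pos f)) * \<i> * E"
    have "\<bar>h * sg * ori (pos f)\<bar> = h" using sg_cases h(1) by (auto simp: abs_mult ori_def)
    then have "dist x z = h * norm E" by (simp only: z_def dist_norm) (simp add: norm_mult abs_mult)
    also have "\<dots> \<le> min s 1 / (2 * (norm E + 1)) * (norm E + 1)"
      using h(1) n s(1) by (intro mult_mono) (auto simp: h_def)
    also have "\<dots> = min s 1 / 2" using n by (simp add: field_simps)
    finally have z: "dist x z < s" "dist x z < 1" using s(1) by auto
    have "z \<notin> f ` reg" unfolding z_def by (rule r(2)[OF h])
    obtain g where g: "g \<in> F" "z \<in> g ` reg" using F_cover[of z] by (elim bexE)
    then have "g \<noteq> f" using \<open>z \<notin> f ` reg\<close> by auto
    moreover have "z \<in> g ` reg \<inter> cball x 1" using g(2) z(2) by simp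
    ultimately have "g \<in> N" using g(1) unfolding N_def by blast
    then have "z \<in> (\<Union>g\<in>N. g ` reg)" using g(2) by blast
    moreover have "z \<in> ball x s" using z(1) by simp
    ultimately show False using s(2) by blast
  qed
  then obtain g where gN: "g \<in> N" and xg: "x \<in> g ` reg" by (elim UN_E)
  then have g: "g \<in> F" "g \<noteq> f" by (auto simp: N_def)
  have kk: "nx k < 6" "nx k \<noteq> k" using k by (auto simp: mod_Suc)
  then have "p k \<noteq> p (nx k)" using corner_eq k by simp
  then have "midpoint (p k) (p (nx k)) \<in> open_segment (p k) (p (nx k))" by simp
  moreover have "f (p k) \<noteq> f (p (nx k))" using \<open>p k \<noteq> _\<close> rigid_inj[OF rf] by (simp add: inj_eq)
  then have "x \<in> open_segment (f (p k)) (f (p (nx k)))" unfolding x_def by simp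
  then obtain y where y: "y \<in> open_segment (p k) (p (nx k))" "x = f y"
    unfolding rigid_segment(2)[OF rf, symmetric] by (elim imageE)
  then have yk: "y \<in> side p k" using k by (simp add: side_eq_segment open_segment_def)
  then have "y \<in> reg" using k unfolding reg_def bd_eq by blast
  then have xf: "x \<in> f ` reg" using y(2) by simp
  have inj: "f u \<in> f ` X \<longleftrightarrow> u \<in> X" for u X using rigid_inj[OF rf] by (simp add: inj_image_mem_iff)
  from F_meet[OF f g(1) not_sym[OF g(2)] xf xg] show thesis
  proof
    assume "\<exists>k'<6. \<exists>j<6. x \<in> f ` side p k' \<and> f ` side p k' = g ` side p j"
    then obtain k' j where kj: "k' < 6" "j < 6" "x \<in> f ` side p k'" "f ` side p k' = g ` side p j" by blast
    have "y \<in> side p k'" using kj(3) unfolding y(2) inj .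
    then have "k' = k" using open_side_notin_other[OF k kj(1) _ y(1)] by blast
    then show thesis using that[OF g kj(2)] kj(4) by simp
  next
    assume "\<exists>k'<6. \<exists>j<6. x = f (p k') \<and> x = g (p j)"
    then obtain k' where k': "k' < 6" "x = f (p k')" by blast
    then have yk': "y = p k'" using y(2) rigid_inj[OF rf] by (simp add: inj_eq)
    have False
    proof (cases "k' = k")
      case True then show False using y(1) yk' by (simp add: open_segment_def)
    next
      case False
      then show False using open_side_notin_other[OF k k'(1) False y(1)] corner_in_side(1)[OF k'(1)] yk' by simp
    qed
    then show thesis ..
  qed
qed

lemma vertex_corner:
  assumes f: "f \<in> F" and k: "k < 6" and g: "g \<in> F" "f (p k) \<in> g ` reg"
  shows "\<exists>j<6. g (p j) = f (p k)"
proof (cases "f = g")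
  case True then show ?thesis using k by blast
next
  case False
  note rf = F_rigid[OF f] and rg = F_rigid[OF g(1)]
  have "p k \<in> reg" using k corner_in_side(1) unfolding reg_def bd_eq by blast
  then have "f (p k) \<in> f ` reg" by simp
  from F_meet[OF f g(1) False this g(2)] show ?thesis
  proof
    assume "\<exists>k'<6. \<exists>j<6. f (p k) \<in> f ` side p k' \<and> f ` side p k' = g ` side p j"
    then obtain k' j where kj: "k' < 6" "j < 6" "f (p k) \<in> f ` side p k'" "f ` side p k' = g ` side p j" by blast
    have "p k \<in> side p k'" using kj(3) rigid_inj[OF rf] by (simp add: inj_image_mem_iff)
    then have "p k \<in> {p k', p (nx k')}"
      using side_Int[OF kj(1) k] corner_in_side(1)[OF k] by (cases "k' = k") auto
    then have "f (p k) = f (p k') \<or> f (p k) = f (p (nx k'))" by auto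
    then have "f (p k) = g (p j) \<or> f (p k) = g (p (nx j))"
      using moved_side_eq(1)[OF rf rg kj(1,2,4)] by auto
    moreover have "nx j < 6" by simp
    ultimately show ?thesis using kj(2) by metis
  next
    assume "\<exists>k'<6. \<exists>j<6. f (p k) = f (p k') \<and> f (p k) = g (p j)"
    then show ?thesis by metis
  qed
qed

text \<open>Seen from the corner \<open>k\<close> of the tile \<open>f\<close>, the tile lies to the left of the ray towards its corner
  \<open>lray f k\<close> and to the right of the ray towards \<open>rray f k\<close>. Passing from a tile to its neighbour across
  the left ray permutes the three tiles at a vertex without fixed point, hence cyclically.\<close>

definition left :: "(complex \<Rightarrow> complex) \<Rightarrow> bool" where
  "left f \<longleftrightarrow> sg * ori (pos f) = 1"

definition lray :: "(complex \<Rightarrow> complex) \<Rightarrow> nat \<Rightarrow> nat" where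
  "lray f k = (if left f then nx k else (k + 5) mod 6)"

definition rray :: "(complex \<Rightarrow> complex) \<Rightarrow> nat \<Rightarrow> nat" where
  "rray f k = (if left f then (k + 5) mod 6 else nx k)"

lemma left_iff: "(left f = left g) = (pos f = pos g)" "(left f \<noteq> left g) = (pos f \<noteq> pos g)"
  using sg_cases by (auto simp: left_def ori_def split: if_splits)

lemma shared_side_left:
  assumes f: "f \<in> F" and g: "g \<in> F" and fg: "f \<noteq> g" and k: "k < 6" and j: "j < 6"
  shows "f (p k) = g (p j) \<Longrightarrow> f (p (nx k)) = g (p (nx j)) \<Longrightarrow> left f \<noteq> left g"
    "f (p k) = g (p (nx j)) \<Longrightarrow> f (p (nx k)) = g (p j) \<Longrightarrow> left f = left g"
proof -
  note c = shared_side_cases(1)[OF F_rigid[OF f] F_rigid[OF g] k j] and d = F_disjoint[OF f g fg]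
  show "left f \<noteq> left g" if "f (p k) = g (p j)" "f (p (nx k)) = g (p (nx j))"
  proof -
    have "ori (pos f) \<noteq> 1 * ori (pos g)" using c[of 1] that d by auto
    then show ?thesis unfolding left_iff by (auto simp: ori_def split: if_splits)
  qed
  show "left f = left g" if "f (p k) = g (p (nx j))" "f (p (nx k)) = g (p j)"
  proof -
    have "ori (pos f) \<noteq> -1 * ori (pos g)" using c[of "-1"] that d by auto
    then show ?thesis unfolding left_iff by (auto simp: ori_def split: if_splits)
  qed
qed

lemma pred_Suc_6: "k < 6 \<Longrightarrow> (nx k + 5) mod 6 = k"
  by presburger

text \<open>Some other tile shares the side on the left ray of \<open>f\<close>. The interiors are
  disjoint, so that tile lies to the right of the ray, which is therefore its right ray.\<close>

lemma ray_neighbour: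
  assumes f: "f \<in> F" and k: "k < 6"
  obtains g j where "g \<in> F" "g \<noteq> f" "j < 6" "g (p j) = f (p k)" "g (p (rray g j)) = f (p (lray f k))"
proof (cases "left f")
  case True
  obtain g m where g: "g \<in> F" "g \<noteq> f" "m < 6" "f ` side p k = g ` side p m" using side_shared[OF f k] .
  have mm: "nx m < 6" by simp
  from moved_side_eq(1)[OF F_rigid[OF f] F_rigid[OF g(1)] k g(3,4)] show thesis
  proof
    assume e: "f (p k) = g (p m) \<and> f (p (nx k)) = g (p (nx m))"
    then have "\<not> left g" using shared_side_left(1)[OF f g(1) not_sym[OF g(2)] k g(3)] True by simp
    then show thesis using e True by (intro that[OF g(1-3)]) (simp_all add: lray_def rray_def)
  next
    assume e: "f (p k) = g (p (nx m)) \<and> f (p (nx k)) = g (p m)"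
    then have "left g" using shared_side_left(2)[OF f g(1) not_sym[OF g(2)] k g(3)] True by simp
    then show thesis using e True
      by (intro that[OF g(1,2) mm]) (simp_all only: lray_def rray_def pred_Suc_6[OF g(3)] if_True)
  qed
next
  case False
  define i where "i = (k + 5) mod 6"
  have i: "i < 6" "nx i = k" using k Suc_pred_mod_6 by (auto simp: i_def)
  obtain g m where g: "g \<in> F" "g \<noteq> f" "m < 6" "f ` side p i = g ` side p m" using side_shared[OF f i(1)] .
  have mm: "nx m < 6" by simp
  from moved_side_eq(1)[OF F_rigid[OF f] F_rigid[OF g(1)] i(1) g(3,4)] show thesis
  proof
    assume e: "f (p i) = g (p m) \<and> f (p (nx i)) = g (p (nx m))"
    then have "left g" using shared_side_left(1)[OF f g(1) not_sym[OF g(2)] i(1) g(3)] False by simp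
    then show thesis using e False unfolding i(2)
      by (intro that[OF g(1,2) mm]) (simp_all only: lray_def rray_def pred_Suc_6[OF g(3)] if_True if_False i_def)
  next
    assume e: "f (p i) = g (p (nx m)) \<and> f (p (nx i)) = g (p m)"
    then have "\<not> left g" using shared_side_left(2)[OF f g(1) not_sym[OF g(2)] i(1) g(3)] False by simp
    then show thesis using e False unfolding i(2)
      by (intro that[OF g(1-3)]) (simp_all only: lray_def rray_def if_False i_def)
  qed
qed

text \<open>Two different tiles to the left of one ray would overlap.\<close>

lemma lray_inj:
  assumes f: "f \<in> F" and g: "g \<in> F" and k: "k < 6" and j: "j < 6"
    and v: "f (p k) = g (p j)" and l: "f (p (lray f k)) = g (p (lray g j))"
  shows "f = g"
proof (rule ccontr)
  assume fg: "f \<noteq> g"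
  define k' j' where "k' = (k + 5) mod 6" and "j' = (j + 5) mod 6"
  have k': "k' < 6" "nx k' = k" using k Suc_pred_mod_6 by (auto simp: k'_def)
  have j': "j' < 6" "nx j' = j" using j Suc_pred_mod_6 by (auto simp: j'_def)
  note S = shared_side_left[OF f g fg]
  show False
  proof (cases "left f"; cases "left g")
    assume c: "left f" "left g"
    then have "f (p (nx k)) = g (p (nx j))" using l by (simp add: lray_def)
    then show False using S(1)[OF k j v] c by simp
  next
    assume c: "left f" "\<not> left g"
    then have "f (p (nx k)) = g (p j')" using l by (simp add: lray_def j'_def)
    then show False using S(2)[OF k j'(1)] v c unfolding j'(2) by simp
  next
    assume c: "\<not> left f" "left g"
    then have "f (p k') = g (p (nx j))" using l by (simp add: lray_def k'_def)
    then show False using S(2)[OF k'(1) j] v c unfolding k'(2) by simp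
  next
    assume c: "\<not> left f" "\<not> left g"
    then have "f (p k') = g (p j')" using l by (simp add: lray_def k'_def j'_def)
    then show False using S(1)[OF k'(1) j'(1)] v c unfolding k'(2) j'(2) by simp
  qed
qed

lemma vertex_cycle:
  assumes f: "f \<in> F" and k: "k < 6"
  obtains g j h i where "g \<in> F" "h \<in> F" "j < 6" "i < 6" "g (p j) = f (p k)" "h (p i) = f (p k)"
    "g (p (rray g j)) = f (p (lray f k))" "h (p (rray h i)) = g (p (lray g j))"
    "f (p (rray f k)) = h (p (lray h i))"
proof -
  define v where "v = f (p k)"
  define V where "V = {g \<in> F. v \<in> g ` reg}"
  have cV: "card V = 3" unfolding V_def v_def by (rule F_degree[OF f k])
  then have finV: "finite V" by (simp add: card_ge_0_finite)
  have memV: "g \<in> V" if "g \<in> F" "j < 6" "g (p j) = v" for g j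
  proof -
    have "p j \<in> reg" using that(2) corner_in_side(1) unfolding reg_def bd_eq by blast
    then have "v \<in> g ` reg" unfolding that(3)[symmetric] by (rule imageI)
    then show ?thesis using that(1) by (simp add: V_def)
  qed
  have uniq: "i = j" if "g \<in> F" "j < 6" "i < 6" "g (p j) = v" "g (p i) = v" for g i j
    using that corner_eq[of i j] injD[OF rigid_inj[OF F_rigid[OF that(1)]], of "p i" "p j"] by simp
  have fV: "f \<in> V" using memV[OF f k] by (simp add: v_def)
  obtain g j where g: "g \<in> F" "g \<noteq> f" "j < 6" "g (p j) = v" "g (p (rray g j)) = f (p (lray f k))"
    using ray_neighbour[OF f k] unfolding v_def by metis
  obtain h i where h: "h \<in> F" "h \<noteq> g" "i < 6" "h (p i) = v" "h (p (rray h i)) = g (p (lray g j))"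
    using ray_neighbour[OF g(1,3)] unfolding g(4) by metis
  have gV: "g \<in> V" and hV: "h \<in> V" using memV g h by blast+
  \<comment> \<open>Three tiles meet at \<open>v\<close>, so the tile across the left ray of the
    third one is \<open>f\<close> or \<open>g\<close>.\<close>
  have closing: "f (p (rray f k)) = u (p (lray u l)) \<or> g (p (rray g j)) = u (p (lray u l))"
    if V3: "V = {f, g, u}" and u: "u \<in> F" "l < 6" "u (p l) = v" for u l
  proof -
    obtain w m where w: "w \<in> F" "w \<noteq> u" "m < 6" "w (p m) = v" "w (p (rray w m)) = u (p (lray u l))"
      using ray_neighbour[OF u(1,2)] unfolding u(3) by metis
    then have "w = f \<or> w = g" using memV[OF w(1,3,4)] V3 by auto
    then show ?thesis
    proof
      assume "w = f"
      then have "m = k" using uniq[OF f k w(3)] w(4) by (simp add: v_def)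
      then show ?thesis using w(5) \<open>w = f\<close> by simp
    next
      assume "w = g"
      then have "m = j" using uniq[OF g(1,3) w(3) g(4)] w(4) by simp
      then show ?thesis using w(5) \<open>w = g\<close> by simp
    qed
  qed
  \<comment> \<open>If the walk closed up after two steps, crossing the left ray of the third tile
    \<open>u\<close> would lead to \<open>f\<close> or \<open>g\<close>. Each of these is already
    reached from the other, so \<open>lray_inj\<close> would identify \<open>u\<close> with one of
    them.\<close>
  have "h \<noteq> f"
  proof
    assume hf: "h = f"
    then have "i = k" using uniq[OF f k h(3)] h(4) by (simp add: v_def)
    obtain u where u: "u \<in> V" "u \<noteq> f" "u \<noteq> g"
    proof -
      have "\<not> V \<subseteq> {f, g}"
      proof
        assume "V \<subseteq> {f, g}"
        then have "card V \<le> card {f, g}" by (rule card_mono[rotated]) simp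
        also have "\<dots> \<le> 2" by (simp add: card_insert_le_m1)
        finally show False using cV by simp
      qed
      then show ?thesis using that by blast
    qed
    then have uF: "u \<in> F" "f (p k) \<in> u ` reg" by (simp_all add: V_def v_def)
    obtain l where l: "l < 6" "u (p l) = v" using vertex_corner[OF f k uF] by (auto simp: v_def)
    have "{f, g, u} \<subseteq> V" "card {f, g, u} = 3" using fV gV u g(2) by auto
    then have "V = {f, g, u}" using card_subset_eq[OF finV, of "{f, g, u}"] cV by simp
    from closing[OF this uF(1) l] show False
    proof
      assume "f (p (rray f k)) = u (p (lray u l))"
      then have "g (p (lray g j)) = u (p (lray u l))" using h(5) hf \<open>i = k\<close> by simp
      then show False using lray_inj[OF g(1) uF(1) g(3) l(1)] g(4) l(2) u(3) by simp
    next
      assume "g (p (rray g j)) = u (p (lray u l))"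
      then have "f (p (lray f k)) = u (p (lray u l))" using g(5) by simp
      then show False using lray_inj[OF f uF(1) k l(1)] l(2) u(2) by (simp add: v_def)
    qed
  qed
  then have "{f, g, h} \<subseteq> V" "card {f, g, h} = 3" using fV gV hV g(2) h(2) by auto
  then have "V = {f, g, h}" using card_subset_eq[OF finV, of "{f, g, h}"] cV by simp
  from closing[OF this h(1,3,4)] have "f (p (rray f k)) = h (p (lray h i))"
  proof
    assume "g (p (rray g j)) = h (p (lray h i))"
    then have "f (p (lray f k)) = h (p (lray h i))" using g(5) by simp
    then have "f = h" using lray_inj[OF f h(1) k h(3)] h(4) by (simp add: v_def)
    then show ?thesis using \<open>h \<noteq> f\<close> by simp
  qed
  then show thesis using that[OF g(1) h(1) g(3) h(3)] g h unfolding v_def by simp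
qed

end

lemma sgn_cnj: "sgn (cnj z) = cnj (sgn z)" for z :: complex
  by (simp add: sgn_eq)

lemma sgn_inverse_cnj: "z \<noteq> 0 \<Longrightarrow> sgn (1 / z) = cnj (sgn z)" for z :: complex
proof -
  assume z: "z \<noteq> 0"
  then have "norm (sgn z) = 1" by (simp add: norm_sgn)
  then have "sgn z * cnj (sgn z) = 1" using complex_norm_square[of "sgn z"] by simp
  then have "cnj (sgn z) = inverse (sgn z)" by (metis inverse_unique)
  then show ?thesis by (simp add: sgn_divide inverse_eq_divide sgn_1)
qed

section \<open>Which corners meet at a vertex\<close>

context deg3_hex
begin

definition llen :: "bool \<Rightarrow> nat \<Rightarrow> real" where
  "llen s k = side_length p (if s then k else (k + 5) mod 6)"

lemma ray_length:
  assumes f: "f \<in> F" and k: "k < 6"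
  shows "dist (f (p k)) (f (p (lray f k))) = llen (left f) k"
    "dist (f (p k)) (f (p (rray f k))) = llen (\<not> left f) k"
proof -
  have i: "(k + 5) mod 6 < 6" "Suc ((k + 5) mod 6) mod 6 = k" using k Suc_pred_mod_6 by auto
  note d = rigid_imp_dist[OF F_rigid[OF f]]
  have "side_length p ((k + 5) mod 6) = dist (p k) (p ((k + 5) mod 6))"
    unfolding side_length_eq[OF i(1)] i(2) by (rule dist_commute)
  then show "dist (f (p k)) (f (p (lray f k))) = llen (left f) k"
    "dist (f (p k)) (f (p (rray f k))) = llen (\<not> left f) k"
    unfolding d llen_def lray_def rray_def using side_length_eq[OF k] by simp_all
qed

definition oriented_dir :: "nat \<Rightarrow> complex" where
  "oriented_dir k = (if sg = 1 then corner_dir p k else cnj (corner_dir p k))"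

text \<open>A reflected tile conjugates the quotient and also exchanges its two rays. The effects
  cancel, so the value depends on the corner only.\<close>

lemma ray_ratio:
  assumes f: "f \<in> F" and k: "k < 6"
  shows "sgn ((f (p (rray f k)) - f (p k)) / (f (p (lray f k)) - f (p k))) = oriented_dir k"
proof -
  have i: "(k + 5) mod 6 < 6" "(k + 5) mod 6 \<noteq> k" "nx k < 6" "nx k \<noteq> k"
    using k by presburger+
  then have nz: "p ((k + 5) mod 6) - p k \<noteq> 0" "p (nx k) - p k \<noteq> 0"
    using corner_eq k by simp_all
  define A where "A = (p ((k + 5) mod 6) - p k) / (p (nx k) - p k)"
  have A0: "A \<noteq> 0" using nz by (simp add: A_def)
  have A1: "(p (nx k) - p k) / (p ((k + 5) mod 6) - p k) = 1 / A" by (simp add: A_def)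
  have cd: "corner_dir p k = sgn A" by (simp add: corner_dir_def A_def)
  note R = rigid_ratio[OF F_rigid[OF f]]
  have cc: "sgn (cnj (1 / A)) = sgn A" "sgn (1 / A) = cnj (sgn A)" "sgn (cnj A) = cnj (sgn A)"
    using sgn_inverse_cnj[OF A0] by (simp_all only: sgn_cnj complex_cnj_cnj)
  show ?thesis
    unfolding oriented_dir_def rray_def lray_def left_def R cd
    using sg_cases by (cases "pos f") (auto simp: A1 A_def[symmetric] cc ori_def simp del: complex_cnj_divide sgn_divide)
qed

text \<open>Consecutive tiles share a ray, so the three quotients of right ray by left ray multiply
  to 1, and the lengths along a shared ray agree. The last conclusion is the angle sum modulo 2
  pi.\<close>

lemma vertex_kinds:
  assumes f: "f \<in> F" and k: "k < 6"
  obtains g j h i where "g \<in> F" "h \<in> F" "j < 6" "i < 6" "g (p j) = f (p k)" "h (p i) = f (p k)"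
    "g (p (rray g j)) = f (p (lray f k))" "h (p (lray h i)) = f (p (rray f k))"
    "llen (left f) k = llen (\<not> left g) j" "llen (left g) j = llen (\<not> left h) i"
    "llen (left h) i = llen (\<not> left f) k"
    "corner_dir p k * corner_dir p j * corner_dir p i = 1"
proof -
  obtain g j h i where c: "g \<in> F" "h \<in> F" "j < 6" "i < 6" "g (p j) = f (p k)" "h (p i) = f (p k)"
    "g (p (rray g j)) = f (p (lray f k))" "h (p (rray h i)) = g (p (lray g j))"
    "f (p (rray f k)) = h (p (lray h i))" using vertex_cycle[OF f k] .
  define v where "v = f (p k)"
  have l: "llen (left f) k = llen (\<not> left g) j" "llen (left g) j = llen (\<not> left h) i"
    "llen (left h) i = llen (\<not> left f) k"
    unfolding ray_length[OF f k, symmetric] ray_length[OF c(1,3), symmetric] ray_length[OF c(2,4), symmetric]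
    unfolding c(5-9) by simp_all
  have nz: "w (p (lray w m)) - w (p m) \<noteq> 0" if "w \<in> F" "m < 6" for w m
  proof -
    have "lray w m < 6" "lray w m \<noteq> m" using that(2) by (auto simp: lray_def) presburger+
    then have "p (lray w m) \<noteq> p m" using corner_eq that(2) by simp
    then show ?thesis using rigid_inj[OF F_rigid[OF that(1)]] by (simp add: inj_eq)
  qed
  define x y z where "x = f (p (lray f k)) - v" and "y = g (p (lray g j)) - v" and "z = h (p (lray h i)) - v"
  have n: "x \<noteq> 0" "y \<noteq> 0" "z \<noteq> 0"
    using nz[OF f k] nz[OF c(1,3)] nz[OF c(2,4)] unfolding c(5,6) x_def y_def z_def v_def by auto
  have "oriented_dir k = sgn (z / x)" "oriented_dir j = sgn (x / y)" "oriented_dir i = sgn (y / z)"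
    using ray_ratio[OF f k] ray_ratio[OF c(1,3)] ray_ratio[OF c(2,4)]
    unfolding c(5-9) x_def y_def z_def v_def by simp_all
  then have "oriented_dir k * oriented_dir j * oriented_dir i = sgn ((z / x) * (x / y) * (y / z))" by (simp only: sgn_mult)
  also have "(z / x) * (x / y) * (y / z) = 1" using n by simp
  finally have d: "oriented_dir k * oriented_dir j * oriented_dir i = 1" by (simp add: sgn_1)
  have "corner_dir p k * corner_dir p j * corner_dir p i = 1"
  proof (cases "sg = 1")
    case True then show ?thesis using d by (simp add: oriented_dir_def)
  next
    case False
    then have "cnj (corner_dir p k * corner_dir p j * corner_dir p i) = 1" using d by (simp add: oriented_dir_def)
    then show ?thesis by (metis complex_cnj_cnj complex_cnj_one)
  qed
  then show thesis using that[OF c(1-7)] c(9) l by simp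
qed

text \<open>Cancelling against the two given products would make \<open>corner_dir p 2\<close> and
  \<open>corner_dir p 3\<close> equal.\<close>

lemma bad_dirs:
  "corner_dir p 0 * corner_dir p 1 * corner_dir p 2 \<noteq> 1" "corner_dir p 3 * corner_dir p 4 * corner_dir p 5 \<noteq> 1"
proof -
  have *: "x = y" if "u * x = 1" "u * y = 1" for u x y :: complex
  proof -
    have "u \<noteq> 0" using that(1) by auto
    then show ?thesis using that mult_left_cancel[of u x y] by simp
  qed
  show "corner_dir p 0 * corner_dir p 1 * corner_dir p 2 \<noteq> 1"
    using *[OF _ dir013] dir23 by blast
  have "corner_dir p 4 * corner_dir p 5 * corner_dir p 2 = 1" using dir245 by (simp add: ac_simps)
  then have "corner_dir p 4 * corner_dir p 5 * corner_dir p 3 \<noteq> 1" using * dir23 by blast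
  then show "corner_dir p 3 * corner_dir p 4 * corner_dir p 5 \<noteq> 1" by (simp add: ac_simps)
qed

text \<open>A finite search over labels and orientations, with \<open>j\<close> across the left ray
  of corner \<open>k\<close> and \<open>i\<close> across its right ray. Corners 1, 3 and 0 suffice
  because they are ends of the sides 1, 2, 3 and 5, beyond which the glide reflections lead.\<close>

lemma kinds_at:
  assumes l: "llen s k = llen (\<not> t) j" "llen t j = llen (\<not> u) i" "llen u i = llen (\<not> s) k"
    and d: "corner_dir p k * corner_dir p j * corner_dir p i = 1" and ji: "j < 6" "i < 6"
  shows "k = 1 \<Longrightarrow> (s \<longrightarrow> j = 3 \<and> \<not> t) \<and> (\<not> s \<longrightarrow> i = 3 \<and> u)"
    "k = 3 \<Longrightarrow> (s \<longrightarrow> j = 1 \<and> \<not> t \<and> i = 0 \<and> \<not> u) \<and> (\<not> s \<longrightarrow> j = 0 \<and> t \<and> i = 1 \<and> u)"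
    "k = 0 \<Longrightarrow> (s \<longrightarrow> i = 3 \<and> \<not> u) \<and> (\<not> s \<longrightarrow> j = 3 \<and> t)"
proof -
  let ?l = "side_length p" and ?A = "corner_dir p"
  note L = len13 len25 len_ne len_ne[symmetric]
  have ll: "llen s 0 = ?l (if s then 0 else 5)" "llen s 1 = ?l (if s then 1 else 0)"
    "llen s 2 = ?l (if s then 2 else 1)" "llen s 3 = ?l (if s then 3 else 2)"
    "llen s 4 = ?l (if s then 4 else 3)" "llen s 5 = ?l (if s then 5 else 4)" for s
    by (simp_all add: llen_def)
  have B: "?A 0 * ?A 1 * ?A 2 \<noteq> 1" "?A 0 * ?A 2 * ?A 1 \<noteq> 1" "?A 1 * ?A 0 * ?A 2 \<noteq> 1" "?A 1 * ?A 2 * ?A 0 \<noteq> 1"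
    "?A 3 * ?A 4 * ?A 5 \<noteq> 1" "?A 3 * ?A 5 * ?A 4 \<noteq> 1"
    using bad_dirs by (simp_all add: ac_simps)
  show "(s \<longrightarrow> j = 3 \<and> \<not> t) \<and> (\<not> s \<longrightarrow> i = 3 \<and> u)" if k: "k = 1"
    using ji l d unfolding k
    by (elim less_6_cases; cases s; cases t; cases u) (simp_all add: ll L B)
  show "(s \<longrightarrow> j = 1 \<and> \<not> t \<and> i = 0 \<and> \<not> u) \<and> (\<not> s \<longrightarrow> j = 0 \<and> t \<and> i = 1 \<and> u)" if k: "k = 3"
    using ji l d unfolding k
    by (elim less_6_cases; cases s; cases t; cases u) (simp_all add: ll L B)
  show "(s \<longrightarrow> i = 3 \<and> \<not> u) \<and> (\<not> s \<longrightarrow> j = 3 \<and> t)" if k: "k = 0"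
    using ji l d unfolding k
    by (elim less_6_cases; cases s; cases t; cases u) (simp_all add: ll L B)
qed

lemma neighbour_eq:
  assumes f: "f \<in> F" and g: "g \<in> F" and lr: "left g = (\<not> left f)"
    and u: "rigid False u" and xy: "x \<noteq> y" "g x = f (u x)" "g y = f (u y)"
  shows "f \<circ> u \<in> F"
proof -
  have "pos g = (\<not> pos f)" using lr left_iff(1)[of f g] by auto
  then have "rigid (\<not> pos f) g" using F_rigid[OF g] by simp
  moreover have "rigid (\<not> pos f) (f \<circ> u)" using rigid_comp[OF F_rigid[OF f] u] by simp
  ultimately have "g = f \<circ> u" using xy by (intro rigid_eqI[of _ _ _ x y]) simp_all
  then show ?thesis using g by simp
qed

text \<open>\<open>kinds_at\<close> tells which side of the adjacent tile is shared and that this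
  tile is reflected relative to \<open>f\<close>. By \<open>neighbour_eq\<close> the two ends of the
  side then identify it.\<close>

lemma F_neighbours:
  assumes f: "f \<in> F"
  shows "f \<circ> gg a b 1 0 \<in> F" "f \<circ> gg a b (-1) 0 \<in> F" "f \<circ> gg a b 0 1 \<in> F" "f \<circ> gg a b 0 (-1) \<in> F"
proof -
  have r: "rigid False (gg a b 1 0)" "rigid False (gg a b (-1) 0)" "rigid False (gg a b 0 1)" "rigid False (gg a b 0 (-1))"
    using gg_rigid[of 1 0 a b] gg_rigid[of "-1" 0 a b] gg_rigid[of 0 1 a b] gg_rigid[of 0 "-1" a b] by simp_all
  note N = neighbour_eq[OF f] and C = side_intersections(1-15)
  have m6: "(1 + 5) mod 6 = (0::nat)" "(3 + 5) mod 6 = (2::nat)" "(0 + 5) mod 6 = (5::nat)" by simp_all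
  have k6: "(1::nat) < 6" "(0::nat) < 6" "(3::nat) < 6" by simp_all
  show "f \<circ> gg a b 1 0 \<in> F"
  proof -
    obtain g j h i where v: "g \<in> F" "h \<in> F" "j < 6" "i < 6" "g (p j) = f (p 1)" "h (p i) = f (p 1)"
      "g (p (rray g j)) = f (p (lray f 1))" "h (p (lray h i)) = f (p (rray f 1))"
      and c: "llen (left f) 1 = llen (\<not> left g) j" "llen (left g) j = llen (\<not> left h) i"
      "llen (left h) i = llen (\<not> left f) 1" "corner_dir p 1 * corner_dir p j * corner_dir p i = 1"
      using vertex_kinds[OF f k6(1)] .
    note K = kinds_at(1)[OF c v(3,4) refl]
    show ?thesis
    proof (cases "left f")
      case True
      then have gj: "j = 3" "\<not> left g" using K by auto
      have "g (p 3) = f (p 1)" "g (p 4) = f (p 2)"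
        using v(5,7) gj True unfolding lray_def rray_def by (simp_all add: Suc_mod_6)
      then show ?thesis using N[OF v(1) _ r(1) C(13)] gj True by (simp add: paired_eqs)
    next
      case False
      then have hi: "i = 3" "left h" using K by auto
      have "h (p 3) = f (p 1)" "h (p 4) = f (p 2)"
        using v(6,8) hi False unfolding lray_def rray_def by (simp_all add: Suc_mod_6)
      then show ?thesis using N[OF v(2) _ r(1) C(13)] hi False by (simp add: paired_eqs)
    qed
  qed
  show "f \<circ> gg a b 0 (-1) \<in> F"
  proof -
    obtain g j h i where v: "g \<in> F" "h \<in> F" "j < 6" "i < 6" "g (p j) = f (p 0)" "h (p i) = f (p 0)"
      "g (p (rray g j)) = f (p (lray f 0))" "h (p (lray h i)) = f (p (rray f 0))"
      and c: "llen (left f) 0 = llen (\<not> left g) j" "llen (left g) j = llen (\<not> left h) i"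
      "llen (left h) i = llen (\<not> left f) 0" "corner_dir p 0 * corner_dir p j * corner_dir p i = 1"
      using vertex_kinds[OF f k6(2)] .
    note K = kinds_at(3)[OF c v(3,4) refl]
    show ?thesis
    proof (cases "left f")
      case True
      then have hi: "i = 3" "\<not> left h" using K by auto
      have "h (p 3) = f (p 0)" "h (p 2) = f (p 5)"
        using v(6,8) hi True unfolding lray_def rray_def hi(1) m6 by simp_all
      then show ?thesis using N[OF v(2) _ r(4) C(10)] hi True by (simp add: paired_eqs)
    next
      case False
      then have gj: "j = 3" "left g" using K by auto
      have "g (p 3) = f (p 0)" "g (p 2) = f (p 5)"
        using v(5,7) gj False unfolding lray_def rray_def gj(1) m6 by simp_all
      then show ?thesis using N[OF v(1) _ r(4) C(10)] gj False by (simp add: paired_eqs)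
    qed
  qed
  obtain g j h i where v: "g \<in> F" "h \<in> F" "j < 6" "i < 6" "g (p j) = f (p 3)" "h (p i) = f (p 3)"
    "g (p (rray g j)) = f (p (lray f 3))" "h (p (lray h i)) = f (p (rray f 3))"
    and c: "llen (left f) 3 = llen (\<not> left g) j" "llen (left g) j = llen (\<not> left h) i"
    "llen (left h) i = llen (\<not> left f) 3" "corner_dir p 3 * corner_dir p j * corner_dir p i = 1"
    using vertex_kinds[OF f k6(3)] .
  note K = kinds_at(2)[OF c v(3,4) refl]
  have "f \<circ> gg a b (-1) 0 \<in> F \<and> f \<circ> gg a b 0 1 \<in> F"
  proof (cases "left f")
    case True
    then have gj: "j = 1" "\<not> left g" "i = 0" "\<not> left h" using K by auto
    have "g (p 1) = f (p 3)" "g (p 2) = f (p 4)" "h (p 0) = f (p 3)" "h (p 5) = f (p 2)"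
      using v(5-8) gj True unfolding lray_def rray_def gj(1,3) m6 Suc_mod_6 by simp_all
    then show ?thesis
      using N[OF v(1) _ r(2) C(6)] N[OF v(2) _ r(3) C(5)] gj True by (simp add: paired_eqs)
  next
    case False
    then have gj: "j = 0" "left g" "i = 1" "left h" using K by auto
    have "h (p 1) = f (p 3)" "h (p 2) = f (p 4)" "g (p 0) = f (p 3)" "g (p 5) = f (p 2)"
      using v(5-8) gj False unfolding lray_def rray_def gj(1,3) m6 Suc_mod_6 by simp_all
    then show ?thesis
      using N[OF v(2) _ r(2) C(6)] N[OF v(1) _ r(3) C(5)] gj False by (simp add: paired_eqs)
  qed
  then show "f \<circ> gg a b (-1) 0 \<in> F" "f \<circ> gg a b 0 1 \<in> F" by simp_all
qed

lemma F_group: "f \<in> F \<Longrightarrow> f \<circ> gg a b m n \<in> F"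
proof -
  assume f: "f \<in> F"
  have N: "h \<circ> gg a b m n \<in> F \<Longrightarrow> gg a b m n \<circ> u = gg a b m' n' \<Longrightarrow>
      (\<And>h. h \<in> F \<Longrightarrow> h \<circ> u \<in> F) \<Longrightarrow> h \<circ> gg a b m' n' \<in> F" for h m n m' n' u
    by (metis comp_assoc)
  have m: "f \<circ> gg a b m 0 \<in> F" for m
  proof (induction m rule: int_induct[of _ 0])
    case base show ?case using f by (simp add: gg_0)
  next
    case (step1 i)
    show ?case by (rule N[OF step1(2) _ F_neighbours(1)]) (simp_all add: gg_comp ps_def)
  next
    case (step2 i)
    show ?case by (rule N[OF step2(2) _ F_neighbours(2)]) (simp_all add: gg_comp ps_def)
  qed
  \<comment> \<open>Composing \<open>gg a b m n\<close> on the right with \<open>gg a b 0 1\<close>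
    adds \<open>ps m\<close> to \<open>n\<close>, so the direction of the step must depend on the
    parity of \<open>m\<close>.\<close>
  have Np: "h \<circ> gg a b 0 (ps m) \<in> F" "h \<circ> gg a b 0 (- ps m) \<in> F" if "h \<in> F" for h m
    using F_neighbours(3,4)[OF that] by (simp_all add: ps_def)
  show "f \<circ> gg a b m n \<in> F"
  proof (induction n rule: int_induct[of _ 0])
    case base show ?case by (rule m)
  next
    case (step1 i)
    show ?case by (rule N[OF step1(2) _ Np(1)[where m = m]]) (simp_all add: gg_comp ps_sq)
  next
    case (step2 i)
    show ?case by (rule N[OF step2(2) _ Np(2)[where m = m]]) (simp_all add: gg_comp ps_sq)
  qed
qed

lemma T'_unique: "\<exists>g. plane_isometry g \<and> T' = move g ` T"
proof -
  obtain f where f: "f \<in> F" using F_cover[of 0] by (elim bexE)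
  obtain f' where f': "f \<circ> f' = id" using rigid_inverse[OF F_rigid[OF f]] by metis
  have "T' = move f ` T"
  proof
    show "move f ` T \<subseteq> T'"
    proof
      fix t assume "t \<in> move f ` T"
      then obtain g where g: "g \<in> G" "t = move f (tile g)" unfolding T_def by auto
      obtain m n where "g = gg a b m n" using g(1) by (rule pggE)
      then show "t \<in> T'" using F_T'[OF F_group[OF f, of m n]] g(2) by (simp add: move_comp)
    qed
    show "T' \<subseteq> move f ` T"
    proof
      fix t assume "t \<in> T'"
      then obtain h where h: "h \<in> F" "t = tile h" using T'_F by blast
      obtain z where z: "z \<in> ins" using jordan(1) by blast
      obtain g where g: "g \<in> G" "f' (h z) \<in> g ` reg" using tiles_cover[of "f' (h z)"] by (elim bexE)
      have "f (f' (h z)) = h z" using f' by (metis comp_apply id_apply)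
      then have "h z \<in> (f \<circ> g) ` reg" using g(2) unfolding image_comp[symmetric] by (metis imageI)
      then have "h ` ins \<inter> (f \<circ> g) ` reg \<noteq> {}" using z by blast
      moreover obtain m n where mn: "g = gg a b m n" using g(1) by (rule pggE)
      have fg: "f \<circ> g \<in> F" unfolding mn by (rule F_group[OF f])
      ultimately have "h ` ins \<inter> (f \<circ> g) ` ins \<noteq> {}"
        using open_meets_tile[OF F_rigid[OF fg] rigid_open[OF F_rigid[OF h(1)] jordan(2)]] by simp
      then have "h = f \<circ> g" using F_disjoint[OF h(1) fg] by argo
      then have "t = move f (tile g)" using h(2) by (simp add: move_comp)
      then show "t \<in> move f ` T" using g(1) unfolding T_def by simp
    qed
  qed
  moreover have "plane_isometry f" using F_rigid[OF f] by (rule rigid_isometry)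
  ultimately show ?thesis by blast
qed

end

section \<open>Symmetries and the torus\<close>

context labelled_hex
begin

lemma symmetry_pgg: "u \<in> G \<Longrightarrow> symmetry T u"
proof -
  assume u: "u \<in> G"
  obtain d where "rigid d u" using pgg_rigid[OF u] by blast
  moreover have "move u ` T = T"
  proof
    show "move u ` T \<subseteq> T"
      unfolding T_def using pgg_comp[OF u] by (auto simp: move_comp)
    show "T \<subseteq> move u ` T"
    proof
      fix t assume "t \<in> T"
      then obtain g where g: "g \<in> G" "t = tile g" unfolding T_def by blast
      obtain v where v: "v \<in> G" "u \<circ> v = id" using pgg_inverse[OF u] by blast
      have "t = move u (tile (v \<circ> g))"
        unfolding g(2) move_comp comp_assoc[symmetric] v(2) by simp
      moreover have "tile (v \<circ> g) \<in> T" unfolding T_def by (intro imageI pgg_comp v(1) g(1))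
      ultimately show "t \<in> move u ` T" by simp
    qed
  qed
  ultimately show ?thesis unfolding symmetry_def using rigid_isometry by blast
qed

lemma isohedral_T: "isohedral T"
  unfolding isohedral_def
proof (intro ballI)
  fix s t assume "s \<in> T" "t \<in> T"
  then obtain g h where gh: "g \<in> G" "s = tile g" "h \<in> G" "t = tile h"
    unfolding T_def by blast
  obtain g' where g': "g' \<in> G" "g' \<circ> g = id" using pgg_inverse[OF gh(1)] by blast
  have "move (h \<circ> g') s = t" unfolding gh(2,4) move_comp comp_assoc g'(2) by simp
  then show "\<exists>u. symmetry T u \<and> move u s = t"
    using symmetry_pgg[OF pgg_comp[OF gh(3) g'(1)]] by blast
qed

text \<open>\<open>gg a b m n\<close> is a translation exactly for even \<open>m\<close> and
  \<open>n\<close>, hence the factors 2. These translations have index 4 in the group.\<close>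

definition lat :: "complex set" where
  "lat = {of_int m * Complex (2 * a) 0 + of_int n * Complex 0 (2 * b) | m n. True}"

lemma lat_vector: "of_int m * Complex (2 * a) 0 + of_int n * Complex 0 (2 * b) = Complex (2 * m * a) (2 * n * b)"
  by (simp add: complex_eq_iff)

lemma translation_gg: "(+) (of_int m * Complex (2 * a) 0 + of_int n * Complex 0 (2 * b)) = gg a b (2 * m) (2 * n)"
  unfolding lat_vector by (rule ext) (simp add: gg_def ps_def complex_eq_iff)

lemma lat_translation: "l \<in> lat \<Longrightarrow> \<exists>m n. (+) l = gg a b (2 * m) (2 * n)"
  unfolding lat_def using translation_gg by blast

lemma independent_axes: "Complex (2 * a) 0 \<noteq> Complex 0 (2 * b)" "independent {Complex (2 * a) 0, Complex 0 (2 * b)}"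
proof -
  show ne: "Complex (2 * a) 0 \<noteq> Complex 0 (2 * b)" using nondegenerate by (simp add: complex_eq_iff)
  have "Complex (2 * a) 0 \<notin> span {Complex 0 (2 * b)}"
    using nondegenerate by (auto simp: span_singleton complex_eq_iff)
  moreover have "independent {Complex 0 (2 * b)}"
    using nondegenerate by (intro independent_insertI) (auto simp: complex_eq_iff independent_empty)
  ultimately show "independent {Complex (2 * a) 0, Complex 0 (2 * b)}" by (rule independent_insertI)
qed

lemma plane_lattice_lat: "plane_lattice lat"
  unfolding plane_lattice_def lat_def using independent_axes by blast

lemma lattice_invariant_lat: "lattice_invariant lat T"
  unfolding lattice_invariant_def
proof
  fix l assume "l \<in> lat"
  then obtain m n where "(+) l = gg a b (2 * m) (2 * n)" using lat_translation by blast
  then show "symmetry T ((+) l)" using symmetry_pgg[OF gg_in_pgg] by simp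
qed

lemma lat_0: "0 \<in> lat"
  unfolding lat_def by (rule CollectI, rule exI[of _ 0], rule exI[of _ 0]) simp

lemma periodic_T: "periodic T"
proof -
  have "Complex (2 * a) 0 \<in> lat" unfolding lat_def
    by (rule CollectI, rule exI[of _ 1], rule exI[of _ 0]) simp
  moreover have "Complex 0 (2 * b) \<in> lat" unfolding lat_def
    by (rule CollectI, rule exI[of _ 0], rule exI[of _ 1]) simp
  ultimately show ?thesis
    unfolding periodic_def using independent_axes lattice_invariant_lat[unfolded lattice_invariant_def] by blast
qed

definition orb :: "polygon \<Rightarrow> polygon set" where
  "orb t = (\<lambda>l. move ((+) l) t) ` lat"

lemma in_orb_iff:
  "t \<in> orb (tile (gg a b m n)) \<longleftrightarrow> (\<exists>i j. t = tile (gg a b (2 * i + m) (2 * j + n)))"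
proof -
  have c: "gg a b (2 * i) (2 * j) \<circ> gg a b m n = gg a b (2 * i + m) (2 * j + n)" for i j
    by (simp add: gg_comp ps_def)
  have "orb (tile (gg a b m n)) = {tile (gg a b (2 * i) (2 * j) \<circ> gg a b m n) | i j. True}"
  proof (intro set_eqI iffI)
    fix t assume "t \<in> orb (tile (gg a b m n))"
    then obtain l where l: "l \<in> lat" "t = tile ((+) l \<circ> gg a b m n)"
      unfolding orb_def move_comp by blast
    then show "t \<in> {tile (gg a b (2 * i) (2 * j) \<circ> gg a b m n) | i j. True}"
      using lat_translation[OF l(1)] by force
  next
    fix t assume "t \<in> {tile (gg a b (2 * i) (2 * j) \<circ> gg a b m n) | i j. True}"
    then obtain i j where t: "t = tile (gg a b (2 * i) (2 * j) \<circ> gg a b m n)" by blast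
    have "of_int i * Complex (2 * a) 0 + of_int j * Complex 0 (2 * b) \<in> lat" unfolding lat_def by blast
    then show "t \<in> orb (tile (gg a b m n))"
      unfolding orb_def move_comp t translation_gg[symmetric] by blast
  qed
  then show ?thesis unfolding c by blast
qed

text \<open>By \<open>tile_inj\<close> and \<open>gg_eq\<close> the tiles correspond to the pairs of
  indices, on which translations act by adding even numbers.\<close>

lemma orb_eq_iff:
  "orb (tile (gg a b m n)) = orb (tile (gg a b m' n')) \<longleftrightarrow>
    even (m - m') \<and> even (n - n')"
proof
  assume eq: "orb (tile (gg a b m n)) = orb (tile (gg a b m' n'))"
  have "tile (gg a b m n) \<in> orb (tile (gg a b m n))"
    unfolding in_orb_iff by (rule exI[of _ 0], rule exI[of _ 0]) simp
  then obtain i j where "tile (gg a b m n) = tile (gg a b (2 * i + m') (2 * j + n'))"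
    unfolding eq in_orb_iff by blast
  then have "gg a b m n = gg a b (2 * i + m') (2 * j + n')" by (rule tile_inj[OF gg_rigid gg_rigid])
  then show "even (m - m') \<and> even (n - n')" unfolding gg_eq[OF nondegenerate] by simp
next
  assume "even (m - m') \<and> even (n - n')"
  then have "2 dvd m - m'" "2 dvd n - n'" by simp_all
  then obtain i j where ij: "m - m' = 2 * i" "n - n' = 2 * j" unfolding dvd_def by blast
  then have m: "m = 2 * i + m'" "n = 2 * j + n'" by simp_all
  show "orb (tile (gg a b m n)) = orb (tile (gg a b m' n'))"
  proof (rule set_eqI)
    fix t
    have "(\<exists>x y. t = tile (gg a b (2 * x + m) (2 * y + n))) \<longleftrightarrow>
        (\<exists>x y. t = tile (gg a b (2 * x + m') (2 * y + n')))"
    proof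
      assume "\<exists>x y. t = tile (gg a b (2 * x + m) (2 * y + n))"
      then obtain x y where "t = tile (gg a b (2 * x + m) (2 * y + n))" by blast
      then show "\<exists>x y. t = tile (gg a b (2 * x + m') (2 * y + n'))"
        unfolding m by (intro exI[of _ "x + i"] exI[of _ "y + j"]) (simp add: algebra_simps)
    next
      assume "\<exists>x y. t = tile (gg a b (2 * x + m') (2 * y + n'))"
      then obtain x y where "t = tile (gg a b (2 * x + m') (2 * y + n'))" by blast
      then show "\<exists>x y. t = tile (gg a b (2 * x + m) (2 * y + n))"
        unfolding m by (intro exI[of _ "x - i"] exI[of _ "y - j"]) (simp add: algebra_simps)
    qed
    then show "t \<in> orb (tile (gg a b m n)) \<longleftrightarrow> t \<in> orb (tile (gg a b m' n'))"
      unfolding in_orb_iff .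
  qed
qed

lemma card_torus: "card (snd (induced_torus_tiling lat T)) = 4"
proof -
  define o' where "o' m n = orb (tile (gg a b m n))" for m n
  have "snd (induced_torus_tiling lat T) = orb ` T"
    by (simp add: induced_torus_tiling_def orb_def[abs_def])
  also have "\<dots> = {o' m n | m n. True}" unfolding T_def pgg_def o'_def by auto
  also have "\<dots> = {o' 0 0, o' 1 0, o' 0 1, o' 1 1}"
  proof
    show "{o' m n | m n. True} \<subseteq> {o' 0 0, o' 1 0, o' 0 1, o' 1 1}"
    proof
      fix x assume "x \<in> {o' m n | m n. True}"
      then obtain m n where x: "x = o' m n" by blast
      have "x = o' (m mod 2) (n mod 2)" unfolding x o'_def orb_eq_iff by (simp add: minus_mod_eq_mult_div)
      moreover have "m mod 2 = 0 \<or> m mod 2 = 1" "n mod 2 = 0 \<or> n mod 2 = 1" by presburger+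
      ultimately show "x \<in> {o' 0 0, o' 1 0, o' 0 1, o' 1 1}" by auto
    qed
  qed blast
  finally have eq: "snd (induced_torus_tiling lat T) = {o' 0 0, o' 1 0, o' 0 1, o' 1 1}" .
  show ?thesis unfolding eq by (simp add: o'_def orb_eq_iff)
qed

lemma plane_covers_T: "plane_covers (hexagon p) T (induced_torus_tiling lat T)"
  unfolding plane_covers_def using plane_tiling_T plane_lattice_lat lattice_invariant_lat by blast

text \<open>Needed because \<open>torus_covers\<close> quantifies over the plane tiling: its witness
  has to be identified with \<open>T\<close>.\<close>

lemma induced_Union:
  assumes "lattice_invariant L U" "0 \<in> L" shows "\<Union>(snd (induced_torus_tiling L U)) = U"
proof
  have "move ((+) l) t \<in> U" if "l \<in> L" "t \<in> U" for l t
    using assms(1) that unfolding lattice_invariant_def symmetry_def by blast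
  then show "\<Union>(snd (induced_torus_tiling L U)) \<subseteq> U" by (auto simp: induced_torus_tiling_def)
  show "U \<subseteq> \<Union>(snd (induced_torus_tiling L U))"
  proof
    fix t assume t: "t \<in> U"
    have "(+) (0::complex) = id" by (rule ext) simp
    then have "t = move ((+) 0) t" by (simp add: move_id)
    then have "t \<in> (\<lambda>l. move ((+) l) t) ` L" using assms(2) by (rule image_eqI)
    then show "t \<in> \<Union>(snd (induced_torus_tiling L U))" using t by (auto simp: induced_torus_tiling_def)
  qed
qed

text \<open>The image of \<open>tile id\<close> is some \<open>tile g\<close>, and
  \<open>tile_inj\<close> turns this into equality of the maps. A translation has linear part 1, so
  both signs of \<open>g\<close> are 1 and both indices even.\<close>

lemma translation_symmetry_lat:
  assumes "symmetry T ((+) l)" shows "l \<in> lat"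
proof -
  have "tile id \<in> T" unfolding T_def by (intro imageI id_in_pgg)
  then have "move ((+) l) (tile id) \<in> T" using assms unfolding symmetry_def by blast
  then obtain g where g: "g \<in> G" "tile ((+) l) = tile g"
    unfolding T_def by (auto simp: move_comp)
  obtain m n where mn: "g = gg a b m n" using g(1) by (rule pggE)
  have "rigid True ((+) l)" by (rule rigidI[of 1 _ _ l]) auto
  then have eq: "(+) l = gg a b m n" using tile_inj[OF _ gg_rigid] g(2) unfolding mn by blast
  have 0: "l = gg a b m n 0" and 1: "l + 1 = gg a b m n 1" and i: "l + \<i> = gg a b m n \<i>"
    using fun_cong[OF eq, of 0] fun_cong[OF eq, of 1] fun_cong[OF eq, of \<i>] by simp_all
  have "ps n = 1" using 0 1 by (simp add: gg_def complex_eq_iff)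
  moreover have "ps m = 1" using 0 i by (simp add: gg_def complex_eq_iff)
  ultimately have "even m" "even n" by (auto simp: ps_def split: if_splits)
  then obtain x y where xy: "m = 2 * x" "n = 2 * y" by (auto elim!: evenE)
  have "l = of_int x * Complex (2 * a) 0 + of_int y * Complex 0 (2 * b)"
    unfolding lat_vector 0 xy gg_def by simp
  then show ?thesis unfolding lat_def by blast
qed

text \<open>Any covered torus tiling comes from a lattice of translation symmetries of
  \<open>T\<close> containing \<open>lat\<close>, and \<open>lat\<close> already contains all such
  translations.\<close>

lemma minimal_T: "minimal_torus_tiling (hexagon p) (induced_torus_tiling lat T)"
  unfolding minimal_torus_tiling_def
proof (intro conjI allI impI)
  show "is_torus_tiling (hexagon p) (induced_torus_tiling lat T)"
    unfolding is_torus_tiling_def using plane_covers_T by blast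
  fix Y assume "torus_covers (hexagon p) (induced_torus_tiling lat T) Y"
  then obtain U where U: "plane_covers (hexagon p) U (induced_torus_tiling lat T)"
    "plane_covers (hexagon p) U Y" "fst (induced_torus_tiling lat T) \<subseteq> fst Y"
    unfolding torus_covers_def by blast
  obtain L where L: "lattice_invariant L U" "induced_torus_tiling lat T = induced_torus_tiling L U"
    using U(1) unfolding plane_covers_def by blast
  have "lat = L" using arg_cong[OF L(2), of fst] by (simp add: induced_torus_tiling_def)
  have "\<Union>(snd (induced_torus_tiling L U)) = U"
    using induced_Union[OF L(1)] lat_0 \<open>lat = L\<close> by simp
  moreover have "\<Union>(snd (induced_torus_tiling L U)) = T"
    unfolding L(2)[symmetric] by (rule induced_Union[OF lattice_invariant_lat lat_0])
  ultimately have UT: "U = T" by simp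
  obtain L' where L': "lattice_invariant L' T" "Y = induced_torus_tiling L' T"
    using U(2) unfolding plane_covers_def UT by blast
  have "L' \<subseteq> lat" using L'(1) translation_symmetry_lat unfolding lattice_invariant_def by blast
  moreover have "lat \<subseteq> L'" using U(3) unfolding L'(2) by (simp add: induced_torus_tiling_def)
  ultimately have "L' = lat" by (rule antisym)
  then show "induced_torus_tiling lat T = Y" using L'(2) by simp
qed

end

section \<open>Normalization\<close>

lemma rigid_inside:
  assumes f: "rigid d f" shows "inside (f ` S) = f ` inside S"
proof -
  have sub: "f ` inside S \<subseteq> inside (f ` S)" if f: "rigid d f" for f S
  proof
    fix y assume "y \<in> f ` inside S"
    then obtain x where x: "x \<in> inside S" "y = f x" by blast
    then have xS: "x \<notin> S" and bx: "bounded (connected_component_set (- S) x)" unfolding inside_def by auto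
    obtain g where g: "rigid d g" "f \<circ> g = id" "g \<circ> f = id" using rigid_inverse[OF f] .
    have gf: "g (f z) = z" "f (g z) = z" for z using g(2,3) by (metis comp_apply id_apply)+
    let ?C = "connected_component_set (- f ` S) (f x)"
    have fx: "f x \<notin> f ` S" using xS rigid_inj[OF f] by (simp add: inj_image_mem_iff)
    have "connected (g ` ?C)"
      by (intro connected_continuous_image rigid_continuous[OF g(1)] connected_connected_component)
    moreover have "x \<in> g ` ?C" using fx gf(1) by (intro image_eqI[of _ _ "f x"]) simp_all
    moreover have "g ` ?C \<subseteq> - S"
    proof
      fix z assume "z \<in> g ` ?C"
      then obtain w where w: "w \<in> ?C" "z = g w" by blast
      then have "w \<notin> f ` S" using connected_component_subset by blast
      then show "z \<in> - S" using w(2) gf(2)[of w] by force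
    qed
    ultimately have "g ` ?C \<subseteq> connected_component_set (- S) x" by (intro connected_component_maximal)
    then have "f ` g ` ?C \<subseteq> f ` connected_component_set (- S) x" by (rule image_mono)
    moreover have "f ` g ` ?C = ?C" by (simp add: image_image gf)
    moreover have "bounded (f ` connected_component_set (- S) x)"
    proof -
      obtain c e where "\<forall>z\<in>connected_component_set (- S) x. dist c z \<le> e" using bx unfolding bounded_def by blast
      then show ?thesis unfolding bounded_def using rigid_imp_dist[OF f]
        by (intro exI[of _ "f c"] exI[of _ e]) auto
    qed
    ultimately have "bounded ?C" using bounded_subset by metis
    then show "y \<in> inside (f ` S)" using fx unfolding x(2) inside_def by simp
  qed
  obtain g where g: "rigid d g" "f \<circ> g = id" "g \<circ> f = id" using rigid_inverse[OF f] .
  have gf: "g (f z) = z" "f (g z) = z" for z using g(2,3) by (metis comp_apply id_apply)+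
  have "g ` inside (f ` S) \<subseteq> inside (g ` f ` S)" by (rule sub[OF g(1)])
  then have "f ` g ` inside (f ` S) \<subseteq> f ` inside (g ` f ` S)" by (rule image_mono)
  then have "inside (f ` S) \<subseteq> f ` inside S" by (simp add: image_image gf)
  then show ?thesis using sub[OF f, of S] by blast
qed

lemma hexagon_path_rigid:
  assumes f: "rigid True f"
  shows "hexagon_path (f \<circ> p) = f \<circ> hexagon_path p" "simple_hexagon (f \<circ> p) \<longleftrightarrow> simple_hexagon p"
proof -
  obtain u w where u: "norm u = 1" and fz: "\<And>z. f z = u * z + w"
    using f unfolding rigid_def by auto
  have "linepath (f x) (f y) = f \<circ> linepath x y" for x y
    by (rule ext) (simp add: linepath_def fz scaleR_conv_of_real algebra_simps)
  then show eq: "hexagon_path (f \<circ> p) = f \<circ> hexagon_path p"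
    by (simp add: hexagon_path_def path_compose_join)
  have ff: "f = (\<lambda>x. w + x) \<circ> (\<lambda>z. u * z)" by (rule ext) (simp add: fz)
  have "u \<noteq> 0" using u by auto
  then have "inj (\<lambda>z. u * z)" by (simp add: inj_def)
  moreover have "linear (\<lambda>z. u * z)" by (rule linearI) (simp_all add: algebra_simps)
  ultimately have "simple_path (f \<circ> g) \<longleftrightarrow> simple_path g" for g
    unfolding ff comp_assoc simple_path_translation_eq by (intro simple_path_linear_image_eq)
  then show "simple_hexagon (f \<circ> p) \<longleftrightarrow> simple_hexagon p" unfolding simple_hexagon_def eq .
qed

lemma hexagon_rigid:
  assumes f: "rigid True f" shows "hexagon (f \<circ> p) = move f (hexagon p)"
proof -
  have "path_image (hexagon_path (f \<circ> p)) = f ` path_image (hexagon_path p)"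
    unfolding hexagon_path_rigid(1)[OF f] by (rule path_image_compose)
  moreover have "side (f \<circ> p) i = f ` side p i" for i
    by (simp add: side_def rigid_segment(1)[OF f])
  ultimately show ?thesis
    by (simp add: hexagon_def move_def rigid_inside[OF f] image_Un image_comp comp_def)
qed

lemma congruent_copy_move:
  assumes f: "rigid d f" shows "congruent_copy (move f P) = congruent_copy P"
proof (intro ext iffI)
  fix t
  obtain g where g: "rigid d g" "g \<circ> f = id" using rigid_inverse[OF f] by metis
  show "congruent_copy P t" if c: "congruent_copy (move f P) t"
  proof -
    obtain h where h: "plane_isometry h" "t = move h (move f P)" using c unfolding congruent_copy_def by blast
    then obtain e where "rigid e h" using plane_isometry_iff_rigid by blast
    then have "plane_isometry (h \<circ> f)" using rigid_comp[OF _ f] rigid_isometry by blast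
    then show ?thesis using h(2) unfolding congruent_copy_def move_comp by blast
  qed
  show "congruent_copy (move f P) t" if c: "congruent_copy P t"
  proof -
    obtain h where h: "plane_isometry h" "t = move h P" using c unfolding congruent_copy_def by blast
    then obtain e where "rigid e h" using plane_isometry_iff_rigid by blast
    then have "plane_isometry (h \<circ> g)" using rigid_comp[OF _ g(1)] rigid_isometry by blast
    moreover have "t = move (h \<circ> g) (move f P)" unfolding h(2) move_comp comp_assoc g(2) by simp
    ultimately show ?thesis unfolding congruent_copy_def by blast
  qed
qed

lemma cis_Arg2pi: "z \<noteq> 0 \<Longrightarrow> cis (Arg2pi z) = sgn z"
proof -
  assume z: "z \<noteq> 0"
  have "z = of_real (norm z) * cis (Arg2pi z)" using Arg2pi_eq[of z] by (simp add: cis_conv_exp)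
  then have "z / of_real (norm z) = cis (Arg2pi z)"
    using z by (metis nonzero_mult_div_cancel_left norm_eq_zero of_real_eq_0_iff)
  then show ?thesis by (simp add: sgn_eq)
qed

context simple_hex
begin

lemma interior_angle_dir:
  assumes k: "k < 6"
  shows "cis (interior_angle p k) = (if counterclockwise p then corner_dir p k else cnj (corner_dir p k))"
    "0 \<le> interior_angle p k" "interior_angle p k < 2 * pi"
proof -
  define A where "A = (p ((k + 5) mod 6) - p k) / (p (nx k) - p k)"
  have i: "(k + 5) mod 6 < 6" "(k + 5) mod 6 \<noteq> k" "nx k < 6" "nx k \<noteq> k"
    using k by presburger+
  then have A0: "A \<noteq> 0" using corner_eq k by (simp add: A_def)
  have ia: "interior_angle p k = (if counterclockwise p then Arg2pi A else Arg2pi (1 / A))"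
    unfolding interior_angle_def Let_def A_def using k by (simp add: Suc_eq_plus1)
  show "cis (interior_angle p k) = (if counterclockwise p then corner_dir p k else cnj (corner_dir p k))"
    unfolding ia corner_dir_def A_def[symmetric]
    using cis_Arg2pi[OF A0] cis_Arg2pi[of "1 / A"] sgn_inverse_cnj[OF A0] A0 by simp
  show "0 \<le> interior_angle p k" "interior_angle p k < 2 * pi"
    unfolding ia using Arg2pi_ge_0 Arg2pi_lt_2pi by auto
qed

lemma angle_sum_dir:
  assumes "i < 6" "j < 6" "k < 6"
    and "interior_angle p i + interior_angle p j + interior_angle p k = 2 * pi"
  shows "corner_dir p i * corner_dir p j * corner_dir p k = 1"
proof -
  have "cis (interior_angle p i) * cis (interior_angle p j) * cis (interior_angle p k) = cis (2 * pi)"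
    unfolding assms(4)[symmetric] by (simp add: cis_mult)
  then have 1: "cis (interior_angle p i) * cis (interior_angle p j) * cis (interior_angle p k) = 1" by simp
  show ?thesis
  proof (cases "counterclockwise p")
    case True
    then show ?thesis using 1 by (simp add: interior_angle_dir(1) assms(1-3))
  next
    case False
    then have "cnj (corner_dir p i * corner_dir p j * corner_dir p k) = 1"
      using 1 by (simp add: interior_angle_dir(1) assms(1-3))
    then show ?thesis by (metis complex_cnj_cnj complex_cnj_one)
  qed
qed

lemma angle_ne_dir:
  assumes "j < 6" "k < 6" "interior_angle p j \<noteq> interior_angle p k"
  shows "corner_dir p j \<noteq> corner_dir p k"
proof
  assume "corner_dir p j = corner_dir p k"
  then have c: "cis (interior_angle p j) = cis (interior_angle p k)"
    by (simp add: interior_angle_dir(1) assms(1,2))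
  have "interior_angle p j = Arg2pi (cis (interior_angle p j))" if "j < 6" for j
    using interior_angle_dir(2,3)[OF that]
    by (intro Arg2pi_unique[symmetric, of 1]) (simp_all add: cis_conv_exp)
  then show False using assms c by metis
qed

text \<open>By the equal lengths the maps that carry side 3 to side 1 and side 5 to side 2 have the
  linear factors \<open>e1 / cnj e3\<close> and \<open>e2 / cnj e5\<close> of modulus 1. The angle
  condition yields \<open>e2 * cnj e3 = - e1 * cnj e5\<close>, so these factors are opposite. A
  rotation and a shift then move the axes to the coordinate axes.\<close>

lemma normalization:
  assumes len: "side_length p 1 = side_length p 3" "side_length p 2 = side_length p 5"
    and dir: "corner_dir p 0 * corner_dir p 1 * corner_dir p 3 = 1"
  obtains f a b where "rigid True f" "paired a b (f \<circ> p)"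
proof -
  define e0 e1 e2 e3 e5 where "e0 = p 1 - p 0" and "e1 = p 2 - p 1" and "e2 = p 3 - p 2"
    and "e3 = p 4 - p 3" and "e5 = p 0 - p 5"
  have nz: "e0 \<noteq> 0" "e1 \<noteq> 0" "e2 \<noteq> 0" "e3 \<noteq> 0" "e5 \<noteq> 0"
    using side_intersections(1,5,6,10,13) by (auto simp: e0_def e1_def e2_def e3_def e5_def)
  have n: "norm e1 = norm e3" "norm e2 = norm e5"
    using len by (simp_all add: side_length_def e1_def e2_def e3_def e5_def dist_norm norm_minus_commute)
  \<comment> \<open>The product of the side quotients at the corners 0, 1 and 3, in which
    \<open>e0\<close> cancels. The angle condition makes it a positive real, and the lengths give
    its value.\<close>
  define W where "W = - (e5 * e2) / (e1 * e3)"
  have "corner_dir p 0 = sgn (- e5 / e0)" "corner_dir p 1 = sgn (- e0 / e1)" "corner_dir p 3 = sgn (- e2 / e3)"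
    by (simp_all add: corner_dir_def e0_def e1_def e2_def e3_def e5_def Suc_mod_6)
  then have "sgn ((- e5 / e0) * (- e0 / e1) * (- e2 / e3)) = 1" using dir by (simp only: sgn_mult)
  also have "(- e5 / e0) * (- e0 / e1) * (- e2 / e3) = W" using nz by (simp add: W_def)
  finally have "W / of_real (norm W) = 1" by (simp add: sgn_eq)
  then have W: "W = of_real (norm W)" by (metis divide_eq_1_iff)
  have "norm W = (norm e5)\<^sup>2 / (norm e3)\<^sup>2"
    unfolding W_def by (simp add: norm_divide norm_mult n power2_eq_square)
  then have "W = (e5 * cnj e5) / (e3 * cnj e3)"
    using W by (simp add: complex_norm_square[symmetric])
  then have "- (e5 * e2) * (e3 * cnj e3) = (e5 * cnj e5) * (e1 * e3)"
    unfolding W_def using nz by (subst (asm) frac_eq_eq) auto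
  moreover have "(e5 * e3) * (e2 * cnj e3 + e1 * cnj e5) =
      (e5 * cnj e5) * (e1 * e3) - (- (e5 * e2) * (e3 * cnj e3))"
    by (simp add: algebra_simps)
  ultimately have "(e5 * e3) * (e2 * cnj e3 + e1 * cnj e5) = 0" by simp
  then have "e2 * cnj e3 = - e1 * cnj e5" using nz by (simp add: eq_neg_iff_add_eq_0)
  moreover have "e2 = e2 * cnj e3 / cnj e3" using nz by simp
  ultimately have e2: "e2 = - (e1 / cnj e3) * cnj e5" by simp
  define \<alpha> where "\<alpha> = e1 / cnj e3"
  have "norm \<alpha> = 1" using n nz by (simp add: \<alpha>_def norm_divide)
  have \<alpha>1: "\<alpha> * cnj e3 = e1" using nz by (simp add: \<alpha>_def)
  have \<alpha>2: "- \<alpha> * cnj e5 = e2" using e2 by (simp add: \<alpha>_def)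
  \<comment> \<open>The axis of z -> \<alpha> * cnj z + c has half the argument of \<alpha>, so
    dividing by the square root makes it horizontal.\<close>
  define \<eta> where "\<eta> = csqrt \<alpha>"
  have \<eta>2: "\<eta> * \<eta> = \<alpha>" unfolding \<eta>_def by (metis power2_csqrt power2_eq_square)
  then have "norm \<eta> * norm \<eta> = 1" using \<open>norm \<alpha> = 1\<close> by (metis norm_mult)
  then have "(norm \<eta>)\<^sup>2 = 1" by (simp add: power2_eq_square)
  then have n\<eta>: "norm \<eta> = 1" using norm_ge_zero[of \<eta>] by (auto simp: power2_eq_1_iff)
  then have \<eta>1: "\<eta> * cnj \<eta> = 1" by (simp add: complex_norm_square[symmetric])
  have \<eta>3: "cnj \<eta> * (\<alpha> * w) = \<eta> * w" for w
    unfolding \<eta>2[symmetric] using \<eta>1 by (metis mult.assoc mult.commute mult_1)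
  define c1 c2 where "c1 = p 1 - \<alpha> * cnj (p 3)" and "c2 = p 3 + \<alpha> * cnj (p 0)"
  define a b where "a = Re (cnj \<eta> * c1)" and "b = Im (cnj \<eta> * c2)"
  \<comment> \<open>The axis of z -> cnj z + c is Im z = Im c / 2, and that of z -> - cnj z + c is
    Re z = Re c / 2. The shift moves both to the coordinate axes, and the glide lengths
    \<open>a\<close> and \<open>b\<close> remain.\<close>
  define \<kappa> where "\<kappa> = Complex (Re (cnj \<eta> * c2) / 2) (Im (cnj \<eta> * c1) / 2)"
  define f where "f z = cnj \<eta> * z - \<kappa>" for z
  have f: "rigid True f" by (rule rigidI[of "cnj \<eta>" _ _ "- \<kappa>"]) (simp_all add: n\<eta> f_def)
  have k1: "f (\<alpha> * cnj z + c1) = gg a b 1 0 (f z)" for z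
  proof -
    have "f (\<alpha> * cnj z + c1) = \<eta> * cnj z + (cnj \<eta> * c1 - \<kappa>)" by (simp add: f_def distrib_left \<eta>3)
    moreover have "gg a b 1 0 w = cnj w + of_real a" for w by (simp add: gg_def ps_def complex_eq_iff)
    moreover have "cnj (f z) = \<eta> * cnj z - cnj \<kappa>" by (simp add: f_def)
    moreover have "x - Complex r (Im x / 2) = of_real (Re x) - cnj (Complex r (Im x / 2))" for x r
      by (simp add: complex_eq_iff)
    then have "cnj \<eta> * c1 - \<kappa> = of_real a - cnj \<kappa>" unfolding a_def \<kappa>_def .
    ultimately show ?thesis by simp
  qed
  have k2: "f (- \<alpha> * cnj z + c2) = gg a b 0 1 (f z)" for z
  proof -
    have "f (- \<alpha> * cnj z + c2) = - (\<eta> * cnj z) + (cnj \<eta> * c2 - \<kappa>)"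
    proof -
      have "f (- \<alpha> * cnj z + c2) = - (cnj \<eta> * (\<alpha> * cnj z)) + (cnj \<eta> * c2 - \<kappa>)"
        by (simp add: f_def algebra_simps)
      then show ?thesis unfolding \<eta>3 .
    qed
    moreover have "gg a b 0 1 w = - cnj w + \<i> * of_real b" for w by (simp add: gg_def ps_def complex_eq_iff)
    moreover have "cnj (f z) = \<eta> * cnj z - cnj \<kappa>" by (simp add: f_def)
    moreover have "x - Complex (Re x / 2) r = \<i> * of_real (Im x) + cnj (Complex (Re x / 2) r)" for x r
      by (simp add: complex_eq_iff)
    then have "cnj \<eta> * c2 - \<kappa> = \<i> * of_real b + cnj \<kappa>" unfolding b_def \<kappa>_def .
    ultimately show ?thesis by simp
  qed
  have "\<alpha> * cnj (p 3) + c1 = p 1" "- \<alpha> * cnj (p 0) + c2 = p 3" by (simp_all add: c1_def c2_def)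
  moreover have "\<alpha> * cnj (p 4) + c1 = p 2" using \<alpha>1 by (simp add: c1_def e3_def e1_def algebra_simps)
  moreover have "- \<alpha> * cnj (p 5) + c2 = p 2" using \<alpha>2 by (simp add: c2_def e5_def e2_def algebra_simps)
  ultimately have "paired a b (f \<circ> p)" unfolding paired_def o_apply using k1 k2 by metis
  then show thesis using that f by blast
qed

end

text \<open>Each of these notions depends on the polygon through its congruent copies only, which
  lets the normalized hexagon stand for the given one.\<close>

lemma tiling_notions_cong:
  assumes "congruent_copy P = congruent_copy Q"
  shows "degree3_tiling P = degree3_tiling Q" "plane_covers P = plane_covers Q"
    "minimal_torus_tiling P = minimal_torus_tiling Q"
proof -
  have t: "plane_tiling P = plane_tiling Q" by (rule ext) (simp only: plane_tiling_def assms)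
  show "degree3_tiling P = degree3_tiling Q" by (rule ext) (simp only: degree3_tiling_def t)
  show c: "plane_covers P = plane_covers Q" by (intro ext) (simp only: plane_covers_def t)
  show "minimal_torus_tiling P = minimal_torus_tiling Q"
    by (rule ext) (simp only: minimal_torus_tiling_def is_torus_tiling_def torus_covers_def c)
qed

theorem theorem2p2:
  fixes p :: "nat \<Rightarrow> complex"
  assumes "simple_hexagon p"
    and "interior_angle p 0 + interior_angle p 1 + interior_angle p 3 = 2 * pi"
    and "interior_angle p 2 + interior_angle p 4 + interior_angle p 5 = 2 * pi"
    and "side_length p 1 = side_length p 3"
    and "side_length p 2 = side_length p 5"
    and "\<forall>j \<in> {..<6} - {0}. side_length p 0 \<noteq> side_length p j"
    and "\<forall>j \<in> {..<6} - {4}. side_length p 4 \<noteq> side_length p j"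
    and "side_length p 1 \<noteq> side_length p 2"
    and "interior_angle p 2 \<noteq> interior_angle p 3"
  shows "\<exists>T. degree3_tiling (hexagon p) T \<and>
           (\<forall>T'. degree3_tiling (hexagon p) T' \<longrightarrow> (\<exists>g. plane_isometry g \<and> T' = move g ` T)) \<and>
           isohedral T \<and> periodic T \<and>
           (\<exists>X. plane_covers (hexagon p) T X \<and> minimal_torus_tiling (hexagon p) X \<and>
                card (snd X) = 4)"
proof -
  interpret P: simple_hex p by unfold_locales (rule assms(1))
  have dir: "corner_dir p 0 * corner_dir p 1 * corner_dir p 3 = 1"
    "corner_dir p 2 * corner_dir p 4 * corner_dir p 5 = 1" "corner_dir p 2 \<noteq> corner_dir p 3"
    using P.angle_sum_dir[OF _ _ _ assms(2)] P.angle_sum_dir[OF _ _ _ assms(3)] P.angle_ne_dir[OF _ _ assms(9)]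
    by simp_all
  obtain f a b where f: "rigid True f" and ab: "paired a b (f \<circ> p)"
    using P.normalization[OF assms(4,5) dir(1)] .
  \<comment> \<open>Since \<open>f\<close> keeps the orientation, lengths and corner directions
    carry over to \<open>q\<close> unchanged.\<close>
  define q where "q = f \<circ> p"
  have len: "side_length q k = side_length p k" for k
    by (simp add: side_length_def q_def rigid_imp_dist[OF f])
  have dirq: "corner_dir q k = corner_dir p k" for k
    by (simp add: corner_dir_def q_def rigid_ratio[OF f])
  interpret Q: labelled_hex q a b
  proof
    show "simple_hexagon q" unfolding q_def hexagon_path_rigid(2)[OF f] by (rule assms(1))
    show "paired a b q" unfolding q_def by (rule ab)
  qed (use assms(4-8) dir in \<open>auto simp: len dirq\<close>)
  have "congruent_copy (hexagon q) = congruent_copy (hexagon p)"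
    unfolding q_def hexagon_rigid[OF f] by (rule congruent_copy_move[OF f])
  note C = tiling_notions_cong[OF this]
  have "\<exists>g. plane_isometry g \<and> T' = move g ` Q.T" if "degree3_tiling (hexagon q) T'" for T'
  proof -
    interpret U: deg3_hex q a b T' by unfold_locales (rule that)
    show ?thesis by (rule U.T'_unique)
  qed
  then show ?thesis
    unfolding C[symmetric]
    using Q.degree3_tiling_T Q.isohedral_T Q.periodic_T Q.plane_covers_T Q.minimal_T Q.card_torus
    by blast
qed

end
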